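(* Consider the following list of triples $(k; Q; m)$, where $k,m$ are positive integers and $Q$ is a set of prime powers; in the description of $Q$ an entry $p^s$ (with $p$ a specific prime) means that all powers $p^s$, $s\geq 1$, belong to $Q$. $k=3$: $(3;\{2,4,3^s\};3)$, $(3;\{2,4,7,3^s\};2)$. $k=4$: $(4;\{3,9,2^s\};5)$, $(4;\{3,5,9,2^s\};4)$, $(4;\{3,5,9,13,17,25,29,2^s\};3)$. $k=5$: $(5;\{2,4,16,5^s\};5)$, $(5;\{2,4,11,16,5^s\};3)$, $(5;\{2,4,11,16,31,41,61,5^s\};2)$. $k=6$: $(6;\{2,4,5,25,2^s,3^s\};7)$, $(6;\{2,4,5,7,13,25,2^s,3^s\};5)$, $(6;\{2,4,5,7,13,19,25,31,2^s,3^s\};4)$, $(6;\{2,4,5,7,13,19,25,31,37,43,49,61,67,73,79,109,139,223,2^s,3^s\};3)$. $k=7$: $(7;\{2,8,7^s\};4)$, $(7;\{2,8,29,43,7^s\};3)$, $(7;\{2,4,8,29,43,64,71,113,127,7^s\};2)$. $k=8$: $(8;\{3,7,9,49,2^s\};9)$, $(8;\{3,7,9,17,49,2^s\};5)$, $(8;\{3,5,7,9,17,25,41,49,2^s\};4)$, $(8;\{3,5,7,9,11,13,17,25,29,41,49,73,81,89,97,113,121,137,233,257,289,337,761,2^s\};3)$. $k=9$: $(9;\{2,4,8,64,3^s\};9)$, $(9;\{2,4,8,19,64,3^s\};5)$, $(9;\{2,4,8,19,37,64,3^s\};3)$, $(9;\{2,4,7,8,19,37,64,73,109,127,163,181,199,271,307,343,3^s\};2)$.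 $k=10$: $(10;\{2,3,4,9,16,81,2^s,5^s\};11)$, $(10;\{2,3,4,9,11,16,81,2^s,5^s\};6)$, $(10;\{2,3,4,9,11,16,31,81,2^s,5^s\};5)$, $(10;\{2,3,4,9,11,16,31,41,61,81,2^s,5^s\};4)$, $(10;\{2,3,4,9,11,16,31,41,61,71,81,101,121,131,151,181,191,211,241,251,271,281,311,331,401,421,431,461,491,641,911,2^s,5^s\};3)$. $k=11$: $(11;\{23,11^s\};5)$, $(11;\{23,67,11^s\};4)$, $(11;\{23,67,89,11^s\};3)$, $(11;\{23,67,89,199,331,353,419,463,617,11^s\};2)$. Then for every triple $(k;Q;m)$ in the list, every finite field $\mathbb{F}_q$ with $q\notin Q$, and every positive integer $n$, every element of $\operatorname{Mat}_n(\mathbb{F}_q)$ can be written as a sum of $m$ many $k$-th powers of elements of $\operatorname{Mat}_n(\mathbb{F}_q)$. In fact, in this case, for every $A\in\operatorname{Mat}_n(\mathbb{F}_q)$ there exist $B_1,\dots,B_m\in\mathbb{F}_q[A]$ with $A=B_1^k+B_2^k+\cdots+B_m^k$.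
   Context: $\mathbb{F}_q$ is the finite field with $q$ elements and $\operatorname{Mat}_n(\mathbb{F}_q)$ is the ring of $n\times n$ matrices over it. For $A\in\operatorname{Mat}_n(\mathbb{F}_q)$, $\mathbb{F}_q[A]=\{P(A)\mid P(x)\in\mathbb{F}_q[x]\}$. The summands $B_i$ are allowed to be zero. *)

theory Defs
  imports
    "HOL-Library.Cardinality"
    "Jordan_Normal_Form.Matrix"
    "HOL-Computational_Algebra.Polynomial"
begin

text \<open>\<open>P(A)\<close>, evaluated in the ring of square matrices of the size of \<open>A\<close>; only meaningful if
  \<open>A\<close> is square, since \<^const>\<open>finsum\<close> requires its summands to lie in the carrier.\<close>

definition poly_mat :: "'a :: comm_ring_1 poly \<Rightarrow> 'a mat \<Rightarrow> 'a mat" where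
  "poly_mat P A =
     finsum (ring_mat TYPE('a) (dim_row A) ()) (\<lambda>i. coeff P i \<cdot>\<^sub>m (A ^\<^sub>m i)) {..degree P}"

definition poly_algebra_mat :: "'a :: comm_ring_1 mat \<Rightarrow> 'a mat set" where
  "poly_algebra_mat A = {poly_mat P A | P. True}"

text \<open>\<open>with_powers S P\<close> is the set \<open>Q\<close> written \<open>{S, p\<^sup>s (p \<in> P)}\<close>: besides the numbers
  in \<open>S\<close> it contains every power \<open>p\<^sup>s\<close> with \<open>s \<ge> 1\<close> of each \<open>p \<in> P\<close>.\<close>

definition with_powers :: "nat set \<Rightarrow> nat set \<Rightarrow> nat set" where
  "with_powers S P = S \<union> {p ^ s | p s. p \<in> P \<and> 1 \<le> s}"

text \<open>Triples \<open>(k, Q, m)\<close> with \<open>Q\<close> the set of excluded field sizes. The explicit powers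
  of 2 listed for \<open>k = 6\<close> and \<open>k = 10\<close> are redundant.\<close>

definition waring_triples :: "(nat \<times> nat set \<times> nat) set" where
  "waring_triples = {
    (3, with_powers {2, 4} {3}, 3),
    (3, with_powers {2, 4, 7} {3}, 2),
    (4, with_powers {3, 9} {2}, 5),
    (4, with_powers {3, 5, 9} {2}, 4),
    (4, with_powers {3, 5, 9, 13, 17, 25, 29} {2}, 3),
    (5, with_powers {2, 4, 16} {5}, 5),
    (5, with_powers {2, 4, 11, 16} {5}, 3),
    (5, with_powers {2, 4, 11, 16, 31, 41, 61} {5}, 2),
    (6, with_powers {2, 4, 5, 25} {2, 3}, 7),
    (6, with_powers {2, 4, 5, 7, 13, 25} {2, 3}, 5),
    (6, with_powers {2, 4, 5, 7, 13, 19, 25, 31} {2, 3}, 4),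
    (6, with_powers {2, 4, 5, 7, 13, 19, 25, 31, 37, 43, 49, 61, 67, 73, 79, 109, 139, 223}
       {2, 3}, 3),
    (7, with_powers {2, 8} {7}, 4),
    (7, with_powers {2, 8, 29, 43} {7}, 3),
    (7, with_powers {2, 4, 8, 29, 43, 64, 71, 113, 127} {7}, 2),
    (8, with_powers {3, 7, 9, 49} {2}, 9),
    (8, with_powers {3, 7, 9, 17, 49} {2}, 5),
    (8, with_powers {3, 5, 7, 9, 17, 25, 41, 49} {2}, 4),
    (8, with_powers {3, 5, 7, 9, 11, 13, 17, 25, 29, 41, 49, 73, 81, 89, 97, 113, 121, 137,
       233, 257, 289, 337, 761} {2}, 3),
    (9, with_powers {2, 4, 8, 64} {3}, 9),
    (9, with_powers {2, 4, 8, 19, 64} {3}, 5),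
    (9, with_powers {2, 4, 8, 19, 37, 64} {3}, 3),
    (9, with_powers {2, 4, 7, 8, 19, 37, 64, 73, 109, 127, 163, 181, 199, 271, 307, 343} {3}, 2),
    (10, with_powers {2, 3, 4, 9, 16, 81} {2, 5}, 11),
    (10, with_powers {2, 3, 4, 9, 11, 16, 81} {2, 5}, 6),
    (10, with_powers {2, 3, 4, 9, 11, 16, 31, 81} {2, 5}, 5),
    (10, with_powers {2, 3, 4, 9, 11, 16, 31, 41, 61, 81} {2, 5}, 4),
    (10, with_powers {2, 3, 4, 9, 11, 16, 31, 41, 61, 71, 81, 101, 121, 131, 151, 181, 191,
       211, 241, 251, 271, 281, 311, 331, 401, 421, 431, 461, 491, 641, 911} {2, 5}, 3),
    (11, with_powers {23} {11}, 5),
    (11, with_powers {23, 67} {11}, 4),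
    (11, with_powers {23, 67, 89} {11}, 3),
    (11, with_powers {23, 67, 89, 199, 331, 353, 419, 463, 617} {11}, 2)
  }"

end

theory Submission
  imports "HOL-Algebra.Algebraic_Closure_Type" Defs
begin

text \<open>The ring \<open>F\<^sub>q[A]\<close> is a quotient of \<open>F\<^sub>q[x]\<close>. Since \<open>k\<close> is prime to \<open>q\<close>, Hensel lifting and the
  Chinese remainder theorem reduce the claim to the residue fields: in each of them every element must
  be a sum of \<open>m\<close> \<open>k\<close>-th powers that are not all zero. These fields have \<open>q\<^sup>e\<close> elements, and
  \<open>q\<^sup>e \<notin> Q\<close> because \<open>Q\<close> is closed under taking roots. In a field with \<open>q\<close> elements \<open>k\<close> may be replaced by
  \<open>d = gcd k (q - 1)\<close>.

  Convolution with the counting function of the \<open>d\<close>-th powers has norm at most \<open>(d - 1) \<surd>q\<close> on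
  functions of sum zero. This follows, without characters, from a second moment over all dilations of the
  \<open>d\<close>-th powers, and replaces the usual bounds for Jacobi sums. It gives representations by two
  or three \<open>d\<close>-th powers as soon as \<open>q\<close> exceeds roughly \<open>(d - 1)\<^sup>4\<close> or \<open>(d - 1)\<^sup>3\<close>. In the
  finitely many smaller fields, explicit representations of representatives \<open>1, g, \<dots>, g\<^bsup>d-1\<^esup>\<close> of the cosets
  of the \<open>d\<close>-th powers, and of \<open>-1\<close> where needed, are checked by computation.\<close>

text \<open>Zero is the obstacle. Hensel lifting of y^k needs the derivative k y^(k-1) to be a unit,
  so in every residue field even zero must be a sum of m powers with a nonzero term. It is obtained
  as 1 plus a representation of -1 by m - 1 powers. For odd d this costs nothing; for even d with (q
  - 1) / d odd, -1 itself must be a sum of two powers (or a few more in exceptional fields), which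
  the estimates give only beyond (d - 1)^4. Hence the separate tables for -1. The second moment is
  exact because for x^d \<noteq> y^d the translates by g x^d and g y^d become uncorrelated when g
  runs over the field. All g in the group of d-th powers give the same norm as g = 1, and there are
  (q - 1) / d of them, so this norm cannot exceed its share of the total. A residue field depends on
  an irreducible factor of a polynomial, so it cannot be a type: it is a finite subset of the
  algebraic closure of F_q, and all counting is done for such subsets.\<close>

no_notation Polynomials.var ("X\<index>")

section \<open>Sums of two and three powers in large finite fields\<close>

text \<open>Cauchy-Schwarz against the constant 1, that is, nonnegativity of the variance of
  \<open>v\<close>; the deviation from the mean is scaled by \<open>card I\<close> to avoid
  division.\<close>

lemma sum_squared_le:
  fixes v :: "'i \<Rightarrow> real"
  shows "(\<Sum>i\<in>I. v i)\<^sup>2 \<le> card I * (\<Sum>i\<in>I. (v i)\<^sup>2)"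
proof (cases "card I = 0")
  case False
  define S where "S = (\<Sum>i\<in>I. v i)"
  have "0 \<le> (\<Sum>i\<in>I. (card I * v i - S)\<^sup>2)" by (simp add: sum_nonneg)
  also have "\<dots> = (card I)\<^sup>2 * (\<Sum>i\<in>I. (v i)\<^sup>2) - 2 * card I * S * (\<Sum>i\<in>I. v i) + card I * S\<^sup>2"
    by (simp add: power2_diff sum.distrib sum_subtractf power_mult_distrib mult.assoc
        flip: sum_distrib_left sum_distrib_right)
  also have "\<dots> = card I * (card I * (\<Sum>i\<in>I. (v i)\<^sup>2) - S\<^sup>2)"
    by (simp add: S_def[symmetric] power2_eq_square algebra_simps)
  finally show ?thesis using False by (simp add: S_def zero_le_mult_iff)
qed (auto simp: card_eq_0_iff)

section \<open>Finite fields as subsets of an ambient field; permutation arguments\<close>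

locale finite_subfield =
  fixes K :: "'b :: field set"
  assumes finite_K: "finite K"
    and zero_K: "0 \<in> K" and one_K: "1 \<in> K"
    and diff_K: "x \<in> K \<Longrightarrow> y \<in> K \<Longrightarrow> x - y \<in> K"
    and mult_K: "x \<in> K \<Longrightarrow> y \<in> K \<Longrightarrow> x * y \<in> K"
begin

lemma uminus_K: "x \<in> K \<Longrightarrow> - x \<in> K"
  using diff_K[OF zero_K] by simp

lemma add_K: "x \<in> K \<Longrightarrow> y \<in> K \<Longrightarrow> x + y \<in> K"
  using diff_K[of x "- y"] uminus_K by simp

lemma power_K: "x \<in> K \<Longrightarrow> x ^ n \<in> K"
  by (induction n) (auto simp: one_K mult_K)

lemma of_nat_K: "of_nat n \<in> K"
  by (induction n) (auto simp: zero_K one_K add_K)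

lemma of_int_K: "of_int n \<in> K"
  by (cases n) (auto simp: of_nat_K uminus_K diff_K one_K simp del: of_nat_Suc)

lemma mult_image: "c \<in> K \<Longrightarrow> c \<noteq> 0 \<Longrightarrow> (\<lambda>x. c * x) ` K = K"
  by (rule endo_inj_surj[OF finite_K]) (auto simp: mult_K inj_on_def)

text \<open>Multiplication by a nonzero element is injective on the finite set \<open>K\<close>,
  hence onto, and so takes the value 1.\<close>

lemma inverse_K: assumes "x \<in> K" shows "inverse x \<in> K"
proof (cases "x = 0")
  case False
  then obtain y where "y \<in> K" "x * y = 1"
    using mult_image[OF assms] one_K by (metis image_iff)
  thus ?thesis by (simp add: inverse_unique)
qed (simp add: zero_K)

lemma divide_K: "x \<in> K \<Longrightarrow> y \<in> K \<Longrightarrow> x / y \<in> K"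
  by (simp add: divide_inverse mult_K inverse_K)

definition q :: nat where "q = card K"

abbreviation Ks :: "'b set" where "Ks \<equiv> K - {0}"

lemma card_Ks: "card Ks = q - 1"
  by (simp add: q_def finite_K zero_K)

lemma q_ge_2: "2 \<le> q"
  using card_mono[OF finite_K, of "{0, 1}"] zero_K one_K by (simp add: q_def)

lemma bij_diff_right: "c \<in> K \<Longrightarrow> bij_betw (\<lambda>a. a - c) K K"
  by (rule bij_betw_byWitness[where f' = "\<lambda>a. a + c"]) (auto simp: add_K diff_K)

lemma bij_mult_Ks: "c \<in> Ks \<Longrightarrow> bij_betw (\<lambda>x. c * x) Ks Ks"
  by (rule bij_betw_byWitness[where f' = "\<lambda>a. a / c"]) (auto simp: mult_K divide_K)

lemma bij_mult_K: "c \<in> Ks \<Longrightarrow> bij_betw (\<lambda>x. c * x) K K"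
  by (rule bij_betw_byWitness[where f' = "\<lambda>a. a / c"]) (auto simp: mult_K divide_K)

lemma power_q_minus_1: assumes "x \<in> Ks" shows "x ^ (q - 1) = 1"
proof -
  have "(\<Prod>y\<in>Ks. x * y) = \<Prod>Ks"
    by (rule prod.reindex_bij_betw[OF bij_mult_Ks[OF assms]])
  also have "(\<Prod>y\<in>Ks. x * y) = x ^ (q - 1) * \<Prod>Ks"
    by (simp add: prod.distrib card_Ks)
  finally show ?thesis using finite_K by simp
qed

text \<open>Translation by 1 permutes \<open>K\<close> and therefore fixes the sum of its elements.
  This ties the characteristic to \<open>q\<close> before anything is known about prime
  powers.\<close>

lemma of_nat_q: "of_nat q = (0 :: 'b)"
proof -
  have "(\<Sum>y\<in>K. y - 1) = \<Sum>K"
    by (rule sum.reindex_bij_betw[OF bij_diff_right[OF one_K]])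
  also have "(\<Sum>y\<in>K. y - 1) = \<Sum>K - of_nat q"
    by (simp add: sum_subtractf q_def)
  finally show ?thesis by simp
qed


section \<open>The group of d-th powers and the number of d-th roots\<close>

lemma card_power_eq_le: assumes "0 < d" shows "card {x \<in> K. x ^ d = c} \<le> d"
proof -
  define P where "P = monom 1 d - [:c:]"
  have c: "coeff P d = 1" using assms by (simp add: P_def coeff_pCons split: nat.split)
  hence nz: "P \<noteq> 0" by auto
  have deg: "degree P \<le> d"
    unfolding P_def by (intro degree_diff_le) (auto simp: degree_monom_le)
  have "{x \<in> K. x ^ d = c} \<subseteq> {x. poly P x = 0}"
    by (auto simp: P_def poly_monom)
  hence "card {x \<in> K. x ^ d = c} \<le> card {x. poly P x = 0}"
    by (intro card_mono poly_roots_finite nz)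
  also have "\<dots> \<le> degree P" by (rule card_poly_roots_bound[OF nz])
  finally show ?thesis using deg by simp
qed

text \<open>The subgroup of nonzero \<open>d\<close>-th powers, of index \<open>d\<close> if
  \<open>d\<close> divides \<open>q - 1\<close>. Representability by \<open>d\<close>-th powers
  depends only on the coset of this group.\<close>

definition H :: "nat \<Rightarrow> 'b set" where "H d = (\<lambda>x. x ^ d) ` Ks"

text \<open>The number of \<open>d\<close>-th roots of \<open>t\<close>. If \<open>d\<close> > 0
  divides \<open>q - 1\<close>, it is 1 at zero, \<open>d\<close> on \<open>H d\<close> and 0
  elsewhere.\<close>

definition w :: "nat \<Rightarrow> 'b \<Rightarrow> nat" where "w d t = card {x \<in> K. x ^ d = t}"

lemma w_le: "0 < d \<Longrightarrow> w d t \<le> d"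
  unfolding w_def by (rule card_power_eq_le)

lemma w_power: assumes "y \<in> Ks" shows "w d (y ^ d) = w d 1"
  unfolding w_def
  by (rule bij_betw_same_card[of "\<lambda>x. x / y"], rule bij_betw_byWitness[where f' = "\<lambda>a. a * y"])
     (use assms in \<open>auto simp: mult_K divide_K power_divide power_mult_distrib\<close>)

lemma w_0: assumes "0 < d" shows "w d 0 = 1"
proof -
  have "{x \<in> K. x ^ d = 0} = {0}" using assms by (auto simp: zero_K)
  thus ?thesis by (simp add: w_def)
qed

lemma finite_H: "finite (H d)"
  by (simp add: H_def finite_K)

lemma H_subset: "H d \<subseteq> Ks"
  by (auto simp: H_def power_K)

lemma sum_w: "(\<Sum>t\<in>K. w d t) = q"
proof -
  have "q = (\<Sum>x\<in>K. \<Sum>t\<in>K. if x ^ d = t then 1 else 0)"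
    by (simp add: finite_K power_K q_def)
  also have "\<dots> = (\<Sum>t\<in>K. \<Sum>x\<in>K. if x ^ d = t then 1 else 0)"
    by (rule sum.swap)
  also have "\<dots> = (\<Sum>t\<in>K. w d t)"
    by (simp add: w_def finite_K flip: sum.inter_filter)
  finally show ?thesis by simp
qed

text \<open>\<open>q - 1 = card (H d) * w d 1\<close>, where the second factor is at most \<open>d\<close> and the first one at most
  \<open>(q - 1) / d\<close>, because \<open>H d\<close> consists of roots of \<open>x ^ ((q - 1) div d) - 1\<close>.\<close>

lemma
  assumes "d dvd q - 1" "0 < d"
  shows card_H: "card (H d) * d = q - 1"
    and w_1: "w d 1 = d"
    and H_eq: "H d = {x \<in> K. x ^ ((q - 1) div d) = 1}"
proof -
  define f where "f = (q - 1) div d"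
  have fd: "f * d = q - 1" using assms by (simp add: f_def)
  have f0: "0 < f" using fd q_ge_2 by (cases f) auto
  have sub: "H d \<subseteq> {x \<in> K. x ^ f = 1}"
    using fd power_q_minus_1 by (auto simp: H_def power_K mult.commute simp flip: power_mult)
  have le: "card (H d) \<le> card {x \<in> K. x ^ f = 1}"
    by (intro card_mono sub) (simp add: finite_K)
  also have lef: "\<dots> \<le> f" by (rule card_power_eq_le[OF f0])
  finally have cH: "card (H d) \<le> f" .
  have "q - 1 = (\<Sum>t\<in>H d. w d 1)"
  proof -
    have "q = w d 0 + (\<Sum>t\<in>Ks. w d t)"
      using sum_w[of d] by (simp add: sum.remove[OF finite_K zero_K])
    hence "q - 1 = (\<Sum>t\<in>Ks. w d t)" using w_0 assms by simp
    also have "\<dots> = (\<Sum>t\<in>H d. w d t)"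
    proof (rule sum.mono_neutral_right)
      show "\<forall>t\<in>Ks - H d. w d t = 0"
      proof
        fix t assume t: "t \<in> Ks - H d"
        have "{x \<in> K. x ^ d = t} = {}"
          using t assms(2) by (auto simp: H_def zero_power)
        thus "w d t = 0" by (simp only: w_def card.empty)
      qed
    qed (use H_subset finite_K in auto)
    also have "\<dots> = (\<Sum>t\<in>H d. w d 1)"
      by (rule sum.cong) (use w_power in \<open>auto simp: H_def\<close>)
    finally show ?thesis .
  qed
  hence eq: "card (H d) * w d 1 = f * d" using fd by simp
  have w1: "w d 1 \<le> d" by (rule w_le[OF assms(2)])
  have "f \<le> card (H d)"
  proof (rule ccontr)
    assume "\<not> ?thesis"
    moreover have "0 < w d 1" using eq fd q_ge_2 by (intro gr0I) simp
    ultimately have "card (H d) * w d 1 < f * d"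
      by (intro mult_less_le_imp_less) (use w1 assms(2) eq fd q_ge_2 in auto)
    thus False using eq by simp
  qed
  hence cf: "card (H d) = f" using cH by simp
  show "card (H d) * d = q - 1" using cf fd by simp
  show "w d 1 = d" using eq cf f0 by simp
  show "H d = {x \<in> K. x ^ ((q - 1) div d) = 1}"
    using card_seteq[OF _ sub] finite_K lef cf by (simp add: f_def)
qed


text \<open>Convolution with the indicator of the \<open>d\<close>-th powers (with multiplicities), twisted by \<open>g\<close>.
  The sum over \<open>g\<close> of the squared norms of \<open>V d \<psi> g\<close> is computed exactly, and \<open>V d \<psi> 1\<close> occurs in it
  \<open>card (H d)\<close> times; that all \<open>V d \<psi> g\<close> add up to zero gains the factor \<open>(d - 1) / d\<close>.\<close>

definition V :: "nat \<Rightarrow> ('b \<Rightarrow> real) \<Rightarrow> 'b \<Rightarrow> 'b \<Rightarrow> real"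
  where "V d \<psi> g a = (\<Sum>x\<in>K. \<psi> (a - g * x ^ d))"

lemma sum_shift: "c \<in> K \<Longrightarrow> (\<Sum>a\<in>K. F (a - c)) = sum F K"
  by (rule sum.reindex_bij_betw[OF bij_diff_right])

lemma sum_Ks: "sum F Ks = sum F K - (F 0 :: real)"
  by (simp add: sum.remove[OF finite_K zero_K])

lemma sum_scaled:
  fixes F :: "'b \<Rightarrow> real"
  assumes "a \<in> K" "c \<in> Ks"
  shows "(\<Sum>g\<in>K. F (a - g * c)) = sum F K"
proof -
  have "(\<Sum>g\<in>K. F (a - g * c)) = (\<Sum>g\<in>K. F (a - c * g))" by (simp add: mult.commute)
  also have "\<dots> = (\<Sum>g\<in>K. F (a - g))" by (rule sum.reindex_bij_betw[OF bij_mult_K[OF assms(2)]])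
  also have "\<dots> = sum F K"
    by (rule sum.reindex_bij_betw, rule bij_betw_byWitness[where f' = "\<lambda>x. a - x"])
       (auto simp: diff_K assms)
  finally show ?thesis .
qed

lemma card_complement_H: "card (Ks - H d) + card (H d) = q - 1"
  using card_Diff_subset[OF finite_H H_subset, of d] card_mono[OF _ H_subset, of d] finite_K
  by (simp add: card_Ks)

lemma V_norm:
  assumes d: "d dvd q - 1" "0 < d" and sum0: "sum \<psi> K = 0"
  shows "(\<Sum>a\<in>K. (V d \<psi> 1 a)\<^sup>2) \<le> (real d - 1)\<^sup>2 * real q * (\<Sum>a\<in>K. (\<psi> a)\<^sup>2)"
proof -
  define R where "R = (\<Sum>a\<in>K. (\<psi> a)\<^sup>2)"
  define s where "s = real q - 1"
  define f where "f = real (card (H d))"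
  have f_d: "f * real d = s"
    using card_H[OF d] q_ge_2 by (simp add: f_def s_def of_nat_diff flip: of_nat_mult)
  have s0: "0 < s" using q_ge_2 by (simp add: s_def)
  have f0: "0 < f" using f_d s0 by (metis f_def gr0I mult_zero_left of_nat_0 of_nat_0_less_iff less_irrefl)
  have R0: "0 \<le> R" by (simp add: R_def sum_nonneg)
  \<comment> \<open>For x \<noteq> 0 the argument runs over all of \<open>K\<close> as g does, and
    the sum vanishes; x = 0 contributes q times \<psi>(a), which is also the value of the term g =
    0.\<close>
  have V0: "(\<Sum>g\<in>Ks. V d \<psi> g a) = 0" if a: "a \<in> K" for a
  proof -
    have "(\<Sum>g\<in>K. V d \<psi> g a) = (\<Sum>x\<in>K. \<Sum>g\<in>K. \<psi> (a - g * x ^ d))"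
      unfolding V_def by (rule sum.swap)
    also have "\<dots> = (\<Sum>x\<in>K. if x = 0 then real q * \<psi> a else 0)"
      using d(2) by (intro sum.cong) (auto simp: sum_scaled a power_K sum0 zero_power q_def)
    also have "\<dots> = real q * \<psi> a" by (simp add: finite_K zero_K)
    finally show ?thesis by (simp add: sum_Ks) (simp add: V_def q_def)
  qed
  have V_sq: "(\<Sum>g\<in>Ks. \<Sum>a\<in>K. (V d \<psi> g a)\<^sup>2) \<le> R * real q * s * (real d - 1)"
  proof -
    \<comment> \<open>Equal powers give the full norm for every g. For different powers a
      translation by g x^d turns the sum over g into a sum of \<psi> over \<open>K\<close>, which is
      zero.\<close>
    have inner: "(\<Sum>g\<in>K. \<Sum>a\<in>K. \<psi> (a - g * x ^ d) * \<psi> (a - g * y ^ d))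
        = (if x ^ d = y ^ d then real q * R else 0)" if xy: "x \<in> K" "y \<in> K" for x y
    proof (cases "x ^ d = y ^ d")
      case True
      have "(\<Sum>a\<in>K. \<psi> (a - g * x ^ d) * \<psi> (a - g * y ^ d)) = R" if "g \<in> K" for g
        unfolding R_def power2_eq_square True
        by (rule sum_shift[where F = "\<lambda>a. \<psi> a * \<psi> a"]) (use that xy in \<open>auto simp: mult_K power_K\<close>)
      thus ?thesis using True by (simp add: q_def)
    next
      case False
      define c where "c = y ^ d - x ^ d"
      have c: "c \<in> Ks" using False xy by (auto simp: c_def diff_K power_K)
      have "(\<Sum>a\<in>K. \<psi> (a - g * x ^ d) * \<psi> (a - g * y ^ d)) = (\<Sum>a\<in>K. \<psi> a * \<psi> (a - g * c))"
        if "g \<in> K" for g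
        using sum_shift[where F = "\<lambda>a. \<psi> a * \<psi> (a - g * c)" and c = "g * x ^ d"] that xy
        by (simp add: mult_K power_K c_def algebra_simps)
      hence "(\<Sum>g\<in>K. \<Sum>a\<in>K. \<psi> (a - g * x ^ d) * \<psi> (a - g * y ^ d))
          = (\<Sum>g\<in>K. \<Sum>a\<in>K. \<psi> a * \<psi> (a - g * c))" by simp
      also have "\<dots> = (\<Sum>a\<in>K. \<psi> a * (\<Sum>g\<in>K. \<psi> (a - g * c)))"
        by (subst sum.swap) (simp add: sum_distrib_left)
      also have "\<dots> = 0"
        by (rule sum.neutral) (simp add: sum_scaled[OF _ c] sum0)
      finally show ?thesis using False by simp
    qed
    have "(\<Sum>g\<in>K. \<Sum>a\<in>K. (V d \<psi> g a)\<^sup>2)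
        = (\<Sum>g\<in>K. \<Sum>a\<in>K. \<Sum>x\<in>K. \<Sum>y\<in>K. \<psi> (a - g * x ^ d) * \<psi> (a - g * y ^ d))"
      by (simp add: V_def power2_eq_square sum_product)
    also have "\<dots> = (\<Sum>x\<in>K. \<Sum>y\<in>K. \<Sum>g\<in>K. \<Sum>a\<in>K. \<psi> (a - g * x ^ d) * \<psi> (a - g * y ^ d))"
    proof -
      have *: "(\<Sum>a\<in>K. \<Sum>x\<in>K. \<Sum>y\<in>K. G a x y) = (\<Sum>x\<in>K. \<Sum>y\<in>K. \<Sum>a\<in>K. G a x y)"
        for G :: "'b \<Rightarrow> 'b \<Rightarrow> 'b \<Rightarrow> real"
        by (subst sum.swap) (rule sum.cong[OF refl], rule sum.swap)
      have "(\<Sum>g\<in>K. \<Sum>a\<in>K. \<Sum>x\<in>K. \<Sum>y\<in>K. \<psi> (a - g * x ^ d) * \<psi> (a - g * y ^ d))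
          = (\<Sum>g\<in>K. \<Sum>x\<in>K. \<Sum>y\<in>K. \<Sum>a\<in>K. \<psi> (a - g * x ^ d) * \<psi> (a - g * y ^ d))"
        by (intro sum.cong refl *)
      also have "\<dots> = (\<Sum>x\<in>K. \<Sum>y\<in>K. \<Sum>g\<in>K. \<Sum>a\<in>K. \<psi> (a - g * x ^ d) * \<psi> (a - g * y ^ d))"
        by (rule *)
      finally show ?thesis .
    qed
    also have "\<dots> = (\<Sum>x\<in>K. \<Sum>y\<in>K. if x ^ d = y ^ d then real q * R else 0)"
      by (simp add: inner)
    also have "\<dots> = (\<Sum>y\<in>K. \<Sum>x\<in>K. if x ^ d = y ^ d then real q * R else 0)"
      by (rule sum.swap)
    also have "\<dots> = (\<Sum>y\<in>K. real (w d (y ^ d)) * (real q * R))"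
      by (simp add: w_def finite_K flip: sum.inter_filter)
    \<comment> \<open>Pairs with x^d = y^d: one for y = 0 and d for each nonzero y.\<close>
    also have "\<dots> = (1 + s * real d) * (real q * R)"
      using q_ge_2 by (simp add: sum.remove[OF finite_K zero_K] w_power w_1[OF d] w_0 d zero_power
         card_Ks s_def of_nat_diff distrib_right)
    finally have "(\<Sum>g\<in>Ks. \<Sum>a\<in>K. (V d \<psi> g a)\<^sup>2)
        = (1 + s * real d) * (real q * R) - (\<Sum>a\<in>K. (V d \<psi> 0 a)\<^sup>2)"
      by (simp add: sum_Ks)
    also have "(\<Sum>a\<in>K. (V d \<psi> 0 a)\<^sup>2) = (real q)\<^sup>2 * R"
      by (simp add: V_def R_def power_mult_distrib sum_distrib_left q_def)
    also have "(1 + s * real d) * (real q * R) - (real q)\<^sup>2 * R = R * real q * s * (real d - 1)"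
      by (simp add: s_def algebra_simps power2_eq_square)
    finally show ?thesis by simp
  qed
  have VH: "V d \<psi> g a = V d \<psi> 1 a" if g: "g \<in> H d" for g a
  proof -
    obtain h where h: "h \<in> Ks" "g = h ^ d" using g by (auto simp: H_def)
    show ?thesis unfolding V_def h
      using sum.reindex_bij_betw[OF bij_mult_K[OF h(1)], of "\<lambda>x. \<psi> (a - x ^ d)"]
      by (simp add: power_mult_distrib)
  qed
  define X where "X = (\<Sum>a\<in>K. (V d \<psi> 1 a)\<^sup>2)"
  define Y where "Y = (\<Sum>g\<in>Ks - H d. \<Sum>a\<in>K. (V d \<psi> g a)\<^sup>2)"
  have split: "sum F Ks = sum F (H d) + sum F (Ks - H d)" for F :: "'b \<Rightarrow> real"
    using sum.subset_diff[OF H_subset, of F d] finite_K by simp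
  have XY: "f * X + Y \<le> R * real q * s * (real d - 1)"
    using V_sq by (simp add: split VH X_def Y_def f_def)
  have cf: "real (card (Ks - H d)) = s - f"
    using card_complement_H[of d] q_ge_2 by (simp add: s_def f_def)
  have "f\<^sup>2 * (V d \<psi> 1 a)\<^sup>2 \<le> (s - f) * (\<Sum>g\<in>Ks - H d. (V d \<psi> g a)\<^sup>2)" if "a \<in> K" for a
  proof -
    \<comment> \<open>The values at g in \<open>H d\<close> all equal the value at 1, so the
      vanishing sum expresses it by the remaining g. The second moment alone would only give d (d -
      1) in place of (d - 1)^2.\<close>
    have "f * V d \<psi> 1 a = - (\<Sum>g\<in>Ks - H d. V d \<psi> g a)"
      using V0[OF that] by (simp add: split VH f_def)
    hence "f\<^sup>2 * (V d \<psi> 1 a)\<^sup>2 = (\<Sum>g\<in>Ks - H d. V d \<psi> g a)\<^sup>2"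
      by (simp flip: power_mult_distrib)
    also have "\<dots> \<le> (s - f) * (\<Sum>g\<in>Ks - H d. (V d \<psi> g a)\<^sup>2)"
      using sum_squared_le[of "\<lambda>g. V d \<psi> g a" "Ks - H d"] cf by simp
    finally show ?thesis .
  qed
  hence "(\<Sum>a\<in>K. f\<^sup>2 * (V d \<psi> 1 a)\<^sup>2) \<le> (\<Sum>a\<in>K. (s - f) * (\<Sum>g\<in>Ks - H d. (V d \<psi> g a)\<^sup>2))"
    by (rule sum_mono)
  also have "(\<Sum>a\<in>K. (s - f) * (\<Sum>g\<in>Ks - H d. (V d \<psi> g a)\<^sup>2)) = (s - f) * Y"
    unfolding Y_def by (subst sum.swap) (simp add: sum_distrib_left)
  finally have *: "f\<^sup>2 * X \<le> (s - f) * Y"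
    by (simp add: X_def sum_distrib_left)
  have "(s - f) * Y \<le> (s - f) * (R * real q * s * (real d - 1) - f * X)"
    using XY cf by (intro mult_left_mono) (auto simp flip: cf)
  with * have "f * (s * X) \<le> f * (s * ((real d - 1)\<^sup>2 * real q * R))"
    unfolding f_d[symmetric] by (simp add: algebra_simps power2_eq_square)
  hence "X \<le> (real d - 1)\<^sup>2 * real q * R"
    using f0 s0 by simp
  thus ?thesis by (simp add: X_def R_def)
qed


section \<open>Centred counts of representations, and the cost of a missing coset\<close>

lemma sum_V: "sum \<psi> K = 0 \<Longrightarrow> sum (V d \<psi> 1) K = 0"
  unfolding V_def by (subst sum.swap) (simp add: sum_shift power_K)

text \<open>The values -c on \<open>B\<close> must be balanced by a total of c times
  \<open>card B\<close> on the complement. Cauchy-Schwarz there improves the trivial lower bound for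
  the norm by the factor q / (q - \<open>card B\<close>).\<close>

lemma sum_squares_gap:
  fixes v :: "'b \<Rightarrow> real"
  assumes "sum v K = 0" "B \<subseteq> K" and vB: "\<And>b. b \<in> B \<Longrightarrow> v b = - c"
  shows "real q * card B * c\<^sup>2 \<le> (real q - card B) * (\<Sum>a\<in>K. (v a)\<^sup>2)"
proof -
  have fin: "finite B" using assms finite_K finite_subset by auto
  have split: "sum F K = sum F B + sum F (K - B)" for F :: "'b \<Rightarrow> real"
    using sum.subset_diff[OF assms(2) finite_K, of F] by simp
  have "card B \<le> q" using assms finite_K by (simp add: q_def card_mono)
  hence cKB: "real (card (K - B)) = real q - card B"
    using assms fin by (simp add: card_Diff_subset q_def of_nat_diff)
  have "sum v (K - B) = card B * c"
    using assms(1) by (simp add: split vB)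
  hence le: "(card B * c)\<^sup>2 \<le> (real q - card B) * (\<Sum>a\<in>K - B. (v a)\<^sup>2)"
    using sum_squared_le[of v "K - B"] cKB by simp
  have "(real q - card B) * (\<Sum>a\<in>K. (v a)\<^sup>2)
      = (real q - card B) * (card B * c\<^sup>2) + (real q - card B) * (\<Sum>a\<in>K - B. (v a)\<^sup>2)"
    by (simp add: split vB distrib_left)
  with le show ?thesis by (simp add: power2_eq_square algebra_simps)
qed

text \<open>The root count minus its mean 1. Hence \<open>V d (u d) 1 b\<close> is the number of
  pairs (x, y) with x^d + y^d = b minus the mean q, and one more application of \<open>V\<close>
  counts triples, minus the mean q^2.\<close>

abbreviation u :: "nat \<Rightarrow> 'b \<Rightarrow> real" where "u d t \<equiv> real (w d t) - 1"

lemma sum_u: "sum (u d) K = 0"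
  using sum_w[of d] by (simp add: sum_subtractf q_def flip: of_nat_sum)

text \<open>From 0 \<le> w \<le> d follows w^2 \<le> d w, and the sum of w is known exactly.\<close>

lemma sum_u_squares:
  assumes "0 < d"
  shows "(\<Sum>t\<in>K. (u d t)\<^sup>2) \<le> (real d - 1) * (real q - 1)"
proof -
  have "(\<Sum>t\<in>K. (u d t)\<^sup>2) = (\<Sum>t\<in>Ks. (u d t)\<^sup>2)"
    using assms by (simp add: sum_Ks w_0)
  also have "\<dots> \<le> (\<Sum>t\<in>Ks. (real d - 2) * w d t + 1)"
  proof (rule sum_mono)
    fix t
    have "0 \<le> real (w d t) * (real d - w d t)" using w_le[OF assms, of t] by simp
    thus "(u d t)\<^sup>2 \<le> (real d - 2) * w d t + 1" by (simp add: power2_eq_square algebra_simps)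
  qed
  also have "\<dots> = (real d - 2) * (\<Sum>t\<in>Ks. real (w d t)) + (real q - 1)"
    using q_ge_2 by (simp add: sum.distrib sum_distrib_left card_Ks of_nat_diff)
  also have "(\<Sum>t\<in>Ks. real (w d t)) = real q - 1"
    using arg_cong[OF sum_w, of real d] assms by (simp add: sum_Ks w_0)
  finally show ?thesis by (simp add: algebra_simps)
qed

lemma scaled_H:
  assumes "a \<in> Ks"
  shows "card ((\<lambda>h. a * h) ` H d) = card (H d)" "(\<lambda>h. a * h) ` H d \<subseteq> Ks"
  using assms H_subset[of d] by (auto simp: card_image inj_on_def mult_K subset_iff)

text \<open>Multiplying a representation by a nonzero \<open>d\<close>-th power gives another one.
  So if \<open>a\<close> has none, the count vanishes on the whole coset of \<open>a\<close>, and
  the centred count takes its least possible value there.\<close>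

lemma V_if_not_sum_of_two_powers:
  assumes d: "d dvd q - 1" "0 < d" and a: "a \<in> Ks" and b: "b \<in> (\<lambda>h. a * h) ` H d"
    and no: "\<And>x y. x \<in> K \<Longrightarrow> y \<in> K \<Longrightarrow> a \<noteq> x ^ d + y ^ d"
  shows "V d (u d) 1 b = - real q"
proof -
  have "w d (b - x ^ d) = 0" if x: "x \<in> K" for x
  proof -
    obtain z where z: "z \<in> Ks" "b = a * z ^ d" using b by (auto simp: H_def)
    have "{y \<in> K. y ^ d = b - x ^ d} = {}"
    proof safe
      fix y assume y: "y \<in> K" "y ^ d = b - x ^ d"
      hence "a = (x / z) ^ d + (y / z) ^ d"
        using z by (simp add: power_divide field_simps)
      with no[of "x / z" "y / z"] x y z show "y \<in> {}" by (simp add: divide_K)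
    qed
    thus ?thesis by (simp only: w_def card.empty)
  qed
  thus ?thesis by (simp add: V_def sum_subtractf q_def)
qed

lemma V_if_not_sum_of_three_powers:
  assumes d: "d dvd q - 1" "0 < d" and a: "a \<in> Ks" and b: "b \<in> (\<lambda>h. a * h) ` H d"
    and no: "\<And>x y z. x \<in> K \<Longrightarrow> y \<in> K \<Longrightarrow> z \<in> K \<Longrightarrow> a \<noteq> x ^ d + y ^ d + z ^ d"
  shows "V d (V d (u d) 1) 1 b = - (real q)\<^sup>2"
proof -
  have "w d (b - x ^ d - t ^ d) = 0" if x: "x \<in> K" "t \<in> K" for x t
  proof -
    obtain z where z: "z \<in> Ks" "b = a * z ^ d" using b by (auto simp: H_def)
    have "{y \<in> K. y ^ d = b - x ^ d - t ^ d} = {}"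
    proof safe
      fix y assume y: "y \<in> K" "y ^ d = b - x ^ d - t ^ d"
      hence "a = (x / z) ^ d + (t / z) ^ d + (y / z) ^ d"
        using z by (simp add: power_divide field_simps)
      with no[of "x / z" "t / z" "y / z"] x y z show "y \<in> {}" by (simp add: divide_K)
    qed
    thus ?thesis by (simp only: w_def card.empty)
  qed
  thus ?thesis by (simp add: V_def sum_subtractf q_def power2_eq_square)
qed

lemma card_H_real:
  assumes "d dvd q - 1" "0 < d"
  shows "real (card (H d)) * d = real q - 1" "0 < card (H d)"
proof -
  show "real (card (H d)) * d = real q - 1"
    using card_H[OF assms] q_ge_2 by (simp add: of_nat_diff flip: of_nat_mult)
  show "0 < card (H d)"
    using card_H[OF assms] q_ge_2 by (intro gr0I) simp
qed

text \<open>\<open>T\<close> measures the squared norm of \<open>v\<close> against the bound (d - 1)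
  (q - 1) known for \<open>u d\<close>. The coset has (q - 1) / d elements, and this number cancels
  against the factor q - 1.\<close>

lemma gap_bound:
  assumes d: "d dvd q - 1" "2 \<le> d" and a: "a \<in> Ks" and v0: "sum v K = 0"
    and v: "\<And>b. b \<in> (\<lambda>h. a * h) ` H d \<Longrightarrow> v b = - c"
    and T: "(\<Sum>b\<in>K. (v b)\<^sup>2) \<le> T * ((real d - 1) * (real q - 1))"
  shows "real q * c\<^sup>2 \<le> ((real d - 1) * real q + 1) * (real d - 1) * T"
proof -
  define B where "B = (\<lambda>h. a * h) ` H d"
  define e where "e = real d - 1"
  define f where "f = real (card (H d))"
  have d0: "0 < d" using d by simp
  have e: "1 \<le> e" using d(2) by (simp add: e_def)
  have fd: "f * (e + 1) = real q - 1" "0 < f" using card_H_real[OF d(1) d0] by (auto simp: f_def e_def)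
  have fq: "f \<le> real q" using fd e by (smt (verit) mult_le_cancel_left1)
  have "B \<subseteq> K" "real (card B) = f" using scaled_H[OF a, of d] by (auto simp: B_def f_def)
  hence "real q * f * c\<^sup>2 \<le> (real q - f) * (\<Sum>b\<in>K. (v b)\<^sup>2)"
    using sum_squares_gap[OF v0, of B c] v unfolding B_def by metis
  also have "\<dots> \<le> (real q - f) * (T * (e * (real q - 1)))"
    using T fq by (intro mult_left_mono) (simp_all add: e_def)
  also have "\<dots> = f * ((real q - f) * (e + 1)) * e * T"
    unfolding fd(1)[symmetric] by (simp only: mult_ac)
  also have "(real q - f) * (e + 1) = e * real q + 1" using fd by (simp add: algebra_simps)
  finally have "f * (real q * c\<^sup>2) \<le> f * ((e * real q + 1) * e * T)" by (simp only: mult_ac)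
  thus ?thesis using fd(2) by (simp add: e_def)
qed

lemma V_u_norm:
  assumes "d dvd q - 1" "0 < d"
  shows "(\<Sum>b\<in>K. (V d (u d) 1 b)\<^sup>2) \<le> (real d - 1)\<^sup>2 * real q * ((real d - 1) * (real q - 1))"
proof -
  have "(\<Sum>b\<in>K. (V d (u d) 1 b)\<^sup>2) \<le> (real d - 1)\<^sup>2 * real q * (\<Sum>t\<in>K. (u d t)\<^sup>2)"
    by (rule V_norm[OF assms sum_u])
  also have "\<dots> \<le> (real d - 1)\<^sup>2 * real q * ((real d - 1) * (real q - 1))"
    using sum_u_squares[OF assms(2)] by (intro mult_left_mono) simp_all
  finally show ?thesis .
qed

lemma real_power_less_q:
  assumes "(d - 1) ^ n < q" "2 \<le> d"
  shows "(real d - 1) ^ n + 1 \<le> real q"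
proof -
  have "real (d - 1) = real d - 1" using assms(2) by (simp add: of_nat_diff)
  moreover have "real ((d - 1) ^ n + 1) \<le> real q" using assms(1) by (simp only: of_nat_le_iff)
  ultimately show ?thesis by simp
qed

text \<open>Here c = q and T = e^2 q with e = d - 1. The gap inequality becomes q (q - e^4) \<le>
  e^3, which fails as soon as q > e^4.\<close>

theorem nonzero_two_powers:
  assumes d: "d dvd q - 1" "2 \<le> d" and q: "(d - 1) ^ 4 < q" and a: "a \<in> Ks"
  shows "\<exists>x\<in>K. \<exists>y\<in>K. a = x ^ d + y ^ d"
proof (rule ccontr)
  assume no: "\<not> ?thesis"
  define e where "e = real d - 1"
  have d0: "0 < d" using d by simp
  have e: "1 \<le> e" using d(2) by (simp add: e_def)
  have qe: "e ^ 4 + 1 \<le> real q" using real_power_less_q[OF q d(2)] by (simp add: e_def)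
  have q0: "0 < real q" using q_ge_2 by simp
  have "real q * (real q)\<^sup>2 \<le> (e * real q + 1) * e * (e\<^sup>2 * real q)"
    unfolding e_def
    by (rule gap_bound[OF d a sum_V[OF sum_u] V_if_not_sum_of_two_powers[OF d(1) d0 a] V_u_norm[OF d(1) d0]])
       (use no in blast)+
  hence "real q * (real q)\<^sup>2 \<le> real q * ((e * real q + 1) * e ^ 3)"
    by (simp add: power2_eq_square power3_eq_cube mult_ac)
  hence "(real q)\<^sup>2 \<le> (e * real q + 1) * e ^ 3" using q0 by simp
  hence "real q * (real q - e ^ 4) \<le> e ^ 3" by (simp add: power2_eq_square algebra_simps power_numeral_reduce)
  moreover have "real q * 1 \<le> real q * (real q - e ^ 4)" using qe q0 by (intro mult_left_mono) auto
  moreover have "e ^ 3 \<le> e ^ 4" using e by (intro power_increasing) auto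
  ultimately show False using qe by linarith
qed

text \<open>Two convolutions give c = q^2 and T = e^4 q^2 with e = d - 1. The resulting q^3 \<le>
  e^6 q + e^5 is impossible for q > e^3.\<close>

theorem nonzero_three_powers:
  assumes d: "d dvd q - 1" "2 \<le> d" and q: "(d - 1) ^ 3 < q" and a: "a \<in> Ks"
  shows "\<exists>x\<in>K. \<exists>y\<in>K. \<exists>z\<in>K. a = x ^ d + y ^ d + z ^ d"
proof (rule ccontr)
  assume no: "\<not> ?thesis"
  define e where "e = real d - 1"
  have d0: "0 < d" using d by simp
  have e: "1 \<le> e" using d(2) by (simp add: e_def)
  have qe: "e ^ 3 + 1 \<le> real q" using real_power_less_q[OF q d(2)] by (simp add: e_def)
  have q0: "0 < real q" using q_ge_2 by simp
  have norm: "(\<Sum>b\<in>K. (V d (V d (u d) 1) 1 b)\<^sup>2)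
      \<le> e\<^sup>2 * real q * (e\<^sup>2 * real q) * ((real d - 1) * (real q - 1))"
  proof -
    have "(\<Sum>b\<in>K. (V d (V d (u d) 1) 1 b)\<^sup>2) \<le> e\<^sup>2 * real q * (\<Sum>b\<in>K. (V d (u d) 1 b)\<^sup>2)"
      using V_norm[OF d(1) d0 sum_V[OF sum_u]] by (simp add: e_def)
    also have "\<dots> \<le> e\<^sup>2 * real q * (e\<^sup>2 * real q * ((real d - 1) * (real q - 1)))"
      using V_u_norm[OF d(1) d0] by (intro mult_left_mono) (simp_all add: e_def)
    finally show ?thesis by (simp only: mult.assoc)
  qed
  have "real q * ((real q)\<^sup>2)\<^sup>2 \<le> (e * real q + 1) * e * (e\<^sup>2 * real q * (e\<^sup>2 * real q))"
    unfolding e_def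
    by (rule gap_bound[OF d a sum_V[OF sum_V[OF sum_u]] V_if_not_sum_of_three_powers[OF d(1) d0 a]
          norm[unfolded e_def]]) (use no in blast)+
  hence "real q * real q * (real q)^3 \<le> real q * real q * ((e * real q + 1) * e ^ 5)"
    by (simp add: power2_eq_square power_numeral_reduce mult_ac)
  hence "(real q)^3 \<le> (e * real q + 1) * e ^ 5" using q0 by simp
  moreover have "(e * real q + 1) * e ^ 5 < real q * (e ^ 3 + 1)\<^sup>2"
  proof -
    have "real q * (e ^ 3 + 1)\<^sup>2 - (e * real q + 1) * e ^ 5 = real q * (2 * e ^ 3 + 1) - e ^ 5"
      by (simp add: power2_eq_square algebra_simps power_numeral_reduce)
    moreover have "e ^ 3 * e ^ 3 \<le> real q * (2 * e ^ 3 + 1)"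
      using qe e q0 by (intro mult_mono) auto
    moreover have "e ^ 5 \<le> e ^ 6" using e by (intro power_increasing) auto
    moreover have "e ^ 3 * e ^ 3 = e ^ 6" by (simp flip: power_add)
    moreover have "real q * (e ^ 3 + 1) \<le> real q * (2 * e ^ 3 + 1)" using e q0 by simp
    moreover have "(e ^ 3 + 1) * (e ^ 3 + 1) \<le> real q * (e ^ 3 + 1)"
      using qe e by (intro mult_right_mono) auto
    moreover have "(e ^ 3 + 1) * (e ^ 3 + 1) > e ^ 3 * e ^ 3" using e by (simp add: algebra_simps add_pos_pos)
    ultimately show ?thesis by linarith
  qed
  moreover have "real q * (e ^ 3 + 1)\<^sup>2 \<le> real q * (real q)\<^sup>2"
    using qe e by (intro mult_left_mono power_mono) auto
  ultimately show False by (simp add: power2_eq_square power3_eq_cube)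
qed

text \<open>If \<open>-1\<close> is a \<open>d\<close>-th power, zero has \<open>1 + (q - 1) d\<close> representations; taking this large
  term out of the sum of squares improves the bound of \<open>nonzero_two_powers\<close>.\<close>

theorem two_powers:
  assumes d: "d dvd q - 1" "2 \<le> d" and q: "(d - 1) ^ 3 * (d - 2) + 2 * (d - 1) \<le> q"
    and m1: "- 1 \<in> H d" and aK: "a \<in> K"
  shows "\<exists>x\<in>K. \<exists>y\<in>K. a = x ^ d + y ^ d"
proof (rule ccontr)
  assume no: "\<not> ?thesis"
  obtain i where i: "i \<in> Ks" "- 1 = i ^ d" using m1 unfolding H_def by (elim imageE)
  have d0: "0 < d" using d by simp
  have "a \<noteq> 0"
  proof
    assume "a = 0"
    hence "a = 1 ^ d + i ^ d" by (simp flip: i(2))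
    with no i one_K show False by blast
  qed
  with aK have a: "a \<in> Ks" by simp
  define B where "B = (\<lambda>h. a * h) ` H d"
  define v where "v = V d (u d) 1"
  define e where "e = real d - 1"
  define f where "f = real (card (H d))"
  have e: "1 \<le> e" using d(2) by (simp add: e_def)
  have fd: "f * (e + 1) = real q - 1" "0 < f" using card_H_real[OF d(1) d0] by (auto simp: f_def e_def)
  have qe: "e ^ 3 * (e - 1) + 2 * e \<le> real q"
  proof -
    have "real ((d - 1) ^ 3 * (d - 2) + 2 * (d - 1)) \<le> real q" using q by (simp only: of_nat_le_iff)
    moreover have "real (d - 1) = e" "real (d - 2) = e - 1" using d by (auto simp: e_def of_nat_diff)
    ultimately show ?thesis by (simp only: of_nat_add of_nat_mult of_nat_power of_nat_numeral)
  qed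
  \<comment> \<open>Zero has 1 + (q - 1) d representations; subtracting the mean q leaves (q - 1) (d
    - 1).\<close>
  have v0: "v 0 = (real q - 1) * e"
  proof -
    have "w d (- (x ^ d)) = d" if "x \<in> Ks" for x
    proof -
      have "i * x \<in> Ks" using i that by (simp add: mult_K)
      from w_power[OF this, of d] w_1[OF d(1) d0] show ?thesis by (simp add: power_mult_distrib flip: i(2))
    qed
    hence "v 0 = (\<Sum>x\<in>Ks. e)"
      using d0 unfolding v_def V_def by (simp add: sum.remove[OF finite_K zero_K] w_0 zero_power e_def)
    thus ?thesis using q_ge_2 by (simp add: card_Ks of_nat_diff)
  qed
  have vB: "v b = - real q" if "b \<in> B" for b
    using V_if_not_sum_of_two_powers[OF d(1) d0 a] no that by (auto simp: B_def v_def)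
  have BK: "B \<subseteq> Ks" and cB: "real (card B) = f" using scaled_H[OF a, of d] by (auto simp: B_def f_def)
  have split: "sum F K = F 0 + sum F B + sum F (Ks - B)" for F :: "'b \<Rightarrow> real"
    using sum.subset_diff[OF BK, of F] finite_K by (simp add: sum.remove[OF finite_K zero_K])
  have cC: "real (card (Ks - B)) = f * e"
  proof -
    have "card (Ks - B) + card B = q - 1"
      using card_Diff_subset[OF _ BK] card_mono[OF _ BK] finite_subset[OF BK] finite_K
      by (simp add: card_Ks)
    hence "real (card (Ks - B)) + f = real q - 1" using q_ge_2 cB by linarith
    thus ?thesis using fd by (simp add: algebra_simps)
  qed
  \<comment> \<open>The large value at zero and the values -q on \<open>B\<close> determine the
    total on the remaining f e elements, so Cauchy-Schwarz bounds their contribution to the norm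
    from below.\<close>
  have "sum v K = 0" unfolding v_def by (rule sum_V[OF sum_u])
  hence "sum v (Ks - B) = f * (real q - (e + 1) * e)"
    using vB cB by (simp add: split v0 flip: fd(1)) (simp add: algebra_simps)
  hence "(f * (real q - (e + 1) * e))\<^sup>2 \<le> f * e * (\<Sum>b\<in>Ks - B. (v b)\<^sup>2)"
    using sum_squared_le[of v "Ks - B"] cC by simp
  hence "f * (f * (real q - (e + 1) * e)\<^sup>2) \<le> f * (e * (\<Sum>b\<in>Ks - B. (v b)\<^sup>2))"
    by (simp add: power2_eq_square mult_ac)
  hence C: "f * (real q - (e + 1) * e)\<^sup>2 \<le> e * (\<Sum>b\<in>Ks - B. (v b)\<^sup>2)"
    using fd(2) by simp
  have "(\<Sum>b\<in>K. (v b)\<^sup>2) \<le> e\<^sup>2 * real q * (e * (real q - 1))"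
    using V_u_norm[OF d(1) d0] by (simp add: v_def e_def)
  hence "((real q - 1) * e)\<^sup>2 + f * (real q)\<^sup>2 + (\<Sum>b\<in>Ks - B. (v b)\<^sup>2) \<le> e ^ 3 * real q * (real q - 1)"
    using vB cB by (simp add: split v0 power2_eq_square power3_eq_cube mult_ac)
  hence "e * (((real q - 1) * e)\<^sup>2 + f * (real q)\<^sup>2 + (\<Sum>b\<in>Ks - B. (v b)\<^sup>2))
      \<le> e * (e ^ 3 * real q * (real q - 1))" using e by (intro mult_left_mono) auto
  with C have "e * ((real q - 1) * e)\<^sup>2 + e * f * (real q)\<^sup>2 + f * (real q - (e + 1) * e)\<^sup>2
      \<le> e ^ 4 * real q * (real q - 1)"
    by (simp add: algebra_simps power_numeral_reduce)
  hence "f * (e + 1) * (e ^ 3 * (real q - 1) + (real q)\<^sup>2 - 2 * e * real q + (e + 1) * e\<^sup>2)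
      \<le> f * (e + 1) * (e ^ 4 * real q)"
    unfolding fd(1)[symmetric] by (simp add: algebra_simps power2_eq_square power_numeral_reduce)
  \<comment> \<open>After cancelling f (e + 1) = q - 1 a quadratic inequality in q remains.
    Collecting its terms in q gives the threshold e^3 (e - 1) + 2 e.\<close>
  hence "e ^ 3 * (real q - 1) + (real q)\<^sup>2 - 2 * e * real q + (e + 1) * e\<^sup>2 \<le> e ^ 4 * real q"
    using fd(2) e by simp
  hence "real q * (real q - (e ^ 3 * (e - 1) + 2 * e)) + e\<^sup>2 \<le> 0"
    by (simp add: algebra_simps power2_eq_square power_numeral_reduce)
  moreover have "0 \<le> real q * (real q - (e ^ 3 * (e - 1) + 2 * e))" using qe by simp
  moreover have "0 < e\<^sup>2" using e by simp
  ultimately show False by linarith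
qed

end

section \<open>Checking certificates\<close>

fun nbits :: "num \<Rightarrow> bool list" where
  "nbits num.One = [True]"
| "nbits (num.Bit0 n) = False # nbits n"
| "nbits (num.Bit1 n) = True # nbits n"

definition ibits :: "int \<Rightarrow> bool list" where
  "ibits x = (if 0 < x then nbits (num_of_nat (nat x)) else [])"

lemma ibits_code [code]:
  "ibits (Int.Pos n) = nbits n" "ibits 0 = []" "ibits (Int.Neg n) = []"
  by (simp_all add: ibits_def)

fun bval :: "bool list \<Rightarrow> nat" where
  "bval [] = 0"
| "bval (b # bs) = (if b then 1 else 0) + 2 * bval bs"

lemma bval_nbits: "bval (nbits n) = numeral n"
  by (induction n) (simp_all add: numeral_Bit0 numeral_Bit1)

lemma bval_ibits: "bval (ibits x) = nat x"
  by (simp add: ibits_def bval_nbits numeral_num_of_nat)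

text \<open>Barrett reduction: \<open>M\<close> approximates \<open>2\<^sup>2\<^sup>8 / p\<close>, and the quotient of \<open>x\<close> by \<open>p\<close> is
  approximated by \<open>M x\<close> without its last 28 bits. A wrong quotient does not affect soundness.\<close>

fun num_shift :: "bool list \<Rightarrow> num \<Rightarrow> int" where
  "num_shift [] n = numeral n"
| "num_shift (b # bs) num.One = 0"
| "num_shift (b # bs) (num.Bit0 n) = num_shift bs n"
| "num_shift (b # bs) (num.Bit1 n) = num_shift bs n"

definition int_shift :: "bool list \<Rightarrow> int \<Rightarrow> int" where
  "int_shift bs x = (if 0 < x then num_shift bs (num_of_nat (nat x)) else 0)"

lemma int_shift_code [code]:
  "int_shift bs (Int.Pos n) = num_shift bs n" "int_shift bs 0 = 0" "int_shift bs (Int.Neg n) = 0"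
  by (simp_all add: int_shift_def)

definition reduce_once :: "int \<Rightarrow> int \<Rightarrow> int" where
  "reduce_once p r = (if p \<le> r then r - p else r)"

definition barrett :: "bool list \<Rightarrow> int \<Rightarrow> int \<Rightarrow> int \<Rightarrow> int" where
  "barrett bs p M x = reduce_once p (x - p * int_shift bs (M * x))"

definition mod_by :: "int \<Rightarrow> int \<Rightarrow> int" where
  "mod_by p x = x mod p"

text \<open>A list \<open>[c\<^sub>0, c\<^sub>1, \<dots>]\<close> stands for \<open>c\<^sub>0 + c\<^sub>1 \<theta> + \<dots>\<close>, where \<open>\<theta>\<close> to the power \<open>length f\<close> is
  the element denoted by \<open>f\<close>; \<open>rd\<close> reduces the coefficients.\<close>

fun padd :: "(int \<Rightarrow> int) \<Rightarrow> int list \<Rightarrow> int list \<Rightarrow> int list" where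
  "padd rd [] ys = ys"
| "padd rd (x # xs) [] = x # xs"
| "padd rd (x # xs) (y # ys) = rd (x + y) # padd rd xs ys"

fun pscale :: "(int \<Rightarrow> int) \<Rightarrow> int \<Rightarrow> int list \<Rightarrow> int list" where
  "pscale rd c [] = []"
| "pscale rd c (x # xs) = rd (c * x) # pscale rd c xs"

text \<open>Multiplication by \<theta>. A list shorter than \<open>f\<close> just moves up one
  place; in a full list the top coefficient would reach \<theta> to the power
  \<open>length f\<close>, and is replaced by the corresponding multiple of
  \<open>f\<close>.\<close>

definition pshift :: "(int \<Rightarrow> int) \<Rightarrow> int list \<Rightarrow> int list \<Rightarrow> int list" where
  "pshift rd f xs = (if xs \<noteq> [] \<and> length xs = length f
     then padd rd (0 # butlast xs) (pscale rd (last xs) f) else 0 # xs)"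

fun pmul :: "(int \<Rightarrow> int) \<Rightarrow> int list \<Rightarrow> int list \<Rightarrow> int list \<Rightarrow> int list" where
  "pmul rd f [] ys = []"
| "pmul rd f [x] ys = pscale rd x ys"
| "pmul rd f (x # x' # xs) ys = padd rd (pscale rd x ys) (pshift rd f (pmul rd f (x' # xs) ys))"

text \<open>The half power \<open>y\<close> is an argument, so it is computed once although it
  occurs twice.\<close>

fun pstep :: "(int \<Rightarrow> int) \<Rightarrow> int list \<Rightarrow> bool \<Rightarrow> int list \<Rightarrow> int list \<Rightarrow> int list" where
  "pstep rd f True x y = pmul rd f x (pmul rd f y y)"
| "pstep rd f False x y = pmul rd f y y"

text \<open>Bits come least significant first, so the power for the tail is squared. The clause for
  a single bit saves operations with 1.\<close>

fun ppow :: "(int \<Rightarrow> int) \<Rightarrow> int list \<Rightarrow> int list \<Rightarrow> bool list \<Rightarrow> int list" where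
  "ppow rd f x [] = [1]"
| "ppow rd f x [b] = (if b then x else [1])"
| "ppow rd f x (b # b' # bs) = pstep rd f b x (ppow rd f x (b' # bs))"

text \<open>Equality up to trailing zeros, with coefficients compared as integers: sufficient for
  equality of the denoted elements, not necessary.\<close>

fun peq :: "int list \<Rightarrow> int list \<Rightarrow> bool" where
  "peq [] [] = True"
| "peq (x # xs) [] = (x = 0 \<and> peq xs [])"
| "peq [] (y # ys) = (y = 0 \<and> peq [] ys)"
| "peq (x # xs) (y # ys) = (x = y \<and> peq xs ys)"

fun power_sum :: "(int \<Rightarrow> int) \<Rightarrow> int list \<Rightarrow> bool list \<Rightarrow> int list list \<Rightarrow> int list" where
  "power_sum rd f db [] = []"
| "power_sum rd f db (x # xs) = padd rd (ppow rd f x db) (power_sum rd f db xs)"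

fun geometric :: "(int \<Rightarrow> int) \<Rightarrow> int list \<Rightarrow> int list \<Rightarrow> nat \<Rightarrow> int list" where
  "geometric rd f y 0 = []"
| "geometric rd f y (Suc n) = padd rd [1] (pmul rd f y (geometric rd f y n))"

text \<open>With y = z^e, the vanishing of 1 + y + ... + y^(r-1) excludes y = 1 wherever r \<noteq>
  0. The order of z is certified by such equations because the list arithmetic proves equalities in
  the field, never inequalities.\<close>

fun check_root :: "(int \<Rightarrow> int) \<Rightarrow> int list \<Rightarrow> int list \<Rightarrow> (nat \<times> int) list \<Rightarrow> bool" where
  "check_root rd f z [] = True"
| "check_root rd f z ((r, e) # spec) =
     (peq (geometric rd f (ppow rd f z (ibits e)) r) [] \<and> check_root rd f z spec)"

fun check_cosets ::
    "(int \<Rightarrow> int) \<Rightarrow> int list \<Rightarrow> bool list \<Rightarrow> nat \<Rightarrow> int list \<Rightarrow> int list \<Rightarrow> nat \<Rightarrow> int list list list \<Rightarrow> bool" where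
  "check_cosets rd f db m g y 0 cs = True"
| "check_cosets rd f db m g y (Suc n) [] = False"
| "check_cosets rd f db m g y (Suc n) (c # cs) =
     (length c = m \<and> peq (power_sum rd f db c) y \<and> check_cosets rd f db m g (pmul rd f g y) n cs)"

text \<open>Congruence modulo \<open>F\<close> serves two purposes. With F = 0 in the field it is
  equality; in the polynomial ring with F = x^s minus the polynomial coded by \<open>f\<close> it
  shows that F divides x^q - x, before any \<theta> is available.\<close>

locale list_arith =
  fixes F \<theta> :: "'r :: comm_ring_1" and rd :: "int \<Rightarrow> int" and f :: "int list"
  fixes ev :: "int list \<Rightarrow> 'r"
  defines "ev \<equiv> \<lambda>xs. foldr (\<lambda>c acc. of_int c + \<theta> * acc) xs 0"
  assumes rd: "\<And>x. F dvd of_int (rd x) - of_int x"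
    and f: "F dvd ev f - \<theta> ^ length f"
begin

lemma ev_simps [simp]: "ev [] = 0" "ev (x # xs) = of_int x + \<theta> * ev xs"
  by (simp_all add: ev_def)

lemma ev_append: "ev (xs @ ys) = ev xs + \<theta> ^ length xs * ev ys"
  by (induction xs) (simp_all add: algebra_simps)

definition eqv :: "'r \<Rightarrow> 'r \<Rightarrow> bool" (infix "\<approx>" 50) where "x \<approx> y \<longleftrightarrow> F dvd x - y"

lemma eqv_refl [simp]: "x \<approx> x" by (simp add: eqv_def)

lemma eqv_trans [trans]: "x \<approx> y \<Longrightarrow> y \<approx> z \<Longrightarrow> x \<approx> z"
  unfolding eqv_def using dvd_add[of F "x - y" "y - z"] by simp

lemma eqv_add: "x \<approx> y \<Longrightarrow> x' \<approx> y' \<Longrightarrow> x + x' \<approx> y + y'"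
  unfolding eqv_def using dvd_add[of F "x - y" "x' - y'"] by (simp add: algebra_simps)

lemma eqv_mult: "x \<approx> y \<Longrightarrow> x' \<approx> y' \<Longrightarrow> x * x' \<approx> y * y'"
proof -
  assume "x \<approx> y" "x' \<approx> y'"
  hence "F dvd (x - y) * x' + y * (x' - y')" unfolding eqv_def by (intro dvd_add) auto
  thus ?thesis by (simp add: eqv_def algebra_simps)
qed

lemma rd_eqv: "of_int (rd x) \<approx> of_int x"
  using rd by (simp add: eqv_def)

lemma ev_padd: "ev (padd rd xs ys) \<approx> ev xs + ev ys"
proof (induction xs arbitrary: ys)
  case (Cons x xs)
  show ?case
  proof (cases ys)
    case (Cons y ys')
    have "of_int (rd (x + y)) + \<theta> * ev (padd rd xs ys') \<approx> of_int (x + y) + \<theta> * (ev xs + ev ys')"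
      by (intro eqv_add eqv_mult rd_eqv Cons.IH eqv_refl)
    thus ?thesis by (simp add: Cons algebra_simps)
  qed simp
qed simp

lemma ev_pscale: "ev (pscale rd c xs) \<approx> of_int c * ev xs"
proof (induction xs)
  case (Cons x xs)
  have "of_int (rd (c * x)) + \<theta> * ev (pscale rd c xs) \<approx> of_int (c * x) + \<theta> * (of_int c * ev xs)"
    by (intro eqv_add eqv_mult rd_eqv Cons.IH eqv_refl)
  thus ?case by (simp add: algebra_simps)
qed simp

lemma ev_pshift: "ev (pshift rd f xs) \<approx> \<theta> * ev xs"
proof (cases "xs \<noteq> [] \<and> length xs = length f")
  case True
  define ys c where "ys = butlast xs" and "c = last xs"
  have xs: "xs = ys @ [c]" using True by (simp add: ys_def c_def)
  have "ev (pshift rd f xs) \<approx> ev (0 # ys) + ev (pscale rd c f)"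
    unfolding pshift_def using True by (simp add: ev_padd ys_def c_def del: ev_simps)
  also have "\<dots> \<approx> ev (0 # ys) + of_int c * \<theta> ^ length f"
  proof (intro eqv_add eqv_refl)
    have "of_int c * ev f \<approx> of_int c * \<theta> ^ length f"
      by (intro eqv_mult eqv_refl) (simp add: eqv_def f)
    with ev_pscale show "ev (pscale rd c f) \<approx> of_int c * \<theta> ^ length f" by (rule eqv_trans)
  qed
  also have "ev (0 # ys) + of_int c * \<theta> ^ length f = \<theta> * ev xs"
  proof -
    have "length f = Suc (length ys)" using True by (simp add: xs)
    thus ?thesis by (simp add: xs ev_append algebra_simps)
  qed
  finally show ?thesis .
qed (auto simp: pshift_def)

lemma ev_pmul: "ev (pmul rd f xs ys) \<approx> ev xs * ev ys"
proof (induction xs rule: induct_list012)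
  case (2 x)
  show ?case using ev_pscale by simp
next
  case (3 x x' xs)
  have "ev (pshift rd f (pmul rd f (x' # xs) ys)) \<approx> \<theta> * (ev (x' # xs) * ev ys)"
    using ev_pshift by (rule eqv_trans) (intro eqv_mult eqv_refl 3)
  hence "ev (pscale rd x ys) + ev (pshift rd f (pmul rd f (x' # xs) ys))
      \<approx> of_int x * ev ys + \<theta> * (ev (x' # xs) * ev ys)"
    by (intro eqv_add ev_pscale)
  with ev_padd have "ev (pmul rd f (x # x' # xs) ys) \<approx> of_int x * ev ys + \<theta> * (ev (x' # xs) * ev ys)"
    unfolding pmul.simps by (rule eqv_trans)
  thus ?case by (simp add: algebra_simps)
qed simp

lemma ev_ppow: "ev (ppow rd f x bs) \<approx> ev x ^ bval bs"
proof (induction bs rule: induct_list012)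
  case (3 b b' bs)
  define y where "y = ppow rd f x (b' # bs)"
  have sq: "ev (pmul rd f y y) \<approx> ev x ^ (2 * bval (b' # bs))"
    using ev_pmul
  proof (rule eqv_trans)
    show "ev y * ev y \<approx> ev x ^ (2 * bval (b' # bs))"
      unfolding mult_2 power_add y_def by (intro eqv_mult 3)
  qed
  show ?case
  proof (cases b)
    case True
    have "ev (pmul rd f x (pmul rd f y y)) \<approx> ev x * ev x ^ (2 * bval (b' # bs))"
      using ev_pmul by (rule eqv_trans) (intro eqv_mult eqv_refl sq)
    thus ?thesis using True by (simp add: y_def)
  next
    case False
    thus ?thesis using sq by (simp add: y_def)
  qed
qed simp_all

lemma peq_imp_eq: "peq xs ys \<Longrightarrow> ev xs = ev ys"
  by (induction xs ys rule: peq.induct) auto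

lemma ev_power_sum: "ev (power_sum rd f db cs) \<approx> (\<Sum>c\<leftarrow>cs. ev c ^ bval db)"
proof (induction cs)
  case (Cons c cs)
  have "ev (ppow rd f c db) + ev (power_sum rd f db cs) \<approx> ev c ^ bval db + (\<Sum>c\<leftarrow>cs. ev c ^ bval db)"
    by (intro eqv_add ev_ppow Cons)
  with ev_padd show ?case by (auto intro: eqv_trans)
qed simp

lemma ev_geometric: "ev (geometric rd f y n) \<approx> (\<Sum>i<n. ev y ^ i)"
proof (induction n)
  case (Suc n)
  have "ev (pmul rd f y (geometric rd f y n)) \<approx> ev y * (\<Sum>i<n. ev y ^ i)"
    using ev_pmul by (rule eqv_trans) (intro eqv_mult eqv_refl Suc)
  hence "ev [1] + ev (pmul rd f y (geometric rd f y n)) \<approx> ev [1] + ev y * (\<Sum>i<n. ev y ^ i)"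
    by (intro eqv_add eqv_refl)
  with ev_padd have "ev (geometric rd f y (Suc n)) \<approx> ev [1] + ev y * (\<Sum>i<n. ev y ^ i)"
    unfolding geometric.simps by (rule eqv_trans)
  also have "ev [1] + ev y * (\<Sum>i<n. ev y ^ i) = (\<Sum>i<Suc n. ev y ^ i)"
    by (subst sum.lessThan_Suc_shift) (simp add: sum_distrib_left)
  finally show ?case .
qed simp

end

section \<open>From coset representatives to all nonzero elements\<close>

context finite_subfield
begin

definition power_sums :: "nat \<Rightarrow> nat \<Rightarrow> 'b set" where
  "power_sums d m = {a. \<exists>xs. set xs \<subseteq> K \<and> length xs = m \<and> a = (\<Sum>x\<leftarrow>xs. x ^ d)}"

lemma power_sums_mult:
  assumes "a \<in> power_sums d m" "h \<in> K"
  shows "a * h ^ d \<in> power_sums d m"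
proof -
  obtain xs where xs: "set xs \<subseteq> K" "length xs = m" "a = (\<Sum>x\<leftarrow>xs. x ^ d)"
    using assms(1) by (auto simp: power_sums_def)
  have "a * h ^ d = (\<Sum>x\<leftarrow>map (\<lambda>x. x * h) xs. x ^ d)"
    by (simp add: xs(3) comp_def power_mult_distrib sum_list_mult_const)
  thus ?thesis using xs assms(2) unfolding power_sums_def
    by (intro CollectI exI[of _ "map (\<lambda>x. x * h) xs"]) (auto simp: mult_K)
qed

lemma power_sums_mono:
  assumes "a \<in> power_sums d m" "m \<le> n" "0 < d"
  shows "a \<in> power_sums d n"
proof -
  obtain xs where xs: "set xs \<subseteq> K" "length xs = m" "a = (\<Sum>x\<leftarrow>xs. x ^ d)"
    using assms(1) by (auto simp: power_sums_def)
  thus ?thesis using assms(2,3) unfolding power_sums_def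
    by (intro CollectI exI[of _ "xs @ replicate (n - m) 0"]) (auto simp: zero_K sum_list_replicate zero_power)
qed

text \<open>If \<open>d\<close> vanished in the field, so would its multiple q - 1, and q vanishes
  anyway.\<close>

lemma of_nat_neq_0: assumes "d dvd q - 1" shows "of_nat d \<noteq> (0 :: 'b)"
proof
  assume "of_nat d = (0 :: 'b)"
  hence "of_nat (q - 1) = (0 :: 'b)" using assms by (auto elim!: dvdE)
  thus False using of_nat_q q_ge_2 by (simp add: of_nat_diff)
qed

text \<open>The sums in \<open>prim\<close> make z = g^((q-1)/d) a primitive d-th root of unity:
  z^(d/r) = 1 would turn the sum into r, which is nonzero. Now a^((q-1)/d) is a d-th root of unity,
  hence some z^j, and a / g^j is a d-th power because its power with exponent (q - 1) / d is
  1.\<close>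

lemma coset_representatives:
  assumes d: "d dvd q - 1" "0 < d" and g: "g \<in> K"
    and prim: "\<And>r. prime r \<Longrightarrow> r dvd d \<Longrightarrow> (\<Sum>i<r. ((g ^ ((q - 1) div d)) ^ (d div r)) ^ i) = 0"
    and a: "a \<in> Ks"
  shows "\<exists>j<d. \<exists>h\<in>K. a = g ^ j * h ^ d"
proof (cases "d = 1")
  case True
  thus ?thesis using a by (intro exI[of _ 0]) auto
next
  case False
  define f where "f = (q - 1) div d"
  have fd: "f * d = q - 1" "0 < f" using d q_ge_2 by (auto simp: f_def intro!: gr0I)
  define z where "z = g ^ f"
  have sum_z: "(\<Sum>i<r. (z ^ (d div r)) ^ i) = 0" if "prime r" "r dvd d" for r
    using prim[OF that] by (simp add: z_def f_def)
  have z0: "z \<noteq> 0"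
  proof
    assume "z = 0"
    obtain r where r: "prime r" "r dvd d" using False prime_factor_nat by blast
    hence "0 < d div r" using d(2) by (auto elim!: dvdE)
    hence "(\<Sum>i<r. (z ^ (d div r)) ^ i) = (\<Sum>i<r. if i = 0 then 1 else 0)"
      by (intro sum.cong) (auto simp: \<open>z = 0\<close>)
    also have "\<dots> = 1" using r(1) prime_gt_0_nat by (simp add: sum.delta')
    finally show False using sum_z[OF r] by simp
  qed
  hence gKs: "g \<in> Ks" using g fd(2) by (auto simp: z_def zero_power)
  have zd: "z ^ d = 1"
    using power_q_minus_1[OF gKs] by (simp add: z_def fd(1) flip: power_mult)
  have zn: "z ^ n \<noteq> 1" if n: "0 < n" "n < d" for n
  proof
    assume zn1: "z ^ n = 1"
    \<comment> \<open>A relation z^n = 1 descends by Bezout to the proper divisor gcd n d of d, and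
      from there to d / r for a prime r dividing the cofactor.\<close>
    obtain x y where "n * x = d * y + gcd n d" using bezout_nat[of n d] n by auto
    hence "z ^ (n * x) = z ^ (d * y) * z ^ gcd n d" by (simp add: power_add)
    hence ze: "z ^ gcd n d = 1" using zn1 zd by (simp add: power_mult)
    define e where "e = gcd n d"
    have e: "e dvd d" "e < d" "0 < e" using n by (auto simp: e_def intro: le_less_trans[OF gcd_le1_nat])
    then obtain c where c: "d = e * c" "c \<noteq> 1" by (auto elim!: dvdE)
    then obtain r where r: "prime r" "r dvd c" using prime_factor_nat by blast
    then obtain b where b: "c = r * b" by (auto elim!: dvdE)
    have r0: "0 < r" using r(1) prime_gt_0_nat by simp
    have "z ^ (d div r) = (z ^ e) ^ b"
      using r0 by (simp add: c b mult.left_commute flip: power_mult)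
    hence "z ^ (d div r) = 1" using ze by (simp add: e_def)
    hence "of_nat r = (0 :: 'b)" using sum_z[OF r(1)] r(2) c(1) by simp
    thus False using of_nat_neq_0[of r] r(2) c(1) d(1) by (meson dvd_trans dvd_mult)
  qed
  have inj: "inj_on (\<lambda>j. z ^ j) {..<d}"
  proof (rule linorder_inj_onI)
    fix i j assume ij: "i < j" "i \<in> {..<d}" "j \<in> {..<d}"
    show "z ^ i \<noteq> z ^ j"
    proof
      assume "z ^ i = z ^ j"
      hence "z ^ (j - i) = 1" using ij z0 by (simp add: power_diff)
      thus False using zn[of "j - i"] ij by (simp add: less_imp_diff_less)
    qed
  qed auto
  have "(\<lambda>j. z ^ j) ` {..<d} = {x \<in> K. x ^ d = 1}"
  proof (rule card_seteq)
    show "finite {x \<in> K. x ^ d = 1}" using finite_K by simp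
    show "(\<lambda>j. z ^ j) ` {..<d} \<subseteq> {x \<in> K. x ^ d = 1}"
      using g zd by (auto simp: z_def power_K power_commutes simp flip: power_mult)
        (metis mult.commute power_mult power_one z_def)
    show "card {x \<in> K. x ^ d = 1} \<le> card ((\<lambda>j. z ^ j) ` {..<d})"
      using card_power_eq_le[OF d(2)] by (simp add: card_image[OF inj])
  qed
  moreover have "(a ^ f) ^ d = 1" using power_q_minus_1[OF a] by (simp add: fd(1) flip: power_mult)
  ultimately have "a ^ f \<in> (\<lambda>j. z ^ j) ` {..<d}" using a by (simp add: power_K)
  then obtain j where j: "j < d" "a ^ f = z ^ j" by auto
  have "(a / g ^ j) ^ f = 1"
    using j z0 by (simp add: power_divide z_def mult.commute flip: power_mult)
  hence "a / g ^ j \<in> H d"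
    using a gKs unfolding H_eq[OF d] f_def by (simp add: divide_K power_K)
  then obtain h where "h \<in> K" "a / g ^ j = h ^ d" by (auto simp: H_def)
  thus ?thesis using j gKs by (intro exI[of _ j]) (auto simp: field_simps)
qed

lemma cosets_imp_power_sums:
  assumes d: "d dvd q - 1" "0 < d" and g: "g \<in> K"
    and "\<And>r. prime r \<Longrightarrow> r dvd d \<Longrightarrow> (\<Sum>i<r. ((g ^ ((q - 1) div d)) ^ (d div r)) ^ i) = 0"
    and "\<And>j. j < d \<Longrightarrow> g ^ j \<in> power_sums d m"
    and "a \<in> Ks"
  shows "a \<in> power_sums d m"
  using coset_representatives[OF assms(1-4,6)] assms(5) power_sums_mult by blast

end

text \<open>\<open>spec\<close> lists the prime divisors \<open>r\<close> of \<open>d\<close> with \<open>e = d / r\<close>.\<close>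

definition is_spec :: "nat \<Rightarrow> (nat \<times> int) list \<Rightarrow> bool" where
  "is_spec d spec \<longleftrightarrow> (\<forall>r. prime r \<longrightarrow> r dvd d \<longrightarrow> (r, int (d div r)) \<in> set spec)"

locale field_arith = finite_subfield K for K :: "'b :: field set" +
  fixes rd :: "int \<Rightarrow> int" and f :: "int list" and \<theta> :: 'b
  assumes \<theta>: "\<theta> \<in> K" "\<theta> ^ length f = foldr (\<lambda>c acc. of_int c + \<theta> * acc) f 0"
    and rd: "\<And>x. of_int (rd x) = (of_int x :: 'b)"
begin

sublocale L: list_arith 0 \<theta> rd f "\<lambda>xs. foldr (\<lambda>c acc. of_int c + \<theta> * acc) xs 0"
  by unfold_locales (simp_all add: rd \<theta>(2))

abbreviation ev :: "int list \<Rightarrow> 'b" where "ev \<equiv> \<lambda>xs. foldr (\<lambda>c acc. of_int c + \<theta> * acc) xs 0"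

lemma ev_K: "ev xs \<in> K"
  by (induction xs) (auto simp: zero_K add_K mult_K of_int_K \<theta>)

lemma eqv_iff: "L.eqv x y \<longleftrightarrow> x = y"
  by (simp add: L.eqv_def)

lemma power_sum_in:
  "ev (power_sum rd f db cs) \<in> power_sums (bval db) (length cs)"
proof -
  have "ev (power_sum rd f db cs) = (\<Sum>x\<leftarrow>map ev cs. x ^ bval db)"
    using L.ev_power_sum[of db cs] by (simp add: eqv_iff comp_def)
  thus ?thesis unfolding power_sums_def
    by (intro CollectI exI[of _ "map ev cs"]) (auto simp: ev_K)
qed

lemma check_cosets_sound:
  assumes "check_cosets rd f db m g y n cs" "j < n"
  shows "ev g ^ j * ev y \<in> power_sums (bval db) m"
  using assms
proof (induction n arbitrary: j y cs)
  case (Suc n)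
  obtain c cs' where cs: "cs = c # cs'" using Suc.prems by (cases cs) auto
  show ?case
  proof (cases j)
    case 0
    thus ?thesis using Suc.prems power_sum_in[of db c] L.peq_imp_eq[of "power_sum rd f db c" y]
      by (simp add: cs)
  next
    case (Suc j')
    have "ev g ^ j' * ev (pmul rd f g y) \<in> power_sums (bval db) m"
      using Suc.prems Suc by (intro Suc.IH[of _ cs']) (auto simp: cs)
    thus ?thesis using L.ev_pmul[of g y] Suc by (simp add: eqv_iff mult_ac)
  qed
qed simp

lemma check_root_sound:
  assumes "check_root rd f z spec" "(r, e) \<in> set spec"
  shows "(\<Sum>i<r. (ev z ^ nat e) ^ i) = 0"
  using assms
proof (induction spec)
  case (Cons x spec)
  show ?case
  proof (cases "x = (r, e)")
    case True
    hence "ev (geometric rd f (ppow rd f z (ibits e)) r) = 0"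
      using Cons.prems L.peq_imp_eq[of "geometric rd f (ppow rd f z (ibits e)) r" "[]"] by simp
    thus ?thesis using L.ev_geometric[of "ppow rd f z (ibits e)" r] L.ev_ppow[of z "ibits e"]
      by (simp add: eqv_iff bval_ibits)
  qed (use Cons in \<open>cases x; auto\<close>)
qed simp

lemma check_sound:
  assumes d: "d dvd q - 1" "0 < d" and spec: "is_spec d spec" and db: "bval db = d"
    and eb: "bval eb = (q - 1) div d"
    and root: "check_root rd f (ppow rd f g eb) spec"
    and cosets: "check_cosets rd f db m g [1] d cs"
    and a: "a \<in> Ks"
  shows "a \<in> power_sums d m"
proof (rule cosets_imp_power_sums[OF d ev_K[of g] _ _ a])
  fix r assume r: "prime r" "r dvd d"
  hence "(r, int (d div r)) \<in> set spec" using spec by (auto simp: is_spec_def)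
  from check_root_sound[OF root this] L.ev_ppow[of g eb]
  show "(\<Sum>i<r. ((ev g ^ ((q - 1) div d)) ^ (d div r)) ^ i) = 0" by (simp add: eqv_iff eb)
next
  fix j assume "j < d"
  from check_cosets_sound[OF cosets this] show "ev g ^ j \<in> power_sums d m" by (simp add: db)
qed

end
text \<open>The tabulated primes are below 2^14, so a product of two residues is below 2^28. For
  such numbers the approximate quotient falls short by at most 1, which the single subtraction in
  \<open>reduce_once\<close> repairs.\<close>

definition barrett_28 :: "int \<Rightarrow> int \<Rightarrow> int" where
  "barrett_28 p = barrett (replicate 28 True) p (268435456 div p)"

fun chunks :: "nat \<Rightarrow> nat \<Rightarrow> int list \<Rightarrow> int list list list" where
  "chunks 0 m xs = []"
| "chunks (Suc n) m xs = map (\<lambda>x. [x]) (take m xs) # chunks n m (drop m xs)"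

fun check_with ::
  "(int \<Rightarrow> int) \<Rightarrow> int list \<Rightarrow> nat \<Rightarrow> bool list \<Rightarrow> bool list \<Rightarrow> (nat \<times> int) list \<Rightarrow> nat \<Rightarrow> int list \<Rightarrow> int list list list \<Rightarrow> bool" where
  "check_with rd f d db eb spec m g cs =
     (check_root rd f (ppow rd f g eb) spec \<and> check_cosets rd f db m g [1] d cs)"

fun check_prime :: "nat \<Rightarrow> (nat \<times> int) list \<Rightarrow> nat \<Rightarrow> int \<times> int \<times> int list \<Rightarrow> bool" where
  "check_prime d spec m (p, g, xs) =
     check_with (barrett_28 p) [0] d (ibits (int d)) (ibits ((p - 1) div int d)) spec m [g] (chunks d m xs)"

fun check_minus_one :: "nat \<Rightarrow> int \<times> int list \<Rightarrow> bool" where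
  "check_minus_one d (p, xs) =
     peq (power_sum (barrett_28 p) [0] (ibits (int d)) (map (\<lambda>x. [x]) xs)) [p - 1]"

text \<open>A field with \<open>n = p\<^sup>s\<close> elements is presented as \<open>F\<^sub>p[\<theta>]\<close>; \<open>f\<close> gives \<open>\<theta>\<^sup>s\<close>.\<close>

fun check_presentation :: "int \<Rightarrow> int \<Rightarrow> int list \<Rightarrow> bool" where
  "check_presentation n p f =
     (f \<noteq> [] \<and> p ^ length f = n \<and> peq (ppow (mod_by p) f [0, 1] (ibits n)) [0, 1])"

fun check_extension ::
  "nat \<Rightarrow> (nat \<times> int) list \<Rightarrow> nat \<Rightarrow> int \<times> int \<times> int list \<times> int list \<times> int list list list \<Rightarrow> bool" where
  "check_extension d spec m (n, p, f, g, cs) =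
     (check_presentation n p f \<and>
      check_with (mod_by p) f d (ibits (int d)) (ibits ((n - 1) div int d)) spec m g cs)"

fun check_extension_minus_one :: "nat \<Rightarrow> int \<times> int \<times> int list \<times> int list list \<Rightarrow> bool" where
  "check_extension_minus_one d (n, p, f, xs) =
     (check_presentation n p f \<and>
      peq (power_sum (mod_by p) f (ibits (int d)) xs) [p - 1])"

section \<open>Soundness of the certificates\<close>

context finite_subfield
begin

lemma of_int_char:
  assumes "of_int p = (0 :: 'b)"
  shows "of_int (mod_by p x) = (of_int x :: 'b)" "of_int (barrett bs p M x) = (of_int x :: 'b)"
  using assms
  by (simp_all add: mod_by_def barrett_def reduce_once_def minus_div_mult_eq_mod[symmetric])

lemma bval_quotient: "bval (ibits ((int q - 1) div int d)) = (q - 1) div d"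
proof -
  have "(int q - 1) div int d = int ((q - 1) div d)"
    using q_ge_2 by (simp add: zdiv_int of_nat_diff)
  thus ?thesis by (simp only: bval_ibits nat_int)
qed

lemma check_prime_sound:
  assumes d: "d dvd q - 1" "0 < d" and spec: "is_spec d spec" and "check_prime d spec m e"
    and q: "fst e = int q" and a: "a \<in> Ks"
  shows "a \<in> power_sums d m"
proof -
  obtain p g xs where e: "e = (p, g, xs)" by (cases e)
  have p: "p = int q" using q by (simp add: e)
  have char: "of_int p = (0 :: 'b)" by (simp add: p of_nat_q)
  \<comment> \<open>A prime field needs one coefficient per element: \<theta> = 0 satisfies
    \<theta>^1 = 0, which is what the list \<open>[0]\<close> encodes.\<close>
  interpret field_arith K "barrett_28 p" "[0]" 0
    by unfold_locales (simp_all add: zero_K barrett_28_def of_int_char[OF char])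
  have "bval (ibits ((p - 1) div int d)) = (q - 1) div d"
    unfolding p by (rule bval_quotient)
  from check_sound[OF d spec _ this _ _ a, where db = "ibits (int d)" and g = "[g]" and cs = "chunks d m xs"]
  show ?thesis using assms(4) by (simp only: e check_prime.simps check_with.simps bval_ibits nat_int)
qed

lemma check_minus_one_sound:
  assumes "check_minus_one d (p, xs)" and p: "p = int q"
  shows "- 1 \<in> power_sums d (length xs)"
proof -
  have char: "of_int p = (0 :: 'b)" by (simp add: p of_nat_q)
  interpret field_arith K "barrett_28 p" "[0]" 0
    by unfold_locales (simp_all add: zero_K barrett_28_def of_int_char[OF char])
  show ?thesis
    using power_sum_in[of "ibits (int d)" "map (\<lambda>x. [x]) xs"] L.peq_imp_eq[OF assms(1)[simplified]]
    by (simp add: bval_ibits char)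
qed

text \<open>\<open>f\<close> divides \<open>x\<^sup>q - x\<close>, which splits over \<open>K\<close>.\<close>

lemma root_exists:
  fixes p :: int and f :: "int list"
  assumes char: "of_int p = (0 :: 'b)" and fne: "f \<noteq> []"
    and pow: "peq (ppow (mod_by p) f [0, 1] (ibits (int q))) [0, 1]"
  shows "\<exists>\<theta>\<in>K. \<theta> ^ length f = foldr (\<lambda>c acc. of_int c + \<theta> * acc) f 0"
proof -
  define X where "X = [:0, 1 :: 'b:]"
  define ev where "ev = (\<lambda>xs. foldr (\<lambda>c acc. of_int c + X * acc) xs 0)"
  define F where "F = X ^ length f - ev f"
  have char': "of_int p = (0 :: 'b poly)" by (simp add: of_int_poly char)
  \<comment> \<open>The same list routines, read in the polynomial ring, compute x^q modulo
    F.\<close>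
  interpret list_arith F X "mod_by p" f ev
    by unfold_locales (simp_all add: ev_def F_def mod_by_def char' dvd_diff_commute
         minus_div_mult_eq_mod[symmetric])
  have "F dvd X ^ q - X"
    using ev_ppow[of "[0, 1]" "ibits (int q)"] peq_imp_eq[OF pow]
    by (simp add: bval_ibits eqv_def dvd_diff_commute)
  then obtain G where G: "X ^ q - X = F * G" by (elim dvdE)
  have poly_ev: "poly (ev xs) \<theta> = foldr (\<lambda>c acc. of_int c + \<theta> * acc) xs 0" for xs \<theta>
    by (induction xs) (simp_all add: X_def of_int_poly)
  have deg_ev: "xs \<noteq> [] \<Longrightarrow> degree (ev xs) < length xs" for xs
  proof (induction xs)
    case (Cons x xs)
    have "degree (X * ev xs) \<le> length xs"
    proof (cases "xs = []")
      case False
      have "degree (X * ev xs) \<le> 1 + degree (ev xs)"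
        using degree_mult_le[of X "ev xs"] by (simp add: X_def)
      thus ?thesis using Cons.IH[OF False] by simp
    qed simp
    thus ?case by (simp add: of_int_poly degree_add_le le_imp_less_Suc)
  qed simp
  have X: "X ^ n = monom 1 n" for n by (simp add: X_def monom_altdef)
  have degF: "degree F = length f"
    using degree_add_eq_left[of "- ev f" "monom 1 (length f)"] deg_ev[OF fne]
    by (simp add: F_def X degree_monom_eq)
  have degq: "degree (X ^ q - X) = q"
    using degree_add_eq_left[of "- X" "monom 1 q"] q_ge_2
    by (simp add: X diff_conv_add_uminus del: add_uminus_conv_diff)
       (simp add: X_def degree_monom_eq)
  hence nz: "X ^ q - X \<noteq> 0" using q_ge_2 by auto
  hence G0: "G \<noteq> 0" and F0: "F \<noteq> 0" using G by auto
  have degG: "degree G < q"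
    using degq degF fne F0 G0 unfolding G by (cases f) (auto simp: degree_mult_eq)
  have "\<exists>\<theta>\<in>K. poly F \<theta> = 0"
  proof (rule ccontr)
    assume no: "\<not> ?thesis"
    \<comment> \<open>Every element of \<open>K\<close> is a root of F G. If none is a root of F,
      then G has q roots, more than its degree.\<close>
    have "K \<subseteq> {x. poly G x = 0}"
    proof
      fix x assume x: "x \<in> K"
      have "x ^ q = x"
      proof (cases "x = 0")
        case False
        have "x ^ q = x * x ^ (q - 1)" using q_ge_2 by (simp flip: power_Suc)
        thus ?thesis using power_q_minus_1[of x] x False by simp
      qed (use q_ge_2 in simp)
      hence "poly (X ^ q - X) x = 0" by (simp add: X_def)
      thus "x \<in> {x. poly G x = 0}" using no x unfolding G by simp
    qed
    hence "q \<le> card {x. poly G x = 0}"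
      unfolding q_def by (intro card_mono poly_roots_finite G0)
    also have "\<dots> \<le> degree G" by (rule card_poly_roots_bound[OF G0])
    finally show False using degG by simp
  qed
  then obtain \<theta> where "\<theta> \<in> K" "poly F \<theta> = 0" by blast
  thus ?thesis by (intro bexI[of _ \<theta>]) (auto simp: F_def poly_ev X_def)
qed

lemma extension_arith:
  fixes p :: int
  assumes "check_presentation (int q) p f"
  obtains \<theta> where "of_int p = (0 :: 'b)" "field_arith K (mod_by p) f \<theta>"
proof -
  have f: "f \<noteq> []" and pq: "p ^ length f = int q"
    and pow: "peq (ppow (mod_by p) f [0, 1] (ibits (int q))) [0, 1]"
    using assms by auto
  have "(of_int p :: 'b) ^ length f = of_nat q"
    using arg_cong[OF pq, of "of_int :: int \<Rightarrow> 'b"] by simp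
  hence char: "of_int p = (0 :: 'b)" using of_nat_q by simp
  obtain \<theta> where "\<theta> \<in> K" "\<theta> ^ length f = foldr (\<lambda>c acc. of_int c + \<theta> * acc) f 0"
    using root_exists[OF char f pow] by blast
  thus thesis
    by (intro that[of \<theta>] char) (unfold_locales, simp_all add: of_int_char[OF char])
qed

lemma check_extension_sound:
  assumes d: "d dvd q - 1" "0 < d" and spec: "is_spec d spec"
    and check: "check_extension d spec m e" and n: "fst e = int q" and a: "a \<in> Ks"
  shows "a \<in> power_sums d m"
proof -
  obtain p f g cs where e: "e = (int q, p, f, g, cs)" using n by (cases e) auto
  have "check_presentation (int q) p f" using check by (simp only: e check_extension.simps)
  then obtain \<theta> where fa: "field_arith K (mod_by p) f \<theta>" by (rule extension_arith)
  interpret field_arith K "mod_by p" f \<theta> by (rule fa)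
  from check_sound[OF d spec _ bval_quotient _ _ a, where db = "ibits (int d)" and g = g and cs = cs]
  show ?thesis using check by (simp only: e check_extension.simps check_with.simps bval_ibits nat_int)
qed

lemma check_extension_minus_one_sound:
  assumes check: "check_extension_minus_one d (int q, p, f, xs)"
  shows "- 1 \<in> power_sums d (length xs)"
proof -
  have "check_presentation (int q) p f" using check by (simp only: check_extension_minus_one.simps)
  then obtain \<theta> where char: "of_int p = (0 :: 'b)" and fa: "field_arith K (mod_by p) f \<theta>"
    by (rule extension_arith)
  interpret field_arith K "mod_by p" f \<theta> by (rule fa)
  show ?thesis
    using power_sum_in[of "ibits (int d)" xs] L.peq_imp_eq[of _ "[p - 1]"] check
    by (simp add: bval_ibits char del: check_presentation.simps)
qed

end

section \<open>Orders of finite fields, and the claim for residue fields\<close>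

context finite_subfield
begin

text \<open>A dimension count without bases: among the L-subspaces whose size is a power of
  \<open>card L\<close> take a largest one. For x outside it, adjoining the multiples of x would
  multiply its size by \<open>card L\<close>.\<close>

lemma card_power_of_subfield:
  assumes "finite_subfield L" "L \<subseteq> K"
  shows "\<exists>e. q = card L ^ e"
proof -
  interpret L: finite_subfield L by fact
  define S where "S = {V. V \<subseteq> K \<and> 0 \<in> V \<and> (\<forall>x\<in>V. \<forall>y\<in>V. x - y \<in> V) \<and> (\<forall>l\<in>L. \<forall>x\<in>V. l * x \<in> V)
    \<and> (\<exists>e. card V = card L ^ e)}"
  have "finite S" using finite_K by (intro finite_subset[of S "Pow K"]) (auto simp: S_def)
  moreover have "{0} \<in> S" by (auto simp: S_def zero_K intro: exI[of _ 0])
  ultimately obtain V where V: "V \<in> S" and max: "\<And>W. W \<in> S \<Longrightarrow> card W \<le> card V"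
    using Max_in[of "card ` S"] Max_ge[of "card ` S"] by fastforce
  obtain e where e: "card V = card L ^ e" using V by (auto simp: S_def)
  have Vadd: "x + y \<in> V" if "x \<in> V" "y \<in> V" for x y
  proof -
    have "0 - y \<in> V" using V that by (auto simp: S_def)
    hence "x - (0 - y) \<in> V" using V that unfolding S_def by blast
    thus ?thesis by simp
  qed
  have "V = K"
  proof (rule ccontr)
    assume "V \<noteq> K"
    with V obtain x where x: "x \<in> K" "x \<notin> V" by (auto simp: S_def)
    define h where "h = (\<lambda>(v, l). v + l * x)"
    have inj: "inj_on h (V \<times> L)"
    proof (rule inj_onI, clarify)
      fix v l v' l' assume *: "v \<in> V" "l \<in> L" "v' \<in> V" "l' \<in> L" "h (v, l) = h (v', l')"
      have "l = l'"
      proof (rule ccontr)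
        assume "l \<noteq> l'"
        hence "x = inverse (l - l') * (v' - v)"
          using * by (simp add: h_def field_simps)
        moreover have "inverse (l - l') \<in> L" "v' - v \<in> V"
          using * V by (auto simp: L.inverse_K L.diff_K S_def)
        ultimately show False using x V unfolding S_def by blast
      qed
      with * show "v = v' \<and> l = l'" by (simp add: h_def)
    qed
    have hV: "h (v, l) - h (v', l') = h (v - v', l - l')" for v l v' l'
      by (simp add: h_def algebra_simps)
    have hm: "c * h (v, l) = h (c * v, c * l)" for c v l
      by (simp add: h_def algebra_simps)
    have "h ` (V \<times> L) \<in> S"
      unfolding S_def
    proof (intro CollectI conjI ballI)
      show "h ` (V \<times> L) \<subseteq> K" using V x assms(2) by (auto simp: h_def S_def intro!: add_K mult_K)
      show "0 \<in> h ` (V \<times> L)" using V L.zero_K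
        by (intro image_eqI[of _ _ "(0, 0)"]) (auto simp: h_def S_def)
      show "\<exists>e. card (h ` (V \<times> L)) = card L ^ e"
        using e by (intro exI[of _ "Suc e"]) (simp add: card_image[OF inj] card_cartesian_product)
      show "y - z \<in> h ` (V \<times> L)" if "y \<in> h ` (V \<times> L)" "z \<in> h ` (V \<times> L)" for y z
      proof -
        from that obtain v l v' l' where "y = h (v, l)" "z = h (v', l')" "v \<in> V" "v' \<in> V" "l \<in> L" "l' \<in> L"
          by blast
        thus ?thesis using V by (auto simp: hV S_def L.diff_K intro!: imageI)
      qed
      show "c * y \<in> h ` (V \<times> L)" if "c \<in> L" "y \<in> h ` (V \<times> L)" for c y
      proof -
        from that obtain v l where "y = h (v, l)" "v \<in> V" "l \<in> L" by blast
        thus ?thesis using V that by (auto simp: hm S_def L.mult_K intro!: imageI)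
      qed
    qed
    hence "card V * card L \<le> card V"
      using max[of "h ` (V \<times> L)"] by (simp add: card_image[OF inj] card_cartesian_product)
    moreover have "0 < card V" using V finite_K finite_subset by (auto simp: S_def card_gt_0_iff)
    ultimately show False using L.q_ge_2 by (simp add: L.q_def)
  qed
  thus ?thesis using e by (auto simp: q_def)
qed

text \<open>The integers have an image in \<open>K\<close> with p elements, p being the
  characteristic. It is a subfield, so q is a power of p.\<close>

lemma q_prime_power: "\<exists>p e. prime p \<and> q = p ^ e"
proof -
  define p where "p = CHAR('b)"
  define L where "L = range (of_int :: int \<Rightarrow> 'b)"
  have LK: "L \<subseteq> K" by (auto simp: L_def of_int_K)
  have L: "finite_subfield L"
  proof
    show "finite L" using LK finite_K finite_subset by blast
    show "0 \<in> L" "1 \<in> L" unfolding L_def by (metis of_int_0 rangeI, metis of_int_1 rangeI)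
    show "x - y \<in> L" "x * y \<in> L" if "x \<in> L" "y \<in> L" for x y
      using that unfolding L_def by (auto simp flip: of_int_diff of_int_mult)
  qed
  have "0 < p" unfolding p_def CHAR_pos_iff using of_nat_q q_ge_2 by (intro exI[of _ q]) auto
  hence p: "prime p" unfolding p_def by (rule prime_CHAR_semidom)
  have eq: "L = of_nat ` {..<p}"
  proof
    show "L \<subseteq> of_nat ` {..<p}"
    proof
      fix x assume "x \<in> L"
      then obtain i where i: "x = of_int i" by (auto simp: L_def)
      have "of_int i = (of_int (i mod int p) + of_int (i div int p) * of_nat p :: 'b)"
        by (metis mod_div_mult_eq of_int_add of_int_mult of_int_of_nat_eq)
      hence "x = of_nat (nat (i mod int p))"
        using \<open>0 < p\<close> by (simp add: i p_def of_nat_nat)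
      moreover have "nat (i mod int p) < p" using \<open>0 < p\<close> by (simp add: nat_less_iff)
      ultimately show "x \<in> of_nat ` {..<p}" by blast
    qed
    show "of_nat ` {..<p} \<subseteq> L" unfolding L_def by (metis image_subsetI of_int_of_nat_eq rangeI)
  qed
  have inj: "inj_on (of_nat :: nat \<Rightarrow> 'b) {..<p}"
  proof (rule linorder_inj_onI)
    fix i j assume ij: "i < j" "i \<in> {..<p}" "j \<in> {..<p}"
    show "of_nat i \<noteq> (of_nat j :: 'b)"
    proof
      assume "of_nat i = (of_nat j :: 'b)"
      hence "of_nat (j - i) = (0 :: 'b)" using ij by (simp add: of_nat_diff)
      hence "p dvd j - i" by (simp add: of_nat_eq_0_iff_char_dvd p_def)
      thus False using ij by (auto dest!: dvd_imp_le)
    qed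
  qed auto
  have "card L = p" by (simp add: eq card_image[OF inj])
  with card_power_of_subfield[OF L LK] p show ?thesis by auto
qed

definition waring :: "nat \<Rightarrow> nat \<Rightarrow> bool" where
  "waring k m \<longleftrightarrow> (\<forall>a\<in>K. \<exists>xs. set xs \<subseteq> K \<and> length xs = m \<and> (\<exists>x\<in>set xs. x \<noteq> 0) \<and> a = (\<Sum>x\<leftarrow>xs. x ^ k))"

lemma waringI:
  assumes "0 < d" "0 < m" and nz: "\<And>a. a \<in> Ks \<Longrightarrow> a \<in> power_sums d m"
    and m1: "- 1 \<in> power_sums d (m - 1)"
  shows "waring d m"
  unfolding waring_def
proof
  fix a assume a: "a \<in> K"
  show "\<exists>xs. set xs \<subseteq> K \<and> length xs = m \<and> (\<exists>x\<in>set xs. x \<noteq> 0) \<and> a = (\<Sum>x\<leftarrow>xs. x ^ d)"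
  proof (cases "a = 0")
    case True
    obtain xs where xs: "set xs \<subseteq> K" "length xs = m - 1" "- 1 = (\<Sum>x\<leftarrow>xs. x ^ d)"
      using m1 unfolding power_sums_def by blast
    have "a = (\<Sum>x\<leftarrow>1 # xs. x ^ d)" using True by (simp flip: xs(3))
    thus ?thesis using xs assms(2) one_K by (intro exI[of _ "1 # xs"]) auto
  next
    case False
    then obtain xs where xs: "set xs \<subseteq> K" "length xs = m" "a = (\<Sum>x\<leftarrow>xs. x ^ d)"
      using nz a by (auto simp: power_sums_def)
    moreover have "\<exists>x\<in>set xs. x \<noteq> 0"
    proof (rule ccontr)
      assume "\<not> ?thesis"
      hence "map (\<lambda>x. x ^ d) xs = map (\<lambda>x. 0) xs" using assms(1) by (intro map_cong) auto
      with xs(3) False show False by simp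
    qed
    ultimately show ?thesis by blast
  qed
qed

lemma waring_mono:
  assumes "waring d m" "m \<le> n" "0 < d"
  shows "waring d n"
  unfolding waring_def
proof
  fix a assume "a \<in> K"
  then obtain xs where "set xs \<subseteq> K" "length xs = m" "\<exists>x\<in>set xs. x \<noteq> 0" "a = (\<Sum>x\<leftarrow>xs. x ^ d)"
    using assms(1) unfolding waring_def by blast
  thus "\<exists>xs. set xs \<subseteq> K \<and> length xs = n \<and> (\<exists>x\<in>set xs. x \<noteq> 0) \<and> a = (\<Sum>x\<leftarrow>xs. x ^ d)"
    using assms(2,3) by (intro exI[of _ "xs @ replicate (n - m) 0"])
      (auto simp: zero_K sum_list_replicate zero_power)
qed

text \<open>By Bezout k u = (q - 1) v + d with d the gcd, so x^d is the k-th power of x^u for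
  nonzero x. Nonzero terms stay nonzero.\<close>

lemma waring_gcd:
  assumes "waring (gcd k (q - 1)) m" "0 < k"
  shows "waring k m"
proof -
  define d where "d = gcd k (q - 1)"
  have "\<exists>h. h \<in> K \<and> (x \<noteq> 0 \<longrightarrow> h \<noteq> 0) \<and> x ^ d = h ^ k" if x: "x \<in> K" for x
  proof (cases "x = 0")
    case True
    thus ?thesis using assms(2) zero_K by (intro exI[of _ 0]) (auto simp: d_def zero_power)
  next
    case False
    obtain u v where uv: "k * u = (q - 1) * v + d"
      using bezout_nat[of k "q - 1"] assms(2) by (auto simp: d_def)
    have "(x ^ u) ^ k = x ^ (k * u)" by (simp add: mult.commute flip: power_mult)
    also have "\<dots> = x ^ d" using power_q_minus_1[of x] x False by (simp add: uv power_add power_mult)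
    finally show ?thesis using x False by (intro exI[of _ "x ^ u"]) (auto simp: power_K)
  qed
  then obtain h where h: "\<And>x. x \<in> K \<Longrightarrow> h x \<in> K" "\<And>x. x \<in> K \<Longrightarrow> x \<noteq> 0 \<Longrightarrow> h x \<noteq> 0"
    "\<And>x. x \<in> K \<Longrightarrow> x ^ d = h x ^ k" by metis
  show ?thesis unfolding waring_def
  proof
    fix a assume "a \<in> K"
    then obtain xs where xs: "set xs \<subseteq> K" "length xs = m" "\<exists>x\<in>set xs. x \<noteq> 0" "a = (\<Sum>x\<leftarrow>xs. x ^ d)"
      using assms(1) unfolding waring_def d_def by blast
    moreover from xs(1) have "(\<Sum>x\<leftarrow>xs. x ^ d) = (\<Sum>x\<leftarrow>map h xs. x ^ k)"
      by (induction xs) (auto simp: h(3))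
    ultimately show "\<exists>xs. set xs \<subseteq> K \<and> length xs = m \<and> (\<exists>x\<in>set xs. x \<noteq> 0) \<and> a = (\<Sum>x\<leftarrow>xs. x ^ k)"
      using h(1,2) by (intro exI[of _ "map h xs"]) auto
  qed
qed

text \<open>For odd \<open>d\<close> the element -1 is its own \<open>d\<close>-th power; otherwise
  (-1)^((q-1)/d) = 1, which characterizes membership.\<close>

lemma minus_one_in_H:
  assumes d: "d dvd q - 1" "0 < d" and "odd d \<or> even ((q - 1) div d)"
  shows "- 1 \<in> H d"
proof (cases "odd d")
  case True
  thus ?thesis unfolding H_def by (intro image_eqI[of _ _ "- 1"]) (auto simp: uminus_K one_K)
next
  case False
  thus ?thesis using assms unfolding H_eq[OF d] by (simp add: uminus_K one_K)
qed

lemma H_power_sums: "a \<in> H d \<Longrightarrow> 1 \<le> m \<Longrightarrow> 0 < d \<Longrightarrow> a \<in> power_sums d m"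
proof (rule power_sums_mono)
  assume "a \<in> H d"
  then obtain x where "x \<in> K" "a = x ^ d" by (auto simp: H_def)
  thus "a \<in> power_sums d 1" unfolding power_sums_def by (intro CollectI exI[of _ "[x]"]) auto
qed

lemma waring_1: "2 \<le> m \<Longrightarrow> waring 1 m"
proof (rule waring_mono)
  show "waring 1 2"
  proof (rule waringI)
    show "a \<in> power_sums 1 2" if "a \<in> Ks" for a
      by (rule power_sums_mono[of _ _ 1]) (use that H_power_sums[of a 1 1] in \<open>auto simp: H_def\<close>)
    show "- 1 \<in> power_sums 1 (2 - 1)"
      by (rule H_power_sums) (auto simp: H_def uminus_K one_K)
  qed auto
qed auto

end

text \<open>A form that can be computed: each divisor of \<open>d\<close> from 2 to \<open>d\<close>
  is listed correctly, or else has a proper divisor and is not prime.\<close>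

lemma is_specI:
  assumes "\<forall>r\<in>set [2..<Suc d]. r dvd d \<longrightarrow> (r, int (d div r)) \<in> set spec \<or> (\<exists>s\<in>set [2..<r]. s dvd r)"
    and "0 < d"
  shows "is_spec d spec"
  unfolding is_spec_def
proof (intro allI impI)
  fix r assume r: "prime r" "r dvd d"
  have "r \<le> d" using r assms(2) by (auto intro: dvd_imp_le)
  moreover have "2 \<le> r" using r(1) by (rule prime_ge_2_nat)
  moreover have "\<not> (\<exists>s\<in>set [2..<r]. s dvd r)"
    using r(1) by (auto simp: prime_nat_iff)
  ultimately show "(r, int (d div r)) \<in> set spec" using assms(1) r(2) by auto
qed

section \<open>Tables of exceptional fields and their completeness\<close>

type_synonym required_table = "(int \<times> nat) list"
type_synonym prime_table = "(int \<times> int \<times> int list) list"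
type_synonym minus_one_table = "(int \<times> int list) list"
type_synonym extension_table =
  "(int \<times> int \<times> int list \<times> int list \<times> int list list list) list"
type_synonym extension_minus_one_table = "(int \<times> int \<times> int list \<times> int list list) list"

text \<open>The number of summands granted to a field with \<open>n\<close> elements: the generic
  value \<open>b\<close> unless \<open>n\<close> is listed.\<close>

fun required :: "required_table \<Rightarrow> nat \<Rightarrow> int \<Rightarrow> nat" where
  "required [] b n = b"
| "required ((n', m) # X) b n = (if n' = n then m else required X b n)"

lemma required_ge: "(\<And>m. m \<in> snd ` set X \<Longrightarrow> b \<le> m) \<Longrightarrow> b \<le> required X b n"
  by (induction X b n rule: required.induct) auto

fun check_primes ::
  "nat \<Rightarrow> (nat \<times> int) list \<Rightarrow> required_table \<Rightarrow> nat \<Rightarrow> prime_table \<Rightarrow> bool" where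
  "check_primes d spec X b [] = True"
| "check_primes d spec X b (e # es) =
     (check_prime d spec (required X b (fst e)) e \<and> check_primes d spec X b es)"

fun check_extensions ::
  "nat \<Rightarrow> (nat \<times> int) list \<Rightarrow> required_table \<Rightarrow> nat \<Rightarrow> extension_table \<Rightarrow> bool" where
  "check_extensions d spec X b [] = True"
| "check_extensions d spec X b (e # es) =
     (check_extension d spec (required X b (fst e)) e \<and> check_extensions d spec X b es)"

fun check_minus_ones ::
  "nat \<Rightarrow> required_table \<Rightarrow> nat \<Rightarrow> minus_one_table \<Rightarrow> bool" where
  "check_minus_ones d X b [] = True"
| "check_minus_ones d X b (e # es) =
     (length (snd e) < required X b (fst e) \<and> check_minus_one d e \<and> check_minus_ones d X b es)"

fun check_extension_minus_ones ::
  "nat \<Rightarrow> required_table \<Rightarrow> nat \<Rightarrow> extension_minus_one_table \<Rightarrow> bool" where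
  "check_extension_minus_ones d X b [] = True"
| "check_extension_minus_ones d X b (e # es) =
     (length (snd (snd (snd e))) < required X b (fst e) \<and> check_extension_minus_one d e \<and>
      check_extension_minus_ones d X b es)"

lemma check_primes_mem: "check_primes d spec X b T \<Longrightarrow> e \<in> set T \<Longrightarrow> check_prime d spec (required X b (fst e)) e"
  by (induction T) auto

lemma check_extensions_mem:
  "check_extensions d spec X b T \<Longrightarrow> e \<in> set T \<Longrightarrow> check_extension d spec (required X b (fst e)) e"
  by (induction T) (auto simp del: check_extension.simps)

lemma check_minus_ones_mem:
  "check_minus_ones d X b T \<Longrightarrow> e \<in> set T \<Longrightarrow> length (snd e) < required X b (fst e) \<and> check_minus_one d e"
  by (induction T) auto

lemma check_extension_minus_ones_mem:
  "check_extension_minus_ones d X b T \<Longrightarrow> e \<in> set T \<Longrightarrow>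
     length (snd (snd (snd e))) < required X b (fst e) \<and> check_extension_minus_one d e"
  by (induction T) (auto simp del: check_extension_minus_one.simps)

text \<open>A prime power \<open>n < 2\<^sup>1\<^sup>4\<close> divides the 14th power of each of its divisors \<open>r > 1\<close>.\<close>

fun no_prime_power :: "int \<Rightarrow> int list \<Rightarrow> bool" where
  "no_prime_power n [] = False"
| "no_prime_power n (r # rs) =
     (if n mod r = 0 then 1 < r \<and> r ^ 14 mod n \<noteq> 0 else no_prime_power n rs)"

lemma no_prime_power_sound:
  assumes "no_prime_power n rs" "n < 2 ^ 14" "prime p"
  shows "n \<noteq> int (p ^ e)"
proof
  assume n: "n = int (p ^ e)"
  obtain r where r: "n mod r = 0" "1 < r" "r ^ 14 mod n \<noteq> 0"
    using assms(1) by (induction n rs rule: no_prime_power.induct) (auto split: if_splits)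
  have "2 ^ e \<le> p ^ e" using prime_ge_2_nat[OF assms(3)] by (intro power_mono) auto
  moreover have "p ^ e < 2 ^ 14" using assms(2) unfolding n by (simp flip: of_nat_less_iff[where 'a = int])
  ultimately have "(2 :: nat) ^ e < 2 ^ 14" by linarith
  hence e: "e < 14" by (simp only: power_strict_increasing_iff)
  have "nat r dvd p ^ e" using r(1,2) by (simp add: n nat_dvd_iff mod_eq_0_iff_dvd)
  then obtain i where i: "nat r = p ^ i" using divides_primepow_nat[OF assms(3)] by blast
  have "0 < i" using i r(2) by (intro gr0I) auto
  have "r = int (p ^ i)" using i r(2) by linarith
  moreover have "p ^ e dvd (p ^ i) ^ 14"
    unfolding power_mult[symmetric] using e \<open>0 < i\<close> by (intro le_imp_power_dvd) auto
  ultimately have "n dvd r ^ 14" unfolding n by (simp only: flip: of_nat_power) (simp only: int_dvd_int_iff)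
  thus False using r(3) by (simp add: mod_eq_0_iff_dvd)
qed

text \<open>All numbers examined are below 97^2, so a composite one has a prime factor in this
  list.\<close>

definition small_primes :: "int list" where
  "small_primes = [2, 3, 5, 7, 11, 13, 17, 19, 23, 29, 31, 37, 41, 43, 47, 53, 59, 61, 67, 71, 73, 79, 83, 89]"

text \<open>\<open>ks\<close> is sorted, so it is consumed while walking through \<open>n, n + c, n + 2c, \<dots>\<close>\<close>

fun covers :: "int list \<Rightarrow> int \<Rightarrow> int \<Rightarrow> nat \<Rightarrow> int list \<Rightarrow> bool" where
  "covers E c n 0 ks = True"
| "covers E c n (Suc N) [] = ((n \<in> set E \<or> no_prime_power n small_primes) \<and> covers E c (n + c) N [])"
| "covers E c n (Suc N) (k # ks) =
     (if n = k then covers E c (n + c) N ks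
      else (n \<in> set E \<or> no_prime_power n small_primes) \<and> covers E c (n + c) N (k # ks))"

lemma covers_sound:
  assumes "covers E c n N ks" "i < N"
  shows "n + c * int i \<in> set ks \<union> set E \<or> no_prime_power (n + c * int i) small_primes"
  using assms
proof (induction E c n N ks arbitrary: i rule: covers.induct)
  case (2 E c n N i)
  thus ?case using 2(1)[of "i - 1"] by (cases i) (auto simp: algebra_simps)
next
  case (3 E c n N k ks i)
  show ?case
  proof (cases i)
    case 0
    thus ?thesis using 3 by (auto split: if_splits)
  next
    case (Suc j)
    thus ?thesis using 3(1,2)[of j] 3(3,4) by (auto simp: algebra_simps split: if_splits)
  qed
qed simp

section \<open>Combining the tables with the bounds for large fields\<close>

context finite_subfield
begin

text \<open>As q is a prime power, it cannot be among the numbers certified not to be one, and so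
  must be tabulated or exempted.\<close>

lemma covers_q:
  assumes "covers E c n N ks" "int q = n + c * int i" "i < N" "n + c * int N < 2 ^ 14" "0 < c"
  shows "int q \<in> set ks \<union> set E"
proof -
  obtain p e where pe: "prime p" "q = p ^ e" using q_prime_power by blast
  have "c * int i \<le> c * int N" using assms(3,5) by simp
  hence "int q < 2 ^ 14" using assms(2,4) by linarith
  hence "\<not> no_prime_power (int q) small_primes" using no_prime_power_sound[OF _ _ pe(1), of "int q" small_primes e]
    by (auto simp: pe(2))
  thus ?thesis using covers_sound[OF assms(1,3)] assms(2) by metis
qed

lemma tables_nonzero:
  assumes d: "d dvd q - 1" "0 < d" and spec: "is_spec d spec"
    and T: "check_primes d spec X b T" "check_extensions d spec X b T'"
    and cov: "covers (bad @ map fst T') (int d) (int d + 1) N (map fst T)"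
    and N: "q \<le> d * N + 1" "(N + 1) * d < 2 ^ 14 - 1" and bad: "int q \<notin> set bad" and a: "a \<in> Ks"
  shows "a \<in> power_sums d (required X b (int q))"
proof -
  \<comment> \<open>The tables start at d + 1, so q = 1 + d i stands at position i - 1.\<close>
  obtain i where i: "q - 1 = d * i" using d(1) by blast
  have i0: "0 < i" using i q_ge_2 by (intro gr0I) auto
  have "d * i \<le> d * N" using i N q_ge_2 by linarith
  hence iN: "i - 1 < N" using d i0 by auto
  have "int q = 1 + int d * int i" using i q_ge_2 by (simp flip: of_nat_mult)
  hence q: "int q = int d + 1 + int d * int (i - 1)" using i0 by (simp add: of_nat_diff algebra_simps)
  have "int ((N + 1) * d) < int (2 ^ 14 - 1)" using N(2) by (simp only: of_nat_less_iff)
  hence bound: "int d + 1 + int d * int N < 2 ^ 14" by (simp add: algebra_simps)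
  have "int q \<in> fst ` set T \<union> fst ` set T'"
    using covers_q[OF cov q iN bound] d(2) bad by auto
  thus ?thesis
  proof
    assume "int q \<in> fst ` set T"
    then obtain e where e: "e \<in> set T" "fst e = int q" by force
    from check_primes_mem[OF T(1) e(1)] show ?thesis
      unfolding e(2) by (rule check_prime_sound[OF d spec _ e(2) a])
  next
    assume "int q \<in> fst ` set T'"
    then obtain e where e: "e \<in> set T'" "fst e = int q" by force
    from check_extensions_mem[OF T(2) e(1)] show ?thesis
      unfolding e(2) by (rule check_extension_sound[OF d spec _ e(2) a])
  qed
qed

text \<open>The sizes lie in the progression 1 + d i, so the next one after d N + 1 is d (N + 1) +
  1. Using this keeps the tables short.\<close>

lemma progression_gap:
  assumes "d dvd q - 1" "\<not> q \<le> d * N + 1"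
  shows "d * (N + 1) < q"
proof -
  obtain i where i: "q - 1 = d * i" using assms(1) by blast
  hence "d * N < d * i" using assms(2) by linarith
  hence "N + 1 \<le> i" by simp
  hence "d * (N + 1) \<le> d * i" by (rule mult_le_mono2)
  thus ?thesis using i q_ge_2 by linarith
qed

text \<open>As -1 is a d-th power, zero is a sum of two powers and the smaller threshold of
  \<open>two_powers\<close> applies. \<open>bad\<close> holds sizes that no table treats.\<close>

theorem waring_odd:
  assumes d: "d dvd q - 1" "odd d" "3 \<le> d" and spec: "is_spec d spec"
    and T: "check_primes d spec X 2 T" "check_extensions d spec X 2 T'"
    and cov: "covers (bad @ map fst T') (int d) (int d + 1) N (map fst T)"
    and N: "(d - 1) ^ 3 * (d - 2) + 2 * (d - 1) \<le> d * (N + 1) + 1" "(N + 1) * d < 2 ^ 14 - 1"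
    and bad: "int q \<notin> set bad" and X: "\<forall>m\<in>snd ` set X. 2 \<le> m"
  shows "waring d (required X 2 (int q))"
proof -
  have d0: "0 < d" using d by simp
  note ge = required_ge[of X 2 "int q", OF bspec[OF X]]
  have m1: "- 1 \<in> H d" using minus_one_in_H[OF d(1) d0] d(2) by simp
  show ?thesis
  proof (rule waringI[OF d0])
    show "- 1 \<in> power_sums d (required X 2 (int q) - 1)"
      using H_power_sums[OF m1 _ d0] ge by auto
    show "a \<in> power_sums d (required X 2 (int q))" if a: "a \<in> Ks" for a
    proof (cases "q \<le> d * N + 1")
      case True
      from tables_nonzero[OF d(1) d0 spec T cov True N(2) bad a] show ?thesis .
    next
      case False
      hence "d * (N + 1) < q" by (rule progression_gap[OF d(1)])
      then obtain x y where "x \<in> K" "y \<in> K" "a = x ^ d + y ^ d"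
        using two_powers[OF d(1) _ _ m1, of a] d(3) N(1) a by auto
      hence "a \<in> power_sums d 2" unfolding power_sums_def by (intro CollectI exI[of _ "[x, y]"]) auto
      thus ?thesis using power_sums_mono ge d0 by blast
    qed
  qed (use ge in simp)
qed

text \<open>The two ranges differ: three powers reach the nonzero elements beyond (d - 1)^3, while
  two powers reach -1 only beyond (d - 1)^4. The second range matters only for odd (q - 1) / d, when
  q = d + 1 + 2 d i; hence the step 2 d.\<close>

theorem waring_even:
  assumes d: "d dvd q - 1" "even d" "4 \<le> d" and spec: "is_spec d spec"
    and T: "check_primes d spec X 3 T" "check_extensions d spec X 3 T'"
    and cov: "covers (bad @ map fst T') (int d) (int d + 1) N (map fst T)"
    and N: "(d - 1) ^ 3 \<le> d * (N + 1)" "(N + 1) * d < 2 ^ 14 - 1"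
    and U: "check_minus_ones d X 3 U" "check_extension_minus_ones d X 3 U'"
    and cov': "covers (bad @ map fst U') (2 * int d) (int d + 1) N' (map fst U)"
    and N': "(d - 1) ^ 4 \<le> d * (2 * N' + 1)" "(2 * N' + 1) * d < 2 ^ 14 - 1"
    and bad: "int q \<notin> set bad" and X: "\<forall>m\<in>snd ` set X. 3 \<le> m"
  shows "waring d (required X 3 (int q))"
proof -
  have d0: "0 < d" "2 \<le> d" using d by auto
  note ge = required_ge[of X 3 "int q", OF bspec[OF X]]
  show ?thesis
  proof (rule waringI[OF d0(1)])
    show "- 1 \<in> power_sums d (required X 3 (int q) - 1)"
    proof (cases "even ((q - 1) div d)")
      case True
      from H_power_sums[OF minus_one_in_H[OF d(1) d0(1)] _ d0(1)] True ge show ?thesis by auto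
    next
      case odd: False
      obtain i where "(q - 1) div d = 2 * i + 1" using odd by (elim oddE)
      hence "q - 1 = d * (2 * i + 1)" using d(1) by (metis dvd_mult_div_cancel)
      hence qi: "q = 1 + d * (2 * i + 1)" using q_ge_2 by linarith
      show ?thesis
      proof (cases "i < N'")
        case iN: True
        have q: "int q = int d + 1 + 2 * int d * int i" unfolding qi by (simp add: algebra_simps)
        have "int ((2 * N' + 1) * d) < int (2 ^ 14 - 1)" using N'(2) by (simp only: of_nat_less_iff)
        hence bound: "int d + 1 + 2 * int d * int N' < 2 ^ 14" by (simp add: algebra_simps)
        have "int q \<in> fst ` set U \<union> fst ` set U'"
          using covers_q[OF cov' q iN bound] d0 bad by auto
        then obtain m where "- 1 \<in> power_sums d m" "m < required X 3 (int q)"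
        proof
          assume "int q \<in> fst ` set U"
          then obtain e where e: "e \<in> set U" "fst e = int q" by force
          obtain xs where e': "e = (int q, xs)" using e(2) by (cases e) auto
          from check_minus_ones_mem[OF U(1) e(1)] have "check_minus_one d (int q, xs)"
            and "length xs < required X 3 (int q)" by (auto simp only: e' fst_conv snd_conv)
          with check_minus_one_sound that show thesis by blast
        next
          assume "int q \<in> fst ` set U'"
          then obtain e where e: "e \<in> set U'" "fst e = int q" by force
          obtain p f xs where e': "e = (int q, p, f, xs)" using e(2) by (cases e) auto
          from check_extension_minus_ones_mem[OF U(2) e(1)]
          have "check_extension_minus_one d (int q, p, f, xs)"
            and "length xs < required X 3 (int q)" by (auto simp only: e' fst_conv snd_conv)
          with check_extension_minus_one_sound that show thesis by blast
        qed
        thus ?thesis using power_sums_mono[of _ d m] d0 by simp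
      next
        case False
        hence "d * (2 * N' + 1) \<le> d * (2 * i + 1)" by simp
        hence "(d - 1) ^ 4 < q" using N'(1) qi by linarith
        then obtain x y where "x \<in> K" "y \<in> K" "- 1 = x ^ d + y ^ d"
          using nonzero_two_powers[OF d(1) d0(2), of "- 1"] uminus_K[OF one_K] by auto
        hence "- 1 \<in> power_sums d 2" unfolding power_sums_def by (intro CollectI exI[of _ "[x, y]"]) auto
        thus ?thesis using power_sums_mono[of _ d 2 "required X 3 (int q) - 1"] ge d0 by simp
      qed
    qed
    show "a \<in> power_sums d (required X 3 (int q))" if a: "a \<in> Ks" for a
    proof (cases "q \<le> d * N + 1")
      case True
      from tables_nonzero[OF d(1) d0(1) spec T cov True N(2) bad a] show ?thesis .
    next
      case False
      hence "d * (N + 1) < q" by (rule progression_gap[OF d(1)])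
      hence "(d - 1) ^ 3 < q" using N(1) by linarith
      then obtain x y z where "x \<in> K" "y \<in> K" "z \<in> K" "a = x ^ d + y ^ d + z ^ d"
        using nonzero_three_powers[OF d(1) d0(2) _ a] by auto
      hence "a \<in> power_sums d 3" unfolding power_sums_def by (intro CollectI exI[of _ "[x, y, z]"]) auto
      thus ?thesis using power_sums_mono ge d0 by blast
    qed
  qed (use ge in simp)
qed

text \<open>Squares: the sets of all \<open>x\<^sup>2\<close> and of all \<open>a - y\<^sup>2\<close> have more than \<open>q / 2\<close> elements each.\<close>

lemma two_squares:
  assumes "2 dvd q - 1" "a \<in> K"
  shows "\<exists>x\<in>K. \<exists>y\<in>K. a = x ^ 2 + y ^ 2"
proof -
  define S where "S = insert 0 (H 2)"
  have "0 \<notin> H 2" using H_subset by blast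
  hence cS: "2 * card S = q + 1"
    using card_H[OF assms(1)] finite_H q_ge_2 by (simp add: S_def)
  have SK: "S \<subseteq> K" using H_subset zero_K by (auto simp: S_def)
  have "inj_on (\<lambda>s. a - s) S" by (auto simp: inj_on_def)
  hence c: "card ((\<lambda>s. a - s) ` S) = card S" by (rule card_image)
  have "S \<inter> (\<lambda>s. a - s) ` S \<noteq> {}"
  proof
    assume e: "S \<inter> (\<lambda>s. a - s) ` S = {}"
    have "card (S \<union> (\<lambda>s. a - s) ` S) = card S + card S"
      using e c finite_subset[OF SK finite_K] by (subst card_Un_disjoint) auto
    moreover have "card (S \<union> (\<lambda>s. a - s) ` S) \<le> q"
      unfolding q_def using SK assms(2) by (intro card_mono finite_K) (auto simp: diff_K subset_iff)
    ultimately show False using cS by linarith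
  qed
  then obtain s t where "s \<in> S" "t \<in> S" "s = a - t" by blast
  hence st: "s \<in> S" "t \<in> S" "a = s + t" by auto
  have "\<exists>x\<in>K. s = x ^ 2" if "s \<in> S" for s
    using that zero_K by (cases "s = 0") (auto simp: S_def H_def intro: bexI[of _ 0])
  from this[OF st(1)] this[OF st(2)] st(3) show ?thesis by blast
qed

lemma waring_2:
  assumes "2 dvd q - 1" "3 \<le> m"
  shows "waring 2 m"
proof -
  have *: "a \<in> power_sums 2 2" if "a \<in> K" for a
  proof -
    obtain x y where "x \<in> K" "y \<in> K" "a = x ^ 2 + y ^ 2" using two_squares[OF assms(1) \<open>a \<in> K\<close>] by blast
    thus ?thesis unfolding power_sums_def by (intro CollectI exI[of _ "[x, y]"]) auto
  qed
  show ?thesis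
  proof (rule waringI)
    show "a \<in> power_sums 2 m" if "a \<in> Ks" for a
      by (rule power_sums_mono[OF *]) (use that assms in auto)
    show "- 1 \<in> power_sums 2 (m - 1)"
      by (rule power_sums_mono[OF *]) (use assms uminus_K one_K in auto)
  qed (use assms in auto)
qed

end

section \<open>Certificates for small fields\<close>

text \<open>In an entry \<open>(p, g, xs)\<close> the \<open>d\<close>-th powers of the \<open>j\<close>-th block of \<open>xs\<close> add up to \<open>g\<^sup>j\<close> modulo
  \<open>p\<close>. The blocks have length 2 for odd \<open>d\<close> and length 3 for even \<open>d\<close>, except for the \<open>q\<close> listed in
  \<open>required_d\<close>. The tables contain all prime powers \<open>q\<close>
  with \<open>d\<close> dividing \<open>q - 1\<close> below the bounds of \<open>two_powers\<close>,
  \<open>nonzero_three_powers\<close> and (for the representations of \<open>-1\<close>) \<open>nonzero_two_powers\<close>, except those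
  excluded in every triple.\<close>

definition required_3 :: "required_table" where
  "required_3 = [
  (7,3)]"

definition primes_3 :: "prime_table" where
  "primes_3 = [
  (7,2,[0,0,1,0,1,1,3,3,3])]"

lemma check_primes_3:
  "check_primes 3 [(3, 1)] required_3 2 primes_3"
  by code_simp

text \<open>The exclusion of 4 is forced: the cubes of F_4 lie in F_2, and so do their sums.
  Likewise the sizes prefixed to the tables for the other exponents are those where the powers lie
  in a proper subfield, except for 23 with exponent 11.\<close>

lemma covers_3:
  "covers ([4] @ map fst ([] :: extension_table))
    (int 3) (int 3 + 1) 3 (map fst primes_3)"
  by code_simp

lemma spec_3: "is_spec 3 [(3, 1)]"
  by (rule is_specI) code_simp+

lemma (in finite_subfield) waring_3:
  assumes "3 dvd q - 1" "int q \<notin> set [4]"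
  shows "waring 3 (required required_3 2 (int q))"
  using assms by (intro waring_odd[OF _ _ _ spec_3 check_primes_3 check_extensions.simps(1)[THEN iffD2, OF TrueI] covers_3])
  (simp_all add: required_3_def)

text \<open>29 is here on account of zero: it exceeds 3^3, so three fourth powers reach every
  nonzero element, but -1 is not a sum of two fourth powers modulo 29. Similarly 139 and 223 for
  exponent 6, 761 for 8 and 911 for 10 lie beyond (d - 1)^3, and their certificates write -1 with
  three powers.\<close>

definition required_4 :: "required_table" where
  "required_4 = [
  (5,5),(13,4),(17,4),(25,4),(29,4)]"

definition primes_4 :: "prime_table" where
  "primes_4 = [
  (5,2,[0,0,0,0,1,0,0,0,1,1,0,1,1,1,1,0,0,1,1,1]),(13,2,[0,0,0,1,0,0,1,1,0,0,1,2,0,2,4,4]),(17,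
  3,[0,0,0,1,0,0,2,6,0,0,3,3,0,1,3,3])]"

definition extensions_4 :: "extension_table" where
  "extensions_4 = [
  (25,5,[2,0],[0,1],[[[],[],[],[1]],[[],[],[2,1],[4,1]],[[],[],[1],[1]],[[],[1],[1],[3,1]]])]"

definition minus_ones_4 :: "minus_one_table" where
  "minus_ones_4 = [
  (5,[1,1,1,1]),(13,[2,4]),(29,[1,6,8]),(37,[8,10]),(53,[2,10]),(61,[13,14])]"

lemma check_primes_4:
  "check_primes 4 [(2, 2)] required_4 3 primes_4"
  by code_simp

lemma check_extensions_4:
  "check_extensions 4 [(2, 2)] required_4 3 extensions_4"
  by code_simp

lemma covers_4:
  "covers ([9] @ map fst extensions_4)
    (int 4) (int 4 + 1) 6 (map fst primes_4)"
  by code_simp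

lemma check_minus_ones_4: "check_minus_ones 4 required_4 3 minus_ones_4"
  by code_simp

lemma covers_minus_ones_4:
  "covers ([9] @ map fst ([] :: extension_minus_one_table)) (2 * int 4) (int 4 + 1) 10 (map fst minus_ones_4)"
  by code_simp

lemma spec_4: "is_spec 4 [(2, 2)]"
  by (rule is_specI) code_simp+

lemma (in finite_subfield) waring_4:
  assumes "4 dvd q - 1" "int q \<notin> set [9]"
  shows "waring 4 (required required_4 3 (int q))"
  using assms by (intro waring_even[OF _ _ _ spec_4 check_primes_4 check_extensions_4 covers_4 _ _
      check_minus_ones_4 check_extension_minus_ones.simps(1)[THEN iffD2, OF TrueI] covers_minus_ones_4])
  (simp_all add: required_4_def)

definition required_5 :: "required_table" where
  "required_5 = [
  (11,5),(31,3),(41,3),(61,3)]"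

definition primes_5 :: "prime_table" where
  "primes_5 = [
  (11,2,[0,0,0,0,1,0,0,0,1,1,0,1,1,1,1,0,0,2,2,2,1,1,1,1,1]),(31,2,[0,0,1,0,1,1,0,7,15,1,1,11,3,
  3,3]),(41,2,[0,0,1,0,1,1,0,1,11,0,4,5,1,1,15]),(61,2,[0,0,1,0,1,1,1,2,2,0,4,10,0,4,6]),(71,2,
  [0,1,1,1,3,18,13,18,9,21]),(101,2,[0,1,1,1,4,39,4,5,6,13]),(131,2,[0,1,1,1,23,27,2,4,12,27]),
  (151,3,[0,1,1,22,1,9,7,27,11,15]),(181,2,[0,1,1,1,9,11,1,8,5,63]),(191,2,[0,1,1,1,7,18,11,31,
  3,38])]"

definition extensions_5 :: "extension_table" where
  "extensions_5 = [
  (81,3,[1,1,0,0],[0,1],[[[],[1]],[[2,2],[1,1,2]],[[1,1],[2,0,0,1]],[[0,1],[1,1]],[[0,0,1],[1,1,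
  2]]]),(121,11,[2,0],[2],[[[],[1]],[[1],[1]],[[5,1],[4,2]],[[0,1],[1,1]],[[1,1],[9,2]]])]"

lemma check_primes_5:
  "check_primes 5 [(5, 1)] required_5 2 primes_5"
  by code_simp

lemma check_extensions_5:
  "check_extensions 5 [(5, 1)] required_5 2 extensions_5"
  by code_simp

lemma covers_5:
  "covers ([16] @ map fst extensions_5)
    (int 5) (int 5 + 1) 39 (map fst primes_5)"
  by code_simp

lemma spec_5: "is_spec 5 [(5, 1)]"
  by (rule is_specI) code_simp+

lemma (in finite_subfield) waring_5:
  assumes "5 dvd q - 1" "int q \<notin> set [16]"
  shows "waring 5 (required required_5 2 (int q))"
  using assms by (intro waring_odd[OF _ _ _ spec_5 check_primes_5 check_extensions_5 covers_5])
  (simp_all add: required_5_def)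

text \<open>Modulo 7 the sixth powers are 0 and 1, so a representation of zero with a nonzero term
  takes seven summands. In the same way 5 requires five fourth powers and 11 requires eleven tenth
  powers.\<close>

definition required_6 :: "required_table" where
  "required_6 = [
  (7,7),(13,7),(19,5),(31,5),(37,4),(43,4),(49,4),(61,4),(67,4),(73,4),(79,4),(109,4),(139,4),
  (223,4)]"

definition primes_6 :: "prime_table" where
  "primes_6 = [
  (7,3,[0,0,0,0,0,0,1,0,0,0,0,1,1,1,0,0,0,0,0,1,1,0,1,1,1,1,1,1,0,0,0,1,1,1,1,0,0,1,1,1,1,1]),
  (13,2,[0,0,0,0,0,0,1,0,0,0,0,0,1,1,0,0,0,1,1,1,1,0,0,2,2,2,2,2,0,0,0,0,1,1,1,0,1,1,1,1,1,1]),
  (19,2,[0,0,0,0,1,0,0,0,1,1,0,0,1,4,4,0,0,0,1,2,0,1,1,2,2,0,0,1,1,4]),(31,3,[0,0,0,0,1,0,0,0,1,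
  2,0,0,0,1,8,0,1,2,3,8,0,0,1,2,3,0,0,2,3,8]),(37,2,[0,0,0,1,0,0,1,1,0,3,3,3,0,6,6,9,0,0,2,3,0,
  5,5,9]),(43,3,[0,0,0,1,0,0,4,10,0,0,3,4,0,0,4,5,0,1,2,5,0,1,4,5]),(61,2,[0,0,0,1,0,0,1,1,0,0,
  1,2,0,0,4,11,0,3,11,16,0,0,6,7]),(67,2,[0,0,0,1,0,0,1,1,0,0,4,12,0,1,3,17,0,0,1,17,0,0,3,8]),
  (73,5,[0,0,0,1,0,0,4,11,0,0,1,14,0,0,5,13,0,0,12,13,0,1,6,13]),(79,3,[0,0,0,1,0,0,2,3,0,0,1,9,
  0,1,3,9,0,0,1,1,0,0,2,12]),(97,5,[0,0,1,0,9,10,0,9,18,0,1,10,0,26,26,0,4,6]),(103,5,[0,0,1,0,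
  3,6,0,2,2,0,2,15,0,10,17,0,1,17]),(109,6,[0,0,0,1,0,1,1,6,0,0,4,18,0,0,2,30,0,0,4,10,0,0,2,
  18])]"

definition extensions_6 :: "extension_table" where
  "extensions_6 = [
  (49,7,[3,0],[1,1],[[[],[],[],[1]],[[],[],[0,1],[4,1]],[[],[],[4,1],[4,1]],[[],[],[1],[3,1]],
  [[],[],[1,1],[4,1]],[[],[1],[2,1],[6,1]]]),(121,11,[2,0],[1,1],[[[],[],[1]],[[],[1],[9,1]],
  [[],[3],[4,2]],[[],[6,2],[1,3]],[[],[4,1],[9,1]],[[],[0,1],[10,1]]])]"

definition minus_ones_6 :: "minus_one_table" where
  "minus_ones_6 = [
  (7,[1,1,1,1,1,1]),(19,[2,4]),(31,[2,3,4,8]),(43,[1,3]),(67,[1,1,2]),(79,[1,4,15]),(103,[4,7]),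
  (127,[3,4]),(139,[1,5,17]),(151,[2,30]),(163,[3,21]),(199,[19,21]),(211,[3,49]),(223,[2,3,
  21]),(271,[13,23]),(283,[1,27]),(307,[1,61]),(331,[2,39]),(367,[10,54]),(379,[6,107]),(439,[7,
  109]),(463,[4,58]),(487,[9,60]),(499,[1,60]),(523,[2,5]),(547,[2,37]),(571,[16,81]),(607,[6,
  160]),(619,[9,35])]"

definition extension_minus_ones_6 :: "extension_minus_one_table" where
  "extension_minus_ones_6 = [
  (343,7,[2,0,0],[[0,1],[0,0,1]])]"

lemma check_primes_6:
  "check_primes 6 [(2, 3), (3, 2)] required_6 3 primes_6"
  by code_simp

lemma check_extensions_6:
  "check_extensions 6 [(2, 3), (3, 2)] required_6 3 extensions_6"
  by code_simp

lemma covers_6: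
  "covers ([25] @ map fst extensions_6)
    (int 6) (int 6 + 1) 20 (map fst primes_6)"
  by code_simp

lemma check_minus_ones_6: "check_minus_ones 6 required_6 3 minus_ones_6"
  by code_simp

lemma check_extension_minus_ones_6: "check_extension_minus_ones 6 required_6 3 extension_minus_ones_6"
  by code_simp

lemma covers_minus_ones_6:
  "covers ([25] @ map fst extension_minus_ones_6) (2 * int 6) (int 6 + 1) 52 (map fst minus_ones_6)"
  by code_simp

lemma spec_6: "is_spec 6 [(2, 3), (3, 2)]"
  by (rule is_specI) code_simp+

lemma (in finite_subfield) waring_6:
  assumes "6 dvd q - 1" "int q \<notin> set [25]"
  shows "waring 6 (required required_6 3 (int q))"
  using assms by (intro waring_even[OF _ _ _ spec_6 check_primes_6 check_extensions_6 covers_6 _ _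
      check_minus_ones_6 check_extension_minus_ones_6 covers_minus_ones_6])
  (simp_all add: required_6_def)

definition required_7 :: "required_table" where
  "required_7 = [
  (29,4),(43,4),(64,3),(71,3),(113,3),(127,3)]"

definition primes_7 :: "prime_table" where
  "primes_7 = [
  (29,2,[0,0,0,1,0,0,1,1,0,4,8,8,1,2,2,2,0,0,4,8,0,1,1,1,0,1,8,8]),(43,2,[0,0,0,1,0,0,1,1,0,2,2,
  6,0,0,1,7,1,1,7,7,0,1,3,3,0,7,7,7]),(71,2,[0,0,1,0,1,1,0,10,23,0,4,5,0,14,23,0,2,28,1,14,28]),
  (113,2,[0,0,1,0,1,1,0,12,18,0,12,39,0,1,2,1,12,20,0,4,10]),(127,2,[0,0,1,0,1,1,0,3,13,0,3,47,
  0,7,21,0,15,47,3,11,63]),(197,2,[0,1,1,1,8,34,2,13,15,27,4,6,7,23]),(211,2,[0,1,1,1,8,39,8,54,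
  1,15,5,71,16,41]),(239,2,[0,1,1,1,4,39,3,5,6,7,14,63,3,19]),(281,2,[0,1,1,1,10,85,1,5,11,45,3,
  12,37,63]),(337,2,[0,1,1,1,4,19,10,11,18,19,2,14,18,28]),(379,2,[0,1,1,1,15,38,4,17,7,145,6,
  87,3,92]),(421,2,[0,1,1,1,12,54,9,20,5,30,4,7,10,12]),(449,2,[0,1,1,1,8,65,16,106,16,33,4,12,
  3,11]),(463,2,[0,1,1,1,3,61,15,100,1,57,10,24,17,88]),(491,2,[0,1,1,1,13,220,7,11,10,15,15,22,
  1,198]),(547,2,[0,1,1,1,4,105,6,206,22,48,2,5,12,94]),(617,2,[0,1,1,1,7,299,10,64,1,30,1,94,
  14,19]),(631,3,[0,1,1,196,1,177,5,130,2,88,1,36,12,29]),(659,2,[0,1,1,1,8,88,5,80,1,52,1,160,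
  1,47]),(673,3,[0,1,1,128,1,18,6,60,11,45,26,66,5,23]),(701,2,[0,1,1,1,2,132,12,62,2,131,2,13,
  1,165]),(743,2,[0,1,1,1,7,78,3,57,5,63,13,140,6,92]),(757,2,[0,1,1,1,1,81,7,70,3,289,8,140,5,
  215]),(827,2,[0,1,1,1,10,28,2,8,26,55,3,39,8,22]),(883,2,[0,1,1,1,1,207,83,159,1,241,8,234,13,
  101]),(911,2,[0,1,1,1,3,133,9,201,4,8,1,39,3,41]),(953,3,[0,1,1,120,1,211,4,40,10,207,11,117,
  14,88]),(967,2,[0,1,1,1,2,252,5,89,1,59,2,98,8,205]),(1009,2,[0,1,1,1,4,440,12,72,6,133,18,
  103,12,153]),(1051,2,[0,1,1,1,8,200,2,86,3,113,10,48,3,236])]"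

definition extensions_7 :: "extension_table" where
  "extensions_7 = [
  (64,2,[1,1,0,0,0,0],[0,1],[[[],[],[1]],[[1],[1,1,1],[0,1,0,1]],[[1],[0,1,1],[1,1,1]],[[],[0,0,
  1],[0,1,0,1]],[[1],[0,1,1],[1,0,0,1]],[[],[1,1],[0,1,1]],[[],[1,1,1],[0,1,0,1]]]),(169,13,[2,
  0],[1,1],[[[],[1]],[[1],[2,1]],[[3],[6,1]],[[6],[4,3]],[[4],[0,5]],[[11],[6,3]],[[5],[4,3]]]),
  (512,2,[1,1,0,0,0,0,0,0,0],[1,1,1],[[[],[1]],[[1],[0,0,1,0,1,0,1]],[[1],[1,1,1,1,0,1,1]],[[1,
  0,1],[0,1,0,1,0,1,1]],[[1],[0,1,0,0,0,1]],[[0,1,0,0,1],[1,0,0,1,1]],[[1,0,0,0,1],[1,1,1,0,1,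
  1]]]),(729,3,[1,1,0,0,0,0],[0,1],[[[],[1]],[[1,1],[1,0,1]],[[0,2],[2,2,1,0,1]],[[2,1],[1,0,0,
  1]],[[1],[2,1,0,2,2]],[[0,2],[1,2,1]],[[2,1],[0,0,2]]]),(841,29,[2,0],[2],[[[],[1]],[[1],[1]],
  [[1,1],[4,2]],[[4,1],[7,1]],[[4],[8]],[[4,1],[22,1]],[[6,1],[5,4]]])]"

lemma check_primes_7:
  "check_primes 7 [(7, 1)] required_7 2 primes_7"
  by code_simp

lemma check_extensions_7:
  "check_extensions 7 [(7, 1)] required_7 2 extensions_7"
  by code_simp

lemma covers_7:
  "covers ([8] @ map fst extensions_7)
    (int 7) (int 7 + 1) 155 (map fst primes_7)"
  by code_simp

lemma spec_7: "is_spec 7 [(7, 1)]"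
  by (rule is_specI) code_simp+

lemma (in finite_subfield) waring_7:
  assumes "7 dvd q - 1" "int q \<notin> set [8]"
  shows "waring 7 (required required_7 2 (int q))"
  using assms by (intro waring_odd[OF _ _ _ spec_7 check_primes_7 check_extensions_7 covers_7])
  (simp_all add: required_7_def)

definition required_8 :: "required_table" where
  "required_8 = [
  (17,9),(25,5),(41,5),(73,4),(81,4),(89,4),(97,4),(113,4),(121,4),(137,4),(233,4),(257,4),(289,
  4),(337,4),(761,4)]"

definition primes_8 :: "prime_table" where
  "primes_8 = [
  (17,3,[0,0,0,0,0,0,0,0,1,0,0,0,0,0,0,1,1,1,0,3,3,3,3,3,3,3,3,0,0,3,3,3,3,3,3,3,0,0,0,0,0,3,3,
  3,3,0,0,0,0,1,1,1,1,1,0,0,0,0,0,0,0,3,3,0,0,0,3,3,3,3,3,3]),(41,3,[0,0,0,0,1,0,0,1,1,1,0,0,4,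
  8,8,0,0,1,2,8,0,1,1,1,7,0,0,0,1,7,0,0,0,8,8,0,0,0,4,7]),(73,5,[0,0,0,1,0,0,1,18,0,1,9,12,0,6,
  12,18,0,0,2,18,0,0,4,18,0,0,1,5,0,1,4,6]),(89,3,[0,0,0,1,0,0,1,9,0,0,1,6,0,4,10,20,0,1,2,9,0,
  0,1,3,0,0,1,25,0,5,6,20]),(97,5,[0,0,0,1,0,0,5,8,0,0,4,4,0,0,5,28,0,1,5,11,0,0,8,28,0,1,1,5,0,
  0,2,19]),(113,3,[0,0,0,1,0,0,3,4,0,0,7,14,0,0,11,35,0,0,4,10,0,0,1,14,0,1,1,9,0,3,5,9]),(137,
  3,[0,0,0,1,0,1,1,1,0,0,12,24,0,2,3,18,0,9,21,24,0,0,4,21,0,0,3,8,0,0,8,32]),(193,5,[0,0,1,0,5,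
  51,0,4,4,0,4,34,0,4,6,0,17,25,0,1,35,0,13,56]),(233,3,[0,0,0,1,0,0,1,49,0,0,1,16,0,0,2,28,0,1,
  23,85,0,0,5,22,0,0,10,15,0,0,7,25]),(241,7,[0,0,1,0,17,36,0,43,51,0,2,6,0,1,77,0,6,25,0,46,46,
  0,12,13]),(257,3,[0,0,0,1,0,0,1,42,0,0,1,18,0,1,7,9,0,0,11,43,0,0,1,5,0,0,9,14,0,0,26,42]),
  (281,3,[0,0,1,0,5,10,0,6,55,0,5,12,0,17,24,0,49,62,0,15,77,0,8,77]),(313,5,[0,0,1,0,9,84,0,6,
  7,0,3,12,0,8,22,0,8,11,0,9,9,0,9,33]),(337,5,[0,0,0,1,0,0,1,14,0,0,9,30,0,0,18,38,0,0,2,37,0,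
  0,6,46,0,0,5,45,0,1,2,53])]"

definition extensions_8 :: "extension_table" where
  "extensions_8 = [
  (25,5,[2,0],[0,1],[[[],[],[],[],[1]],[[],[],[1],[1,1],[1,1]],[[],[],[],[1],[1]],[[],[1],[1],
  [1],[3,1]],[[],[],[],[1,1],[3,1]],[[],[],[1],[3,1],[3,1]],[[],[],[1],[1],[1]],[[],[1],[1],[1],
  [1,1]]]),(81,3,[1,1,0,0],[0,1],[[[],[],[],[1]],[[],[],[2,1],[1,1,1]],[[],[],[2,1],[0,1,1]],
  [[],[],[1,2,1],[2,2,1]],[[],[1],[2,1],[1,1,1]],[[],[1],[2,0,1],[2,2,1]],[[],[],[0,1,1],[2,2,
  1]],[[],[1],[1,1,1],[2,2,1]]]),(121,11,[2,0],[1,1],[[[],[],[],[1]],[[],[],[2,1],[7,1]],[[],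
  [1],[1],[10,3]],[[],[],[5],[2,1]],[[],[],[1],[1,1]],[[],[],[1,1],[9,1]],[[],[1],[1],[4,1]],
  [[],[],[2,1],[5,1]]]),(169,13,[2,0],[0,1],[[[],[],[1]],[[],[2],[4,1]],[[],[1],[1]],[[],[4],
  [10,2]],[[],[1],[4]],[[],[4],[5,2]],[[],[4,1],[6,1]],[[],[1],[10,1]]]),(289,17,[3,0],[0,1],
  [[[],[],[],[1]],[[],[],[12,1],[15,3]],[[],[],[3],[0,3]],[[],[1],[0,1],[8,3]],[[],[],[0,1],[0,
  1]],[[],[],[2,1],[5,1]],[[],[],[1,1],[16,1]],[[],[],[2,1],[12,1]]])]"

definition minus_ones_8 :: "minus_one_table" where
  "minus_ones_8 = [
  (41,[1,1,1,7]),(73,[3,9]),(89,[2,4,11]),(137,[1,2,31]),(233,[2,5,27]),(281,[1,11]),(313,[8,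
  22]),(409,[7,38]),(457,[2,40]),(521,[5,22]),(569,[8,122]),(601,[5,25]),(617,[1,45]),(761,[1,
  11,21]),(809,[6,7]),(857,[13,90]),(937,[3,178]),(953,[5,7]),(1033,[1,217]),(1049,[1,13]),
  (1097,[1,130]),(1129,[8,39]),(1193,[1,62]),(1289,[6,287]),(1321,[11,46]),(1433,[3,49]),(1481,
  [1,44]),(1609,[2,89]),(1657,[4,43]),(1721,[10,263]),(1753,[1,62]),(1801,[8,145]),(1913,[8,
  77]),(1993,[10,58]),(2089,[16,185]),(2137,[11,240]),(2153,[4,90]),(2281,[1,115]),(2297,[5,
  476]),(2377,[2,695]),(2393,[1,422])]"

definition extension_minus_ones_8 :: "extension_minus_one_table" where
  "extension_minus_ones_8 = [
  (25,5,[2,0],[[1,1],[3,1]]),(121,11,[2,0],[[1],[4]]),(169,13,[2,0],[[2],[4]]),(361,19,[2,0],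
  [[1],[9]]),(729,3,[1,1,0,0,0,0],[[1],[1]]),(841,29,[2,0],[[1,1],[14,4]]),(1369,37,[2,0],[[8],
  [10]]),(1849,43,[2,0],[[1],[2]])]"

lemma check_primes_8:
  "check_primes 8 [(2, 4)] required_8 3 primes_8"
  by code_simp

lemma check_extensions_8:
  "check_extensions 8 [(2, 4)] required_8 3 extensions_8"
  by code_simp

lemma covers_8:
  "covers ([9,49] @ map fst extensions_8)
    (int 8) (int 8 + 1) 42 (map fst primes_8)"
  by code_simp

lemma check_minus_ones_8: "check_minus_ones 8 required_8 3 minus_ones_8"
  by code_simp

lemma check_extension_minus_ones_8: "check_extension_minus_ones 8 required_8 3 extension_minus_ones_8"
  by code_simp

lemma covers_minus_ones_8:
  "covers ([9,49] @ map fst extension_minus_ones_8) (2 * int 8) (int 8 + 1) 150 (map fst minus_ones_8)"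
  by code_simp

lemma spec_8: "is_spec 8 [(2, 4)]"
  by (rule is_specI) code_simp+

lemma (in finite_subfield) waring_8:
  assumes "8 dvd q - 1" "int q \<notin> set [9,49]"
  shows "waring 8 (required required_8 3 (int q))"
  using assms by (intro waring_even[OF _ _ _ spec_8 check_primes_8 check_extensions_8 covers_8 _ _
      check_minus_ones_8 check_extension_minus_ones_8 covers_minus_ones_8])
  (simp_all add: required_8_def)

text \<open>Modulo 19 the ninth powers are 0, 1 and -1, so the residue 9 takes nine of them.\<close>

definition required_9 :: "required_table" where
  "required_9 = [
  (19,9),(37,5),(73,3),(109,3),(127,3),(163,3),(181,3),(199,3),(271,3),(307,3),(343,3)]"

definition primes_9 :: "prime_table" where
  "primes_9 = [
  (19,2,[0,0,0,0,0,0,0,0,1,0,0,0,0,0,0,0,1,1,0,0,0,0,0,1,1,1,1,0,1,1,1,1,1,1,1,1,0,0,0,0,0,0,2,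
  2,2,0,0,0,2,2,2,2,2,2,0,0,1,1,1,1,1,1,1,0,0,0,0,2,2,2,2,2,1,1,1,1,1,1,1,1,1]),(37,2,[0,0,0,0,
  1,0,0,0,1,1,0,0,3,3,5,0,0,1,1,5,3,3,5,5,5,0,0,0,1,2,0,1,1,2,2,0,3,5,5,5,0,0,3,3,3]),(73,2,[0,
  0,1,0,1,1,9,13,25,5,9,9,9,17,25,0,5,11,0,1,17,1,25,25,0,5,25]),(109,3,[0,0,1,1,1,1,0,1,13,0,
  11,11,2,11,12,0,6,8,0,2,4,0,4,13,2,12,13]),(127,3,[0,0,1,0,1,16,0,1,13,10,23,33,1,4,8,1,2,39,
  0,10,20,0,11,23,2,4,8]),(163,2,[0,0,1,0,1,1,2,4,36,0,9,24,1,10,18,0,15,67,0,3,36,0,2,8,0,3,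
  9]),(181,2,[0,0,1,0,1,1,0,2,24,1,27,54,0,24,26,0,1,21,0,27,63,0,2,6,0,1,8]),(199,2,[0,0,1,0,1,
  1,0,9,22,1,7,25,0,6,22,3,4,7,0,1,35,0,5,7,1,3,11]),(271,2,[0,0,1,0,1,1,0,1,38,0,13,14,0,6,11,
  0,33,38,1,9,22,0,5,8,1,3,86]),(307,5,[0,0,1,0,9,52,0,1,26,0,8,72,0,3,32,0,5,39,0,7,32,2,4,32,
  0,14,78]),(379,2,[0,1,1,1,40,49,2,147,12,24,3,42,22,34,2,31,1,4]),(397,3,[0,1,1,21,1,53,26,92,
  3,6,2,13,11,35,44,62,7,23]),(433,3,[0,1,3,69,1,72,5,14,7,30,3,28,1,5,1,31,9,86]),(487,2,[0,1,
  1,1,7,33,3,161,3,7,10,76,2,110,19,65,1,5]),(523,2,[0,1,1,1,1,65,6,55,2,50,2,24,8,98,5,54,48,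
  49]),(541,2,[0,1,1,1,6,18,8,52,3,14,4,11,9,242,7,69,4,8]),(577,2,[0,1,1,1,5,24,12,75,6,58,2,
  120,3,31,1,66,24,104]),(613,2,[0,1,1,1,6,179,3,91,52,182,3,122,36,42,6,8,48,68]),(631,2,[0,1,
  1,1,10,62,14,33,3,17,22,52,10,35,3,174,11,24]),(739,3,[0,1,6,114,1,29,10,90,5,55,15,53,4,120,
  24,57,26,34]),(757,2,[0,1,1,1,14,56,8,35,7,221,10,388,5,28,1,64,1,65]),(811,3,[0,1,46,233,1,
  23,5,31,7,59,8,35,30,399,5,22,10,81]),(829,2,[0,1,1,1,11,48,3,283,1,58,1,87,19,28,3,88,22,
  152]),(883,2,[0,1,1,1,11,104,1,119,6,242,14,234,29,53,5,225,3,242]),(919,5,[0,1,7,34,3,14,3,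
  31,12,42,9,131,1,1,16,131,8,114]),(937,2,[0,1,1,1,19,82,2,257,9,33,3,54,4,219,19,44,18,375]),
  (991,2,[0,1,1,1,6,204,4,110,15,292,15,29,20,47,3,100,10,40]),(1009,2,[0,1,1,1,8,38,4,388,4,
  166,31,202,17,91,53,148,5,32]),(1063,2,[0,1,1,1,33,67,43,251,11,381,3,127,36,184,25,125,5,
  26]),(1117,2,[0,1,1,1,2,5,10,132,3,268,13,15,6,362,5,61,7,115]),(1153,2,[0,1,1,1,6,45,32,79,9,
  133,3,49,2,38,20,61,1,415]),(1171,2,[0,1,1,1,5,152,4,94,13,390,30,36,3,142,2,131,10,88]),
  (1279,2,[0,1,1,1,10,22,7,55,7,88,28,267,11,128,1,107,21,218]),(1297,2,[0,1,1,1,13,74,7,106,3,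
  94,13,504,10,429,37,83,19,571]),(1423,3,[0,1,9,156,1,103,17,86,1,357,8,100,12,76,20,43,2,
  304]),(1459,3,[0,1,12,204,1,162,12,189,1,61,6,132,8,38,14,688,2,159]),(1531,2,[0,1,1,1,1,284,
  1,17,1,37,9,32,1,264,41,158,16,65]),(1549,2,[0,1,1,1,19,397,7,126,15,584,7,35,8,88,3,30,3,
  133]),(1567,2,[0,1,1,1,7,117,3,227,7,241,19,39,20,236,55,177,9,10]),(1621,2,[0,1,1,1,1,19,11,
  41,6,209,7,43,7,113,1,51,1,47]),(1657,3,[0,1,1,54,1,49,1,448,56,234,28,187,1,8,25,707,5,632]),
  (1693,2,[0,1,1,1,6,22,2,82,11,251,6,256,56,154,11,244,17,114]),(1747,2,[0,1,1,1,10,73,9,265,9,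
  21,22,284,8,121,1,266,10,398]),(1783,2,[0,1,1,1,3,62,12,215,4,242,14,418,8,12,4,124,7,160]),
  (1801,3,[0,1,1,168,1,81,3,29,12,166,12,308,7,118,7,344,8,106]),(1873,2,[0,1,1,1,8,391,5,435,
  10,60,10,573,23,31,5,128,24,58]),(1999,3,[0,1,16,19,1,119,5,133,18,324,19,257,3,298,5,186,2,
  107]),(2017,3,[0,1,9,107,1,132,2,497,5,278,16,54,1,135,11,197,5,325]),(2053,2,[0,1,1,1,7,588,
  25,410,4,80,8,49,18,903,4,82,3,274]),(2089,3,[0,1,1,15,1,188,7,97,6,109,20,199,27,97,7,110,8,
  9]),(2143,3,[0,1,12,155,1,64,2,619,3,518,15,218,8,408,7,158,6,21]),(2161,2,[0,1,1,1,8,284,5,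
  110,11,46,2,352,10,337,27,837,11,230]),(2179,5,[0,1,14,57,1,470,8,34,6,92,1,93,9,60,11,18,1,
  55]),(2251,5,[0,1,3,104,1,453,8,30,5,202,3,374,5,542,9,303,22,339]),(2269,2,[0,1,1,1,1,331,6,
  550,4,144,15,337,7,11,1,92,43,68]),(2287,7,[0,1,1,35,1,167,8,95,7,14,2,644,6,90,2,560,4,574]),
  (2341,5,[0,1,6,581,2,179,16,50,17,177,2,335,22,136,7,147,4,156]),(2377,2,[0,1,1,1,22,150,13,
  56,23,74,8,106,10,321,31,284,9,460]),(2467,2,[0,1,1,1,4,107,27,311,23,387,14,135,3,37,11,643,
  1,63]),(2503,2,[0,1,1,1,7,888,3,260,15,67,8,690,3,228,4,440,15,457]),(2521,2,[0,1,1,1,9,12,9,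
  137,12,100,3,338,1,158,8,608,37,457]),(2539,2,[0,1,1,1,4,609,7,315,8,101,3,334,8,238,2,10,8,
  912]),(2557,2,[0,1,1,1,2,86,5,17,2,254,6,454,10,219,6,45,25,260]),(2593,2,[0,1,1,1,5,231,2,
  418,11,916,10,17,5,916,7,158,4,637]),(2647,2,[0,1,1,1,3,41,17,928,3,81,7,360,36,81,2,271,1,
  219]),(2683,2,[0,1,1,1,16,134,17,232,1,279,1,369,10,194,1,28,1,620]),(2719,2,[0,1,1,1,2,349,6,
  530,4,196,14,51,12,849,4,296,1,239]),(2791,3,[0,1,7,158,1,227,4,590,1,659,5,71,4,222,1,6,9,
  221]),(2917,3,[0,1,3,227,1,731,10,192,9,24,3,17,12,76,5,547,13,377]),(2953,3,[0,1,7,629,1,352,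
  4,79,6,466,5,177,9,254,16,385,8,94]),(2971,5,[0,1,1,183,2,89,21,451,11,231,5,1094,2,99,16,119,
  9,145]),(3061,3,[0,1,25,139,1,139,2,525,4,327,22,625,6,56,23,81,4,782]),(3079,2,[0,1,1,1,1,
  329,3,247,29,108,26,212,3,44,6,358,5,93]),(3169,2,[0,1,1,1,10,130,7,37,8,1077,3,632,11,74,2,
  569,8,536]),(3187,2,[0,1,1,1,1,29,8,148,11,432,10,79,2,73,24,441,3,40]),(3259,3,[0,1,8,599,1,
  137,9,86,5,396,5,159,7,664,4,1177,17,129]),(3313,2,[0,1,1,1,10,267,2,390,15,243,2,30,11,196,
  11,359,7,31]),(3331,3,[0,1,14,361,1,278,6,494,32,411,1,98,1,19,8,288,5,195]),(3457,3,[0,1,15,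
  167,1,288,3,260,1,158,1,385,6,629,8,904,4,319]),(3511,2,[0,1,1,1,6,268,14,164,10,257,13,731,
  30,119,7,299,1,111]),(3529,2,[0,1,1,1,2,7,1,24,10,451,7,231,6,28,7,109,5,277]),(3547,2,[0,1,1,
  1,4,885,1,178,1,24,12,107,8,194,2,21,5,324]),(3583,2,[0,1,1,1,7,254,1,519,9,144,8,75,6,55,6,
  409,8,169])]"

definition extensions_9 :: "extension_table" where
  "extensions_9 = [
  (289,17,[3,0],[1,1],[[[],[1]],[[1],[0,4]],[[4],[7,1]],[[7],[3,1]],[[6],[7,2]],[[8],[2,3]],
  [[4],[0,4]],[[10],[8,6]],[[12],[6,2]]]),(343,7,[2,0,0],[0,1],[[[],[],[1]],[[],[1],[5,3,1]],
  [[],[6,4,1],[3,5,1]],[[],[1],[1]],[[],[1],[3,5,1]],[[],[3,1,1],[5,3,1]],[[3],[3],[3]],[[],[1],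
  [6,6,1]],[[],[5,2,1],[6,6,1]]]),(361,19,[2,0],[2],[[[],[1]],[[1],[1]],[[3,1],[13,2]],[[8,1],
  [10,1]],[[9,1],[1,2]],[[0,1],[2,2]],[[18,1],[2,2]],[[5,1],[9,2]],[[6,1],[14,1]]]),(1369,37,[2,
  0],[2],[[[],[1]],[[1],[1]],[[8,1],[13,3]],[[4,1],[17,2]],[[8,1],[13,5]],[[1],[2]],[[3,1],[28,
  3]],[[0,1],[16,5]],[[6,1],[11,2]]]),(2197,13,[2,0,0],[0,1],[[[],[1]],[[1],[2,5,2]],[[8,2],[6,
  6,2]],[[1],[1]],[[2],[2,5,1]],[[8,1],[11,9,1]],[[2],[4]],[[4],[2,9,1]],[[9,2],[3,2,2]]]),
  (2809,53,[2,0],[1,1],[[[],[1]],[[1],[26,4]],[[12],[37,6]],[[4],[38,1]],[[11],[14,2]],[[12],[3,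
  2]],[[2],[35,9]],[[9],[10,4]],[[9],[24,1]]])]"

lemma check_primes_9:
  "check_primes 9 [(3, 3)] required_9 2 primes_9"
  by code_simp

lemma check_extensions_9:
  "check_extensions 9 [(3, 3)] required_9 2 extensions_9"
  by code_simp

lemma covers_9:
  "covers ([64] @ map fst extensions_9)
    (int 9) (int 9 + 1) 399 (map fst primes_9)"
  by code_simp

lemma spec_9: "is_spec 9 [(3, 3)]"
  by (rule is_specI) code_simp+

lemma (in finite_subfield) waring_9:
  assumes "9 dvd q - 1" "int q \<notin> set [64]"
  shows "waring 9 (required required_9 2 (int q))"
  using assms by (intro waring_odd[OF _ _ _ spec_9 check_primes_9 check_extensions_9 covers_9])
  (simp_all add: required_9_def)

definition required_10 :: "required_table" where
  "required_10 = [
  (11,11),(31,6),(41,5),(61,5),(71,4),(101,4),(121,4),(131,4),(151,4),(181,4),(191,4),(211,4),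
  (241,4),(251,4),(271,4),(281,4),(311,4),(331,4),(401,4),(421,4),(431,4),(461,4),(491,4),(641,
  4),(911,4)]"

definition primes_10 :: "prime_table" where
  "primes_10 = [
  (11,2,[0,0,0,0,0,0,0,0,0,0,1,0,0,0,0,0,0,0,0,0,1,1,0,0,0,0,0,0,0,1,1,1,1,0,0,0,1,1,1,1,1,1,1,
  1,0,0,0,0,0,0,1,1,1,1,1,0,1,1,1,1,1,1,1,1,1,1,0,0,1,1,1,1,1,1,1,1,1,0,0,0,0,1,1,1,1,1,1,1,0,0,
  0,0,0,0,0,0,1,1,1,0,0,0,0,0,1,1,1,1,1,1]),(31,3,[0,0,0,0,0,1,0,0,0,1,1,1,0,0,3,5,5,5,0,0,0,1,
  1,3,0,0,0,0,3,3,0,0,0,0,1,3,0,0,1,5,5,5,0,1,1,5,5,5,0,0,0,1,3,3,0,0,3,3,5,5]),(41,6,[0,0,0,0,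
  1,0,2,2,2,3,0,3,3,3,3,0,0,1,1,3,0,1,1,6,6,0,0,3,3,3,0,0,0,2,2,0,2,2,2,6,0,0,0,1,3,0,0,1,3,3]),
  (61,2,[0,0,0,0,1,0,0,0,1,1,0,1,1,1,1,0,2,2,2,4,0,0,1,1,10,0,0,4,4,8,0,0,1,1,1,0,2,4,4,4,0,0,0,
  5,8,0,5,5,8,8]),(71,7,[0,0,0,1,0,0,2,3,0,0,1,3,0,3,7,18,0,1,6,18,0,1,2,6,0,0,1,1,0,0,3,18,0,2,
  3,6,0,1,1,7]),(101,2,[0,0,0,1,0,0,1,1,0,1,8,13,0,0,2,4,0,0,8,10,0,1,2,8,0,0,3,10,0,2,2,10,0,1,
  5,8,0,0,1,26]),(131,2,[0,0,0,1,0,0,1,1,0,2,2,4,0,1,3,12,0,0,11,33,0,1,3,33,0,0,1,33,0,2,2,14,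
  0,0,7,14,0,0,7,12]),(151,3,[0,0,0,1,0,0,1,5,0,0,1,3,0,0,3,29,0,1,9,15,0,0,15,30,0,1,12,29,0,1,
  2,12,0,0,9,22,0,0,11,30]),(181,2,[0,0,0,1,0,0,1,1,0,0,3,10,0,0,11,18,0,0,5,15,0,0,7,14,0,0,15,
  19,0,0,14,25,0,1,1,11,0,0,6,50]),(191,7,[0,0,0,1,0,0,1,36,0,3,3,8,0,1,1,38,0,0,38,38,0,0,2,13,
  0,0,3,32,0,0,8,12,0,1,2,6,0,0,3,19]),(211,2,[0,0,0,1,0,0,1,1,0,0,7,22,0,0,13,22,0,0,7,32,0,0,
  13,16,0,1,26,32,0,0,17,22,0,1,1,20,0,0,5,17]),(241,7,[0,0,0,1,0,0,6,23,0,0,4,5,0,3,4,7,0,0,6,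
  26,0,0,1,30,0,1,13,23,0,0,9,43,0,0,7,38,0,3,7,38]),(251,6,[0,0,0,1,0,0,1,19,0,0,2,68,0,0,15,
  19,0,0,6,68,0,0,17,19,0,0,2,45,0,0,2,34,0,1,4,6,0,1,2,6]),(271,3,[0,0,0,1,0,0,3,66,0,0,5,5,0,
  0,5,63,0,0,6,11,0,0,1,3,0,1,9,63,0,0,8,66,0,0,7,66,0,0,21,22]),(281,3,[0,0,0,1,0,0,3,30,0,0,2,
  32,0,0,7,27,0,0,2,2,0,0,1,21,0,0,38,54,0,0,2,3,0,0,3,43,0,2,6,8]),(311,17,[0,0,0,1,0,1,1,80,0,
  0,20,37,0,0,20,21,0,0,9,19,0,1,1,14,0,0,2,63,0,0,11,37,0,0,20,41,0,0,4,22]),(331,2,[0,0,0,1,0,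
  0,1,1,0,1,12,34,0,0,2,13,0,0,7,100,0,0,1,2,0,0,12,14,0,2,3,19,0,0,6,100,0,0,1,7]),(401,3,[0,0,
  0,1,0,0,12,25,0,0,2,6,0,0,5,26,0,0,8,16,0,0,10,60,0,0,8,8,0,0,15,36,0,1,5,5,0,0,2,65]),(421,2,
  [0,0,0,1,0,0,1,1,0,0,2,17,0,0,2,7,0,0,3,14,0,0,8,23,0,0,79,84,0,0,11,32,0,2,13,36,0,0,8,17]),
  (431,7,[0,0,0,1,0,0,1,38,0,0,1,46,0,0,12,38,0,0,11,15,0,2,20,28,0,1,4,57,0,0,6,40,0,0,5,39,0,
  0,22,25]),(461,2,[0,0,0,1,0,0,1,1,0,0,9,36,0,0,3,11,0,0,8,33,0,0,6,48,0,0,3,91,0,0,23,82,0,1,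
  2,49,0,0,27,28]),(491,2,[0,0,0,1,0,0,1,1,0,0,1,7,0,0,23,96,0,0,3,22,0,1,6,50,0,0,12,20,0,0,6,
  60,0,0,4,96,0,0,5,114]),(521,3,[0,0,1,0,18,22,0,12,74,0,22,132,0,2,32,0,18,68,0,2,57,0,18,36,
  0,12,48,0,14,57]),(541,2,[0,0,1,0,1,1,0,3,72,0,2,84,0,1,15,0,1,14,0,22,33,0,33,59,0,14,20,0,4,
  55]),(571,3,[0,0,1,0,6,39,0,9,138,0,3,67,0,14,40,0,7,7,0,4,14,0,21,111,0,23,98,0,13,104]),
  (601,7,[0,0,1,0,2,83,0,17,52,0,5,33,0,3,68,0,26,141,0,6,45,0,12,20,0,4,26,0,17,66]),(631,3,[0,
  0,1,0,6,62,0,12,126,0,19,135,0,28,46,0,42,45,0,21,67,0,6,184,0,38,71,0,10,41]),(641,3,[0,0,0,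
  1,0,0,1,96,0,0,1,75,0,0,3,30,0,0,1,60,0,0,39,127,0,0,11,109,0,0,22,92,0,0,7,24,0,1,21,40]),
  (661,2,[0,0,1,0,1,1,0,1,86,0,5,85,0,3,81,0,27,133,0,50,172,0,34,103,0,79,103,0,9,61]),(691,2,
  [0,0,1,0,1,1,0,6,9,0,12,127,0,5,18,0,5,165,0,2,114,0,57,64,0,3,13,0,29,81]),(701,2,[0,0,1,0,1,
  1,0,29,82,0,14,76,0,17,19,0,8,72,0,1,84,0,21,152,0,6,72,0,12,31])]"

definition extensions_10 :: "extension_table" where
  "extensions_10 = [
  (121,11,[2,0],[2,1],[[[],[],[],[1]],[[],[],[1,1],[6,1]],[[],[],[9,1],[9,1]],[[],[],[4,1],[9,
  1]],[[],[1],[1],[8,1]],[[],[0,1],[5,1],[10,1]],[[],[1,1],[7,1],[10,1]],[[],[],[1],[10,1]],[[],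
  [],[2,1],[3,1]],[[],[1],[1],[9,1]]]),(361,19,[2,0],[1,1],[[[],[],[1]],[[],[1],[2,1]],[[],[7,
  1],[15,2]],[[],[7],[18,2]],[[],[2],[10,1]],[[],[7,1],[3,3]],[[],[4],[6,1]],[[],[8],[4,2]],[[],
  [7],[16,3]],[[],[6],[18,1]]])]"

definition minus_ones_10 :: "minus_one_table" where
  "minus_ones_10 = [
  (11,[1,1,1,1,1,1,1,1,1,1]),(31,[3,5]),(71,[1,9,18]),(131,[1,11,14]),(151,[2,4]),(191,[2,13]),
  (211,[10,14]),(251,[1,11]),(271,[3,9]),(311,[1,7,14]),(331,[2,4]),(431,[2,46,106]),(491,[1,8,
  15]),(571,[1,35]),(631,[8,44]),(691,[4,40]),(751,[5,79]),(811,[14,58]),(911,[5,23,105]),(971,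
  [1,51]),(991,[71,86]),(1031,[19,67]),(1051,[12,75]),(1091,[14,67]),(1151,[25,34]),(1171,[6,
  36]),(1231,[31,180]),(1291,[8,298]),(1451,[3,217]),(1471,[21,48]),(1511,[10,49]),(1531,[59,
  130]),(1571,[5,330]),(1811,[1,95]),(1831,[4,367]),(1871,[2,202]),(1931,[18,110]),(1951,[4,
  105]),(2011,[1,89]),(2111,[19,218]),(2131,[14,54]),(2251,[5,283]),(2311,[19,147]),(2351,[2,
  108]),(2371,[20,443]),(2411,[1,491]),(2531,[27,44]),(2551,[18,41]),(2591,[9,354]),(2671,[22,
  212]),(2711,[3,255]),(2731,[1,16]),(2791,[9,98]),(2851,[14,59]),(2971,[14,713]),(3011,[16,
  185]),(3191,[8,186]),(3251,[1,189]),(3271,[4,183]),(3331,[1,60]),(3371,[11,254]),(3391,[2,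
  267]),(3491,[12,526]),(3511,[13,34]),(3571,[7,341]),(3631,[6,78]),(3671,[3,203]),(3691,[9,
  237]),(3851,[9,205]),(3911,[5,88]),(3931,[6,50]),(4051,[6,43]),(4091,[19,98]),(4111,[34,275]),
  (4211,[1,217]),(4231,[33,176]),(4271,[2,480]),(4391,[4,246]),(4451,[15,66]),(4591,[27,940]),
  (4651,[13,169]),(4691,[2,59]),(4751,[13,234]),(4831,[18,181]),(4871,[10,56]),(4931,[1,61]),
  (4951,[7,1178]),(5011,[8,566]),(5051,[3,258]),(5171,[12,536]),(5231,[26,278]),(5351,[58,692]),
  (5431,[3,307]),(5471,[14,360]),(5531,[17,25]),(5591,[5,526]),(5651,[2,1135]),(5711,[2,427]),
  (5791,[4,529]),(5851,[2,1000]),(6011,[14,353]),(6091,[50,665]),(6131,[61,1920]),(6151,[5,84]),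
  (6211,[15,860]),(6271,[8,1293]),(6311,[7,382]),(6451,[2,1758]),(6491,[6,902]),(6551,[9,222])]"

definition extension_minus_ones_10 :: "extension_minus_one_table" where
  "extension_minus_ones_10 = [
  (1331,11,[1,3,0],[[0,1],[1,1]])]"

lemma check_primes_10:
  "check_primes 10 [(2, 5), (5, 2)] required_10 3 primes_10"
  by code_simp

lemma check_extensions_10:
  "check_extensions 10 [(2, 5), (5, 2)] required_10 3 extensions_10"
  by code_simp

lemma covers_10:
  "covers ([81] @ map fst extensions_10)
    (int 10) (int 10 + 1) 72 (map fst primes_10)"
  by code_simp

lemma check_minus_ones_10: "check_minus_ones 10 required_10 3 minus_ones_10"
  by code_simp

lemma check_extension_minus_ones_10: "check_extension_minus_ones 10 required_10 3 extension_minus_ones_10"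
  by code_simp

lemma covers_minus_ones_10:
  "covers ([81] @ map fst extension_minus_ones_10) (2 * int 10) (int 10 + 1) 328 (map fst minus_ones_10)"
  by code_simp

lemma spec_10: "is_spec 10 [(2, 5), (5, 2)]"
  by (rule is_specI) code_simp+

lemma (in finite_subfield) waring_10:
  assumes "10 dvd q - 1" "int q \<notin> set [81]"
  shows "waring 10 (required required_10 3 (int q))"
  using assms by (intro waring_even[OF _ _ _ spec_10 check_primes_10 check_extensions_10 covers_10 _ _
      check_minus_ones_10 check_extension_minus_ones_10 covers_minus_ones_10])
  (simp_all add: required_10_def)

definition required_11 :: "required_table" where
  "required_11 = [
  (67,5),(89,4),(199,3),(331,3),(353,3),(419,3),(463,3),(617,3)]"

definition primes_11 :: "prime_table" where
  "primes_11 = [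
  (67,2,[0,0,0,0,1,0,0,0,1,1,0,1,1,1,1,0,0,0,2,4,0,2,2,4,4,0,0,1,1,7,0,0,3,3,3,0,0,1,7,7,2,2,2,
  2,4,0,3,4,4,4,0,3,6,6,6]),(89,2,[0,0,0,1,0,0,1,1,0,1,3,5,5,5,11,13,0,1,33,33,0,9,11,11,0,0,19,
  33,0,1,1,3,0,0,1,13,0,0,5,19,0,9,11,19]),(199,2,[0,0,1,0,1,1,1,30,47,2,20,25,0,3,47,3,9,41,0,
  6,27,0,15,27,0,2,11,0,12,15,4,22,25]),(331,3,[0,0,1,0,1,62,0,1,8,0,88,101,0,5,53,0,2,73,0,22,
  41,0,4,5,0,19,20,0,14,56,1,11,62]),(353,2,[0,0,1,0,1,1,0,28,77,0,1,12,0,8,18,0,35,59,0,4,5,1,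
  7,30,1,9,9,0,13,15,0,1,41]),(397,2,[0,1,1,1,46,71,12,40,8,9,23,36,1,2,12,18,9,15,6,36,11,
  106]),(419,2,[0,0,1,0,1,1,0,9,89,0,1,16,0,12,17,0,9,51,0,18,51,0,10,25,0,11,24,1,2,9,0,9,81]),
  (463,2,[0,0,1,0,1,1,0,13,29,0,3,25,0,13,37,0,10,42,0,7,26,0,14,42,1,23,148,0,19,37,0,13,46]),
  (617,2,[0,0,1,0,1,1,0,6,10,0,4,119,0,3,57,0,3,87,0,4,8,1,1,8,0,17,18,0,23,270,0,26,54]),(661,
  2,[0,1,1,1,2,34,23,109,11,25,26,52,2,3,35,130,1,64,7,85,3,20]),(683,2,[0,1,1,1,1,137,2,27,95,
  98,14,37,5,110,33,58,14,18,17,141,25,114]),(727,2,[0,1,1,1,2,27,23,75,34,51,20,27,2,47,41,66,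
  2,59,2,23,1,171]),(859,2,[0,1,1,1,6,18,9,87,18,159,25,89,31,94,28,74,24,159,5,28,4,76]),(881,
  2,[0,1,1,1,18,35,1,101,18,154,6,15,10,18,8,36,17,36,4,12,6,12]),(947,2,[0,1,1,1,14,124,1,96,9,
  125,8,124,16,25,1,83,7,21,204,310,15,64]),(991,2,[0,1,1,1,16,33,17,47,1,22,5,105,33,273,22,61,
  5,73,5,55,14,273]),(1013,3,[0,1,1,106,1,120,43,93,9,31,1,47,6,86,14,31,4,173,14,33,8,11]),
  (1123,2,[0,1,1,1,16,107,13,48,1,10,6,32,38,132,13,16,12,195,4,64,33,52]),(1277,2,[0,1,1,1,3,
  144,5,203,16,48,5,80,12,288,1,156,1,353,8,98,35,178]),(1321,3,[0,1,1,5,1,125,11,42,29,103,45,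
  75,2,5,18,312,202,428,1,212,11,105]),(1409,2,[0,1,1,1,4,18,8,238,14,49,18,94,17,273,71,78,42,
  132,11,39,8,71]),(1453,2,[0,1,1,1,8,98,28,247,2,162,15,73,1,176,9,93,9,143,8,182,1,38]),(1607,
  2,[0,1,1,1,9,423,3,135,1,168,2,140,2,76,15,67,8,102,14,182,19,274]),(1783,2,[0,1,1,1,9,144,7,
  68,15,99,8,503,21,43,9,72,1,231,6,377,33,117]),(1871,2,[0,1,1,1,1,32,8,29,3,384,29,229,25,140,
  1,47,1,30,8,38,7,42]),(2003,2,[0,1,1,1,5,121,11,185,4,274,9,127,6,19,3,150,15,350,4,669,9,
  394]),(2069,2,[0,1,1,1,2,49,4,188,5,215,2,79,24,267,8,230,17,35,5,31,4,27]),(2113,2,[0,1,1,1,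
  26,88,1,253,8,11,2,189,4,8,26,310,10,50,8,17,12,166]),(2179,2,[0,1,1,1,4,348,3,21,9,58,6,34,8,
  135,1,439,16,31,2,83,31,486]),(2267,2,[0,1,1,1,3,131,8,188,5,315,11,204,20,73,2,42,4,65,5,35,
  5,83]),(2311,2,[0,1,1,1,6,516,32,344,2,10,36,83,5,274,8,204,18,38,54,122,8,10]),(2333,2,[0,1,
  1,1,13,443,5,12,12,100,3,126,2,38,8,204,1,267,6,22,14,304]),(2377,2,[0,1,1,1,24,54,1,168,6,
  173,14,210,31,127,6,10,35,239,5,269,8,349]),(2399,2,[0,1,1,1,16,265,5,30,3,516,4,473,6,197,16,
  38,2,104,5,210,6,239]),(2531,2,[0,1,1,1,8,63,33,443,4,935,26,105,34,171,25,479,1,138,18,201,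
  16,378]),(2663,2,[0,1,1,1,23,244,5,1131,12,129,49,159,6,388,7,197,17,29,10,14,15,196]),(2707,
  2,[0,1,1,1,20,403,6,840,12,248,4,221,4,189,10,712,4,230,9,340,12,74]),(2729,2,[0,1,1,1,13,462,
  15,108,1,43,2,139,12,68,1,81,1,60,4,99,31,121]),(2861,2,[0,1,1,1,3,602,13,115,16,51,7,716,20,
  311,6,48,4,183,48,345,11,445]),(2927,2,[0,1,1,1,7,182,3,60,1,97,12,36,7,150,7,168,1,257,1,328,
  33,355]),(2971,2,[0,1,1,1,3,262,48,255,16,471,28,388,10,403,4,346,1,242,17,176,6,319]),(3037,
  2,[0,1,1,1,3,21,2,71,16,201,5,150,42,1010,21,45,3,36,22,189,36,279]),(3169,2,[0,1,1,1,19,711,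
  17,187,1,131,11,129,2,122,12,83,3,382,16,116,4,134]),(3191,2,[0,1,1,1,6,118,2,162,19,28,8,367,
  1,276,8,107,7,13,11,84,28,182]),(3257,2,[0,1,1,1,45,77,19,1057,18,215,20,378,1,330,5,58,4,69,
  10,243,17,266]),(3301,2,[0,1,1,1,15,227,14,65,20,328,8,265,1,35,6,355,5,153,2,146,1,93]),
  (3323,2,[0,1,1,1,7,253,2,140,2,48,5,816,2,57,3,50,26,700,3,296,22,301]),(3389,2,[0,1,1,1,5,
  139,15,206,1,352,4,262,1,172,6,19,13,64,14,334,19,51]),(3433,2,[0,1,1,1,7,148,17,831,3,802,2,
  745,26,1014,72,553,7,146,3,232,11,32]),(3499,2,[0,1,1,1,2,255,2,19,2,452,1,22,24,94,9,259,6,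
  331,8,492,14,332]),(3631,2,[0,1,1,1,18,193,1,730,21,156,24,336,10,1692,1,91,9,117,1,252,12,
  234]),(3697,2,[0,1,1,1,9,98,7,122,5,176,10,91,14,398,12,116,22,186,5,109,60,799]),(3719,2,[0,
  1,1,1,15,211,4,74,8,381,28,193,2,681,20,219,2,351,7,140,8,173]),(3851,2,[0,1,1,1,53,491,1,706,
  1,95,20,319,19,355,46,1213,20,260,4,422,10,41]),(3917,2,[0,1,1,1,9,38,1,291,12,97,4,76,11,12,
  1,283,1,154,9,452,1,112]),(4027,2,[0,1,1,1,7,25,24,538,10,118,5,17,6,332,2,331,16,683,27,310,
  49,471]),(4049,2,[0,1,1,1,18,63,4,113,6,227,9,224,6,31,7,264,4,233,3,107,4,231]),(4093,2,[0,1,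
  1,1,7,187,22,99,10,539,9,416,1,92,28,57,10,731,13,430,3,188]),(4159,2,[0,1,1,1,7,391,6,407,2,
  138,12,159,2,98,2,447,35,394,1,438,36,551]),(4357,2,[0,1,1,1,1,14,30,449,4,486,11,797,22,53,6,
  182,7,360,16,533,32,392]),(4423,2,[0,1,1,1,9,1328,2,973,7,216,2,565,16,341,2,413,20,114,1,300,
  4,166]),(4621,2,[0,1,1,1,24,123,3,340,6,305,13,820,1,165,22,385,7,360,22,601,4,1291]),(4643,3,
  [0,1,1,98,1,53,5,629,3,88,7,77,3,504,2,64,11,323,17,440,22,331]),(4951,2,[0,1,1,1,60,783,14,
  299,2,23,1,2033,18,525,6,80,9,24,7,136,1,519]),(4973,2,[0,1,1,1,17,1017,4,248,19,170,15,242,5,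
  380,5,284,7,1739,8,648,6,591]),(5039,2,[0,1,1,1,13,196,6,25,19,483,7,241,15,293,6,163,6,1344,
  25,995,14,163]),(5171,2,[0,1,1,1,1,57,18,250,4,224,9,99,7,382,33,684,4,582,1,1035,7,150]),
  (5237,2,[0,1,1,1,2,90,4,344,4,36,1,193,17,1801,21,1028,11,927,17,516,21,856]),(5281,2,[0,1,1,
  1,4,152,9,665,15,768,3,122,7,158,3,146,8,792,10,709,3,396]),(5303,2,[0,1,1,1,8,367,7,554,12,
  567,11,308,1,329,27,1145,2,155,11,85,3,170]),(5347,2,[0,1,1,1,41,397,2,324,19,332,11,77,1,413,
  24,935,3,171,18,263,22,306]),(5413,2,[0,1,1,1,4,317,6,264,15,449,13,163,14,49,9,110,27,392,2,
  18,6,805]),(5479,2,[0,1,1,1,16,658,11,104,10,823,3,67,1,366,3,572,1,436,1,456,14,1270]),(5501,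
  2,[0,1,1,1,35,164,13,826,38,51,12,85,7,168,13,290,25,260,4,780,4,145]),(5743,2,[0,1,1,1,1,45,
  1,663,4,1139,20,299,1,1123,2,617,10,1706,14,238,7,96]),(5897,2,[0,1,1,1,8,217,11,603,5,877,15,
  122,2,1656,8,430,1,778,6,389,10,135]),(6007,2,[0,1,1,1,10,482,17,601,12,324,21,610,5,168,6,
  466,7,1141,15,1273,1,673]),(6029,2,[0,1,1,1,7,85,9,979,6,359,3,294,1,532,21,28,7,867,1,68,6,
  654]),(6073,2,[0,1,1,1,12,812,36,1291,9,530,1,415,14,364,19,93,14,74,3,348,3,297]),(6271,2,[0,
  1,1,1,5,304,10,245,5,154,10,605,1,315,13,336,10,740,9,21,1,524]),(6337,3,[0,1,1,1256,1,253,1,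
  475,23,27,15,773,11,225,61,339,5,1566,30,354,2,326]),(6359,2,[0,1,1,1,2,661,7,661,1,1461,14,
  122,13,242,38,189,46,866,32,38,17,78]),(6469,2,[0,1,1,1,18,86,69,1034,10,251,10,154,12,337,4,
  2014,5,1235,28,2370,3,10]),(6491,2,[0,1,1,1,7,342,5,856,8,1222,3,382,4,888,13,1740,46,1335,50,
  330,12,115]),(6689,2,[0,1,1,1,13,1052,21,141,5,148,8,407,14,152,4,419,36,407,13,459,1,146]),
  (6733,2,[0,1,1,1,8,945,14,610,32,92,11,73,4,155,22,28,1,1416,6,2441,4,1169]),(6997,2,[0,1,1,1,
  16,408,3,1189,10,81,2,299,8,25,3,1384,5,74,6,1384,4,87]),(7019,2,[0,1,1,1,22,811,16,819,29,
  1396,32,479,2,849,7,393,34,1208,3,29,12,73]),(7129,2,[0,1,1,1,5,766,5,518,9,1092,1,1295,5,387,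
  27,444,12,95,7,26,15,994]),(7151,3,[0,1,1,748,1,292,5,398,3,216,4,735,9,45,3,176,7,773,2,3388,
  7,379]),(7283,2,[0,1,1,1,22,197,1,256,1,767,9,228,13,860,11,194,5,496,2,112,5,299]),(7349,2,
  [0,1,1,1,22,90,26,110,2,917,6,428,13,67,4,142,17,2372,16,88,4,827]),(7393,2,[0,1,1,1,2,73,11,
  313,20,304,1,786,6,175,9,89,24,1170,10,316,5,317]),(7459,2,[0,1,1,1,3,584,2,171,3,1048,12,154,
  5,36,1,444,4,841,6,163,9,1852]),(7481,2,[0,1,1,1,7,1149,9,402,6,601,4,562,3,1262,4,1304,8,84,
  2,438,8,854]),(7547,2,[0,1,1,1,26,653,5,51,12,114,4,618,5,842,28,1283,23,837,26,457,8,547]),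
  (7591,2,[0,1,1,1,25,716,13,228,4,800,16,855,1,258,8,157,1,673,7,282,19,1741]),(7723,2,[0,1,1,
  1,22,228,2,1184,1,46,10,1076,1,1620,6,470,7,1134,13,463,22,782]),(7789,2,[0,1,1,1,6,2004,3,
  771,18,112,6,1580,4,1342,5,520,19,458,5,344,15,181]),(7877,2,[0,1,1,1,17,288,10,504,39,608,12,
  526,9,950,11,120,1,1065,28,196,22,329]),(8009,2,[0,1,1,1,23,529,17,570,2,477,3,54,5,121,6,318,
  4,1740,3,2459,8,13]),(8053,2,[0,1,1,1,53,102,20,149,11,641,8,1344,19,588,34,291,1,729,4,539,1,
  550]),(8273,2,[0,1,1,1,6,990,7,787,17,93,4,437,4,69,34,701,2,1706,3,586,1,2160]),(8317,2,[0,1,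
  1,1,27,85,12,81,27,156,1,289,3,124,4,758,29,1473,24,339,12,481]),(8537,2,[0,1,1,1,2,32,19,
  1263,16,1334,16,527,23,439,19,618,5,459,18,1881,10,519]),(8581,2,[0,1,1,1,8,267,9,417,2,2245,
  9,125,5,246,16,58,1,31,39,1139,1,541]),(8647,2,[0,1,1,1,20,381,15,47,10,1006,4,435,9,390,4,
  840,1,343,3,1749,5,1213]),(8669,2,[0,1,1,1,22,688,15,520,12,1062,1,3159,6,657,2,933,17,90,2,
  231,12,248]),(8713,2,[0,1,1,1,5,489,1,828,16,215,1,588,4,380,2,303,5,1064,3,395,20,349]),
  (8779,2,[0,1,1,1,12,1462,4,673,15,188,13,735,2,409,1,575,9,1166,2,469,9,207]),(8867,2,[0,1,1,
  1,2,1607,17,365,11,72,27,160,34,817,3,159,23,336,35,304,1,2011]),(8933,2,[0,1,1,1,24,99,8,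
  1426,8,323,7,1094,3,250,32,1143,3,705,4,1891,8,235]),(8999,2,[0,1,1,1,22,458,2,2386,5,151,14,
  425,4,650,13,1419,10,388,11,552,17,370])]"

definition extensions_11 :: "extension_table" where
  "extensions_11 = [
  (243,3,[1,1,0,0,0],[0,1],[[[],[1]],[[2,1],[2,2]],[[1,2],[1,0,0,2]],[[0,1,2],[2,0,0,1]],[[1,1],
  [0,0,2]],[[0,2],[0,0,1]],[[2,2],[1,0,0,2]],[[1,2],[0,1,2]],[[2],[1,0,0,2]],[[1,1],[0,2]],[[2],
  [1,0,2]]]),(529,23,[5,0],[2],[[[],[1]],[[1],[1]],[[1,1],[4,5]],[[17,1],[7,5]],[[2,1],[13,5]],
  [[9,1],[14,5]],[[15,1],[17,5]],[[11,1],[22,5]],[[20,1],[15,5]],[[7,1],[11,5]],[[4,1],[3,5]]]),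
  (1024,2,[1,0,0,1,0,0,0,0,0,0],[0,1],[[[],[1]],[[1],[1,0,0,0,1,1,1]],[[1],[1,1,0,0,1]],[[0,0,
  1],[1,1,1,0,1,0,1]],[[1],[0,0,1,1,1]],[[1,0,1],[1,0,0,0,1,1]],[[0,0,0,0,1],[0,1,1,0,1]],[[1,1,
  0,1],[1,0,0,1,0,0,0,1]],[[1],[1,1,0,0,1,0,1]],[[1,0,1,1,0,1],[0,1,1,0,1,1]],[[1,0,1,0,1,1],[1,
  1,1,1,1,1]]]),(1849,43,[2,0],[1,1],[[[],[1]],[[1],[17,11]],[[21],[41,1]],[[1],[8,1]],[[7],[33,
  1]],[[4],[14,8]],[[10],[21,4]],[[17],[11,7]],[[12],[19,3]],[[25],[30,2]],[[38],[9,1]]]),(3125,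
  5,[1,1,0,0,0],[0,1],[[[],[1]],[[2,3],[1,4,0,1]],[[3,1],[2,1,0,1]],[[3],[4,4,0,2]],[[4,2,1],[4,
  1,3,3]],[[0,3],[1,2,3,1]],[[3,1],[4,2,2]],[[3],[3,1]],[[1,1],[4,0,2]],[[3,2],[0,0,1,1]],[[4,
  1],[4,4,3,1]]]),(4489,67,[2,0],[2],[[[],[1]],[[1],[1]],[[10,1],[19,4]],[[2],[4]],[[24,1],[50,
  6]],[[16,1],[51,4]],[[0,1],[50,7]],[[25,1],[59,3]],[[1,1],[5,2]],[[5,1],[6,1]],[[1,1],[42,
  4]]]),(7921,89,[3,0],[2],[[[],[1]],[[1],[1]],[[25,1],[56,19]],[[3,1],[35,33]],[[20,1],[76,
  13]],[[1,1],[57,1]],[[19],[33]],[[2,1],[83,1]],[[1],[13]],[[5],[19]],[[3,1],[4,3]]])]"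

lemma check_primes_11:
  "check_primes 11 [(11, 1)] required_11 2 primes_11"
  by code_simp

lemma check_extensions_11:
  "check_extensions 11 [(11, 1)] required_11 2 extensions_11"
  by code_simp

text \<open>Modulo 23 the eleventh powers are 0, 1 and -1. It takes eleven of them to reach every
  residue, more than any triple with k = 11 offers.\<close>

lemma covers_11:
  "covers ([23] @ map fst extensions_11)
    (int 11) (int 11 + 1) 819 (map fst primes_11)"
  by code_simp

lemma spec_11: "is_spec 11 [(11, 1)]"
  by (rule is_specI) code_simp+

lemma (in finite_subfield) waring_11:
  assumes "11 dvd q - 1" "int q \<notin> set [23]"
  shows "waring 11 (required required_11 2 (int q))"
  using assms by (intro waring_odd[OF _ _ _ spec_11 check_primes_11 check_extensions_11 covers_11])
  (simp_all add: required_11_def)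

section \<open>From finite fields to the algebra generated by a matrix\<close>

definition comaximal :: "'r :: comm_ring_1 \<Rightarrow> 'r \<Rightarrow> bool" where
  "comaximal a b \<longleftrightarrow> (\<exists>u v. u * a + v * b = 1)"

lemma comaximal_mult:
  assumes "comaximal a b" "comaximal a c"
  shows "comaximal a (b * c)"
proof -
  obtain u v where 1: "u * a + v * b = 1" using assms by (auto simp: comaximal_def)
  obtain u' v' where 2: "u' * a + v' * c = 1" using assms by (auto simp: comaximal_def)
  have "(u * a + v * b) * (u' * a + v' * c) = 1" by (simp add: 1 2)
  hence "(u * u' * a + u * v' * c + v * b * u') * a + (v * v') * (b * c) = 1"
    by (simp add: algebra_simps)
  thus ?thesis unfolding comaximal_def by blast
qed

lemma comaximal_power: "comaximal a b \<Longrightarrow> comaximal a (b ^ n)"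
proof (induction n)
  case 0
  show ?case unfolding comaximal_def by (intro exI[of _ 0] exI[of _ 1]) simp
qed (simp add: comaximal_mult)

lemma comaximal_cong:
  assumes "comaximal a b" "b dvd a' - a"
  shows "comaximal a' b"
proof -
  obtain u v where uv: "u * a + v * b = 1" using assms by (auto simp: comaximal_def)
  obtain c where "a' - a = b * c" using assms(2) by blast
  hence a': "a' = a + b * c" by (simp add: algebra_simps)
  have "u * a' + (v - u * c) * b = u * a + v * b" by (simp add: a' algebra_simps)
  with uv show ?thesis unfolding comaximal_def by (intro exI[of _ u] exI[of _ "v - u * c"]) simp
qed

lemma comaximal_dvd:
  assumes "comaximal a b" "c dvd b"
  shows "comaximal a c"
proof -
  obtain u v where uv: "u * a + v * b = 1" using assms by (auto simp: comaximal_def)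
  obtain d where "b = c * d" using assms(2) by blast
  with uv show ?thesis unfolding comaximal_def
    by (intro exI[of _ u] exI[of _ "v * d"]) (simp add: mult_ac)
qed

lemma comaximal_mult_dvd:
  assumes "comaximal f g" "f dvd z" "g dvd z"
  shows "f * g dvd z"
proof -
  obtain u v where uv: "u * f + v * g = 1" using assms by (auto simp: comaximal_def)
  have "z = (u * f + v * g) * z" by (simp add: uv)
  also have "\<dots> = u * (f * z) + v * (z * g)" by (simp add: algebra_simps)
  also have "f * g dvd \<dots>" using assms(2,3) by (intro dvd_add dvd_mult mult_dvd_mono) auto
  finally show ?thesis .
qed

lemma diff_dvd_power_diff: "(a - b :: 'r :: comm_ring_1) dvd a ^ n - b ^ n"
  unfolding power_diff_sumr2 by (rule dvd_triv_left)

lemma power_add_expand: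
  "\<exists>w. (y + h :: 'r :: comm_ring_1) ^ Suc n = y ^ Suc n + of_nat (Suc n) * y ^ n * h + h ^ 2 * w"
proof (induction n)
  case (Suc n)
  then obtain w where w: "(y + h) ^ Suc n = y ^ Suc n + of_nat (Suc n) * y ^ n * h + h ^ 2 * w" by blast
  have "(y + h) ^ Suc (Suc n) = y ^ Suc (Suc n) + of_nat (Suc (Suc n)) * y ^ Suc n * h
      + h ^ 2 * (of_nat (Suc n) * y ^ n + w * (y + h))"
    by (subst power_Suc, subst w) (simp add: algebra_simps power2_eq_square)
  thus ?case by blast
qed (auto intro: exI[of _ 0])

text \<open>Newton iteration: y and k are invertible modulo f, hence so is the derivative k y^(k-1).
  A solution modulo f^(e+1) is corrected by a multiple of f^(e+1), whose square vanishes modulo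
  f^(e+2).\<close>

lemma hensel_power:
  fixes f c y \<kappa> :: "'r :: comm_ring_1"
  assumes f: "f dvd c - y ^ k" and y: "comaximal y f" and k: "0 < k" "\<kappa> * of_nat k = 1"
  shows "\<exists>y'. f ^ Suc e dvd c - y' ^ k \<and> f dvd y' - y"
proof (induction e)
  case 0
  show ?case using f by (intro exI[of _ y]) auto
next
  case (Suc e)
  then obtain z where z: "f ^ Suc e dvd c - z ^ k" "f dvd z - y" by blast
  obtain r where r: "c - z ^ k = f ^ Suc e * r" using z(1) by blast
  obtain n where n: "k = Suc n" using k(1) by (cases k) auto
  from comaximal_cong[OF y z(2)] obtain u v where uv: "u * z + v * f = 1"
    by (auto simp: comaximal_def)
  \<comment> \<open>u inverts z modulo f and \<kappa> inverts k, so k z^n t is congruent to r modulo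
    f and cancels the error f^(e+1) r.\<close>
  define t where "t = \<kappa> * u ^ n * r"
  obtain w where w: "(z + f ^ Suc e * t) ^ k
      = z ^ k + of_nat k * z ^ n * (f ^ Suc e * t) + (f ^ Suc e * t) ^ 2 * w"
    using power_add_expand[of z "f ^ Suc e * t" n] unfolding n by blast
  have "of_nat k * z ^ n * t = (\<kappa> * of_nat k) * (u * z) ^ n * r"
    by (simp add: t_def power_mult_distrib mult_ac)
  hence kt: "of_nat k * z ^ n * t = (u * z) ^ n * r" by (simp add: k(2))
  have "u * z - 1 = f * (- v)" using uv by (simp add: algebra_simps)
  hence "f dvd u * z - 1" by simp
  hence "f dvd (u * z) ^ n - 1 ^ n" using diff_dvd_power_diff dvd_trans by blast
  then obtain b where "(u * z) ^ n - 1 ^ n = f * b" by blast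
  hence b: "(u * z) ^ n = 1 + f * b" by (simp add: algebra_simps)
  have "c - (z + f ^ Suc e * t) ^ k = f ^ Suc e * (r - of_nat k * z ^ n * t) - (f ^ Suc e * t) ^ 2 * w"
    using r unfolding w by (simp add: algebra_simps)
  also have "\<dots> = f ^ Suc (Suc e) * (- b * r - f ^ e * t ^ 2 * w)"
    unfolding kt b by (simp add: algebra_simps power2_eq_square)
  finally have "f ^ Suc (Suc e) dvd c - (z + f ^ Suc e * t) ^ k" by simp
  moreover have "f dvd (z + f ^ Suc e * t) - y"
    using dvd_add[OF z(2), of "f ^ Suc e * t"] by (simp add: algebra_simps)
  ultimately show ?case by blast
qed

text \<open>The unit \<open>P 0\<close> is what makes Hensel lifting possible.\<close>

definition waring_mod :: "nat \<Rightarrow> nat \<Rightarrow> 'r :: comm_ring_1 \<Rightarrow> 'r \<Rightarrow> bool" where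
  "waring_mod k m x f \<longleftrightarrow> (\<exists>P :: nat \<Rightarrow> 'r. comaximal (P 0) f \<and> f dvd x - (\<Sum>i<m. P i ^ k))"

lemma waring_mod_dvd: "waring_mod k m x g \<Longrightarrow> f dvd g \<Longrightarrow> waring_mod k m x f"
  unfolding waring_mod_def by (meson comaximal_dvd dvd_trans)

text \<open>Only the summand with index 0 is lifted. The others are kept and enter the constant c
  whose k-th root is sought.\<close>

lemma waring_mod_power:
  fixes x f \<kappa> :: "'r :: comm_ring_1"
  assumes "waring_mod k m x f" "0 < k" "\<kappa> * of_nat k = 1" "0 < m"
  shows "waring_mod k m x (f ^ e)"
proof -
  obtain P where P: "comaximal (P 0) f" "f dvd x - (\<Sum>i<m. P i ^ k)"
    using assms(1) by (auto simp: waring_mod_def)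
  obtain m' where m: "m = Suc m'" using assms(4) by (cases m) auto
  define c where "c = x - (\<Sum>i<m'. P (Suc i) ^ k)"
  have "f dvd c - P 0 ^ k"
    using P(2) unfolding m c_def by (subst (asm) sum.lessThan_Suc_shift) (simp add: algebra_simps)
  from hensel_power[OF this P(1) assms(2,3), of e] obtain y where
    y: "f ^ Suc e dvd c - y ^ k" "f dvd y - P 0" by blast
  have "comaximal ((P(0 := y)) 0) (f ^ Suc e)"
    using comaximal_power[OF comaximal_cong[OF P(1) y(2)], of "Suc e"] by (simp del: power_Suc)
  moreover have "x - (\<Sum>i<m. (P(0 := y)) i ^ k) = c - y ^ k"
    unfolding m c_def by (subst sum.lessThan_Suc_shift) (simp add: algebra_simps)
  ultimately have "waring_mod k m x (f ^ Suc e)"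
    using y(1) unfolding waring_mod_def by (intro exI[of _ "P(0 := y)"]) (simp only: simp_thms)
  thus ?thesis by (rule waring_mod_dvd) simp
qed

lemma waring_mod_mult:
  assumes "waring_mod k m x f" "waring_mod k m x g" "comaximal f g"
  shows "waring_mod k m x (f * g)"
proof -
  obtain P where P: "comaximal (P 0) f" "f dvd x - (\<Sum>i<m. P i ^ k)"
    using assms(1) by (auto simp: waring_mod_def)
  obtain R where R: "comaximal (R 0) g" "g dvd x - (\<Sum>i<m. R i ^ k)"
    using assms(2) by (auto simp: waring_mod_def)
  obtain u v where uv: "u * f + v * g = 1" using assms(3) by (auto simp: comaximal_def)
  \<comment> \<open>v g is 1 modulo f and 0 modulo g, and u f the reverse, so S agrees with P modulo
    f and with R modulo g.\<close>
  define S where "S = (\<lambda>i. P i * v * g + R i * u * f)"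
  have SP: "f dvd S i - P i" for i
  proof -
    have "v * g = 1 - u * f" using uv by (simp add: algebra_simps)
    hence "S i - P i = f * (R i * u - P i * u)" by (simp add: S_def mult.assoc) (simp add: algebra_simps)
    thus ?thesis by simp
  qed
  have SR: "g dvd S i - R i" for i
  proof -
    have "u * f = 1 - v * g" using uv by (simp add: algebra_simps)
    hence "S i - R i = g * (P i * v - R i * v)" by (simp add: S_def mult.assoc) (simp add: algebra_simps)
    thus ?thesis by simp
  qed
  have lift: "h dvd x - (\<Sum>i<m. S i ^ k)" if "\<And>i. h dvd S i - T i" "h dvd x - (\<Sum>i<m. T i ^ k)" for h T
  proof -
    have "h dvd S i ^ k - T i ^ k" for i using that(1) diff_dvd_power_diff dvd_trans by blast
    hence "h dvd (\<Sum>i<m. S i ^ k - T i ^ k)" by (intro dvd_sum)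
    with that(2) have "h dvd x - (\<Sum>i<m. T i ^ k) - (\<Sum>i<m. S i ^ k - T i ^ k)" by (rule dvd_diff)
    thus ?thesis by (simp add: sum_subtractf)
  qed
  have "f * g dvd x - (\<Sum>i<m. S i ^ k)"
    by (intro comaximal_mult_dvd assms(3) lift[OF SP P(2)] lift[OF SR R(2)])
  moreover have "comaximal (S 0) (f * g)"
    by (intro comaximal_mult comaximal_cong[OF P(1) SP] comaximal_cong[OF R(1) SR])
  ultimately show ?thesis unfolding waring_mod_def by blast
qed

section \<open>Residue fields inside the algebraic closure\<close>

definition ac_eval :: "'a :: field alg_closure \<Rightarrow> 'a poly \<Rightarrow> 'a alg_closure" where
  "ac_eval \<alpha> P = poly (map_poly to_ac P) \<alpha>"

lemma ac_eval_pCons [simp]: "ac_eval \<alpha> 0 = 0" "ac_eval \<alpha> (pCons c P) = to_ac c + \<alpha> * ac_eval \<alpha> P"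
  by (simp_all add: ac_eval_def map_poly_pCons)

lemma ac_eval_add: "ac_eval \<alpha> (P + R) = ac_eval \<alpha> P + ac_eval \<alpha> R"
  by (induction P R rule: poly_induct2) (simp_all add: algebra_simps)

lemma ac_eval_smult: "ac_eval \<alpha> (Polynomial.smult c P) = to_ac c * ac_eval \<alpha> P"
  by (induction P) (simp_all add: algebra_simps)

lemma ac_eval_mult: "ac_eval \<alpha> (P * R) = ac_eval \<alpha> P * ac_eval \<alpha> R"
  by (induction P) (simp_all add: ac_eval_add ac_eval_smult algebra_simps)

lemma ac_eval_diff: "ac_eval \<alpha> (P - R) = ac_eval \<alpha> P - ac_eval \<alpha> R"
  using ac_eval_add[of \<alpha> "P - R" R] by (simp add: algebra_simps)

lemma ac_eval_1 [simp]: "ac_eval \<alpha> 1 = 1"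
  by (simp add: one_pCons)

lemma ac_eval_power: "ac_eval \<alpha> (P ^ n) = ac_eval \<alpha> P ^ n"
  by (induction n) (simp_all add: ac_eval_mult)

lemma ac_eval_sum: "ac_eval \<alpha> (sum P I) = (\<Sum>i\<in>I. ac_eval \<alpha> (P i))"
  by (induction I rule: infinite_finite_induct) (simp_all add: ac_eval_add)

lemma finite_bounded_polys: "finite {P :: 'a :: {comm_ring_1, finite} poly. degree P < n}"
proof (rule finite_subset)
  show "{P :: 'a poly. degree P < n} \<subseteq> Poly ` {xs. set xs \<subseteq> UNIV \<and> length xs \<le> n}"
  proof
    fix P :: "'a poly" assume "P \<in> {P. degree P < n}"
    hence "length (coeffs P) \<le> n" by (cases "P = 0") (auto simp: length_coeffs_degree)
    thus "P \<in> Poly ` {xs. set xs \<subseteq> UNIV \<and> length xs \<le> n}"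
      by (intro image_eqI[of _ _ "coeffs P"]) auto
  qed
  show "finite (Poly ` {xs :: 'a list. set xs \<subseteq> UNIV \<and> length xs \<le> n})"
    by (intro finite_imageI finite_lists_length_le) simp
qed

lemma minimal_polynomial:
  fixes f :: "'a :: field poly"
  assumes "f \<noteq> 0" "ac_eval \<alpha> f = 0"
  obtains p where "p \<noteq> 0" "0 < degree p" "\<And>R. ac_eval \<alpha> R = 0 \<longleftrightarrow> p dvd R"
proof -
  define p where "p = (ARG_MIN degree P. P \<noteq> 0 \<and> ac_eval \<alpha> P = 0)"
  have p: "p \<noteq> 0" "ac_eval \<alpha> p = 0"
    using arg_min_natI[of "\<lambda>P. P \<noteq> 0 \<and> ac_eval \<alpha> P = 0" f degree] assms by (auto simp: p_def)
  have min: "degree p \<le> degree P" if "P \<noteq> 0" "ac_eval \<alpha> P = 0" for P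
    using arg_min_nat_le[of "\<lambda>P. P \<noteq> 0 \<and> ac_eval \<alpha> P = 0" P degree] that by (auto simp: p_def)
  have dvd: "p dvd R" if "ac_eval \<alpha> R = 0" for R
  proof -
    have "ac_eval \<alpha> (R mod p) = 0"
      using that p(2) by (simp add: minus_mult_div_eq_mod[symmetric] ac_eval_diff ac_eval_mult)
    hence "R mod p = 0" using min[of "R mod p"] degree_mod_less[OF p(1), of R] by linarith
    thus ?thesis by (rule mod_0_imp_dvd)
  qed
  have zero: "ac_eval \<alpha> R = 0" if "p dvd R" for R
    using that p(2) by (auto simp: ac_eval_mult)
  have deg: "0 < degree p"
  proof (rule gr0I)
    assume "degree p = 0"
    then obtain c where "p = [:c:]" by (rule degree_eq_zeroE)
    with p show False by simp
  qed
  show thesis by (rule that[OF p(1) deg], rule iffI, erule dvd, erule zero)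
qed

text \<open>Division by f leaves finitely many polynomials that already give all values at \<alpha>,
  and a finite subring of a field is a field. It contains F_q, so its size is a power of q.\<close>

lemma finite_subfield_range_ac_eval:
  fixes f :: "'a :: {field, finite} poly"
  assumes "f \<noteq> 0" "ac_eval \<alpha> f = 0"
  shows "finite_subfield (range (ac_eval \<alpha>))" "\<exists>e. card (range (ac_eval \<alpha>)) = CARD('a) ^ e"
proof -
  have "range (ac_eval \<alpha>) \<subseteq> ac_eval \<alpha> ` {P. degree P < Suc (degree f)}"
  proof safe
    fix P
    have "ac_eval \<alpha> P = ac_eval \<alpha> (f * (P div f) + P mod f)" by simp
    also have "\<dots> = ac_eval \<alpha> (P mod f)"
      by (simp only: ac_eval_add ac_eval_mult assms(2)) simp
    finally have "ac_eval \<alpha> P = ac_eval \<alpha> (P mod f)" .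
    moreover have "degree (P mod f) < Suc (degree f)"
      using degree_mod_less[OF assms(1), of P] by auto
    ultimately show "ac_eval \<alpha> P \<in> ac_eval \<alpha> ` {P. degree P < Suc (degree f)}" by blast
  qed
  hence fin: "finite (range (ac_eval \<alpha>))"
    using finite_bounded_polys finite_imageI finite_subset by blast
  show K: "finite_subfield (range (ac_eval \<alpha>))"
  proof
    show "0 \<in> range (ac_eval \<alpha>)" by (metis ac_eval_pCons(1) rangeI)
    show "1 \<in> range (ac_eval \<alpha>)" by (metis ac_eval_1 rangeI)
    show "x - y \<in> range (ac_eval \<alpha>)" "x * y \<in> range (ac_eval \<alpha>)"
      if "x \<in> range (ac_eval \<alpha>)" "y \<in> range (ac_eval \<alpha>)" for x y
      using that by (auto simp flip: ac_eval_diff ac_eval_mult)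
  qed (rule fin)
  have sub: "range to_ac \<subseteq> range (ac_eval \<alpha>)"
  proof safe
    fix c
    have "to_ac c = ac_eval \<alpha> [:c:]" by simp
    thus "to_ac c \<in> range (ac_eval \<alpha>)" by blast
  qed
  have "finite_subfield (range (to_ac :: 'a \<Rightarrow> _))"
  proof
    show "0 \<in> range (to_ac :: 'a \<Rightarrow> _)" "1 \<in> range (to_ac :: 'a \<Rightarrow> _)"
      by (metis to_ac_0 rangeI, metis to_ac_1 rangeI)
    show "x - y \<in> range to_ac" "x * y \<in> range to_ac"
      if "x \<in> range to_ac" "y \<in> range to_ac" for x y :: "'a alg_closure"
      using that by (auto simp flip: to_ac_diff to_ac_mult)
  qed simp
  from finite_subfield.card_power_of_subfield[OF K this sub]
  show "\<exists>e. card (range (ac_eval \<alpha>)) = CARD('a) ^ e"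
    by (simp add: card_image[OF inj_to_ac] finite_subfield.q_def[OF K])
qed

text \<open>A nonzero term is moved to index 0, where \<open>waring_mod\<close> expects the unit;
  beyond \<open>m\<close> the function is filled with zeros to stay in \<open>K\<close>.\<close>

lemma waring_function:
  assumes "finite_subfield K" "finite_subfield.waring K k m" "a \<in> K"
  shows "\<exists>y :: nat \<Rightarrow> 'b :: field. (\<forall>i. y i \<in> K) \<and> y 0 \<noteq> 0 \<and> a = (\<Sum>i<m. y i ^ k)"
proof -
  interpret finite_subfield K by fact
  obtain xs x where xs: "set xs \<subseteq> K" "length xs = m" "x \<in> set xs" "x \<noteq> 0" "a = (\<Sum>x\<leftarrow>xs. x ^ k)"
    using assms(2,3) unfolding waring_def by blast
  obtain ys zs where yz: "xs = ys @ x # zs" using xs(3) split_list by metis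
  define ws where "ws = x # ys @ zs"
  have ws: "set ws \<subseteq> K" "length ws = m" "a = (\<Sum>x\<leftarrow>ws. x ^ k)"
    using xs by (auto simp: ws_def yz algebra_simps)
  define y where "y = (\<lambda>i. if i < m then ws ! i else 0)"
  have "a = (\<Sum>i<m. ws ! i ^ k)"
    using ws(2,3) by (simp add: sum_list_sum_nth atLeast0LessThan)
  hence "a = (\<Sum>i<m. y i ^ k)" by (simp add: y_def)
  moreover have "y i \<in> K" for i using ws zero_K by (auto simp: y_def subset_iff)
  moreover have "y 0 \<noteq> 0" using ws(2) xs(4) by (auto simp: y_def ws_def)
  ultimately show ?thesis by blast
qed

text \<open>Distinct irreducible factors, found as minimal polynomials of roots of f, are collected
  in g by the Chinese remainder theorem, while multiplicities are left to an exponent e with f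
  dividing g^e. So Hensel lifting is applied once, at the end.\<close>

theorem waring_polynomial:
  fixes f :: "'a :: {field, finite} poly"
  assumes W: "\<And>(K :: 'a alg_closure set) e. finite_subfield K \<Longrightarrow> card K = CARD('a) ^ e \<Longrightarrow>
      finite_subfield.waring K k m"
    and k: "0 < k" "of_nat k \<noteq> (0 :: 'a)" and m: "0 < m" and f: "f \<noteq> 0"
  shows "waring_mod k m [:0, 1:] f"
proof -
  have unit: "[:inverse (of_nat k):] * of_nat k = (1 :: 'a poly)"
    using k(2) by (simp add: of_nat_poly one_pCons)
  have "\<exists>g e. waring_mod k m [:0, 1:] g \<and> f dvd g ^ e"
    using f
  proof (induction "degree f" arbitrary: f rule: less_induct)
    case less
    show ?case
    proof (cases "degree f = 0")
      case True
      hence "f dvd 1" using less.prems is_unit_iff_degree by blast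
      \<comment> \<open>Modulo 1 even zero is a unit and every congruence holds.\<close>
      moreover have "waring_mod k m [:0, 1:] (1 :: 'a poly)"
        unfolding waring_mod_def comaximal_def
        by (intro exI[of _ "\<lambda>_. 0"] conjI exI[of _ 0] exI[of _ 1]) simp_all
      ultimately show ?thesis by (intro exI[of _ 1] exI[of _ 0]) simp
    next
      case False
      have "degree (map_poly to_ac f) = degree f" by (intro degree_map_poly) simp
      with False obtain \<alpha> where \<alpha>: "ac_eval \<alpha> f = 0"
        using alg_closed_imp_poly_has_root[of "map_poly to_ac f"] by (auto simp: ac_eval_def)
      obtain p where p: "p \<noteq> 0" "0 < degree p" "\<And>R. ac_eval \<alpha> R = 0 \<longleftrightarrow> p dvd R"
        using minimal_polynomial[OF less.prems \<alpha>] by blast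
      note K = finite_subfield_range_ac_eval[OF less.prems \<alpha>]
      \<comment> \<open>A nonzero value at \<alpha> has its inverse in the range as well, and a
        preimage of it inverts R modulo p.\<close>
      have comax: "comaximal R p" if "ac_eval \<alpha> R \<noteq> 0" for R
      proof -
        have "inverse (ac_eval \<alpha> R) \<in> range (ac_eval \<alpha>)"
          by (rule finite_subfield.inverse_K[OF K(1)]) simp
        then obtain U where "ac_eval \<alpha> U = inverse (ac_eval \<alpha> R)" by force
        hence "ac_eval \<alpha> (1 - U * R) = 0" using that by (simp add: ac_eval_diff ac_eval_mult)
        then obtain V where "1 - U * R = p * V" using p(3) by blast
        hence "U * R + V * p = 1" by (simp add: algebra_simps)
        thus ?thesis unfolding comaximal_def by blast
      qed
      have waring_p: "waring_mod k m [:0, 1:] p"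
      proof -
        obtain e where "card (range (ac_eval \<alpha>)) = CARD('a) ^ e" using K(2) by blast
        from waring_function[OF K(1) W[OF K(1) this], of "ac_eval \<alpha> [:0, 1:]"]
        obtain y where y: "\<forall>i. y i \<in> range (ac_eval \<alpha>)" "y 0 \<noteq> 0"
          "ac_eval \<alpha> [:0, 1:] = (\<Sum>i<m. y i ^ k)" by blast
        from y(1) have "\<forall>i. \<exists>P. y i = ac_eval \<alpha> P" by blast
        then obtain P where P: "\<And>i. y i = ac_eval \<alpha> (P i)" by metis
        have "ac_eval \<alpha> ([:0, 1:] - (\<Sum>i<m. P i ^ k)) = 0"
          using y(3) by (simp add: P ac_eval_diff ac_eval_sum ac_eval_power del: ac_eval_pCons)
        hence "p dvd [:0, 1:] - (\<Sum>i<m. P i ^ k)" using p(3) by blast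
        moreover have "comaximal (P 0) p" using comax y(2) P by metis
        ultimately show ?thesis unfolding waring_mod_def by blast
      qed
      obtain f' where f': "f = p * f'" using p(3) \<alpha> by blast
      hence "degree f' < degree f" "f' \<noteq> 0"
        using less.prems p(2) by (auto simp: degree_mult_eq)
      then obtain g e where g: "waring_mod k m [:0, 1:] g" "f' dvd g ^ e" using less.hyps by blast
      show ?thesis
      proof (cases "p dvd g")
        case True
        hence "f dvd g ^ Suc e" unfolding f' using g(2) by (simp add: mult_dvd_mono)
        with g(1) show ?thesis by blast
      next
        case False
        hence "comaximal g p" using comax p(3) by blast
        hence "waring_mod k m [:0, 1:] (g * p)" by (intro waring_mod_mult g(1) waring_p)
        moreover have "f dvd (g * p) ^ Suc e"
        proof -
          have "p * f' dvd (g * p) * (g * p) ^ e"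
            by (intro mult_dvd_mono) (auto simp: power_mult_distrib g(2))
          thus ?thesis by (simp add: f')
        qed
        ultimately show ?thesis by blast
      qed
    qed
  qed
  thus ?thesis using waring_mod_power[OF _ k(1) unit m] waring_mod_dvd by blast
qed

section \<open>Evaluation of polynomials at a square matrix\<close>

fun mat_eval_list :: "'a :: comm_ring_1 mat \<Rightarrow> 'a list \<Rightarrow> 'a mat" where
  "mat_eval_list A [] = 0\<^sub>m (dim_row A) (dim_row A)"
| "mat_eval_list A (c # cs) = c \<cdot>\<^sub>m 1\<^sub>m (dim_row A) + mat_eval_list A cs * A"

text \<open>Horner evaluation, which fits induction over \<open>pCons\<close>. Square matrices of a
  given size are a carrier set and not a type, so the homomorphism laws are proved under carrier
  conditions.\<close>

definition mat_eval :: "'a :: comm_ring_1 mat \<Rightarrow> 'a poly \<Rightarrow> 'a mat" where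
  "mat_eval A P = mat_eval_list A (coeffs P)"

context
  fixes A :: "'a :: comm_ring_1 mat" and n :: nat
  assumes A: "A \<in> carrier_mat n n"
begin

lemma mat_eval_carrier [simp]: "mat_eval A P \<in> carrier_mat n n"
proof -
  have "mat_eval_list A cs \<in> carrier_mat n n" for cs
    using A by (induction cs) auto
  thus ?thesis by (simp add: mat_eval_def)
qed

lemma mat_eval_0 [simp]: "mat_eval A 0 = 0\<^sub>m n n"
  using A by (simp add: mat_eval_def)

lemma mat_eval_pCons: "mat_eval A (pCons c P) = c \<cdot>\<^sub>m 1\<^sub>m n + mat_eval A P * A"
proof (cases "c = 0 \<and> P = 0")
  case True
  have "(0 :: 'a) \<cdot>\<^sub>m 1\<^sub>m n + 0\<^sub>m n n * A = 0\<^sub>m n n" using A by (intro eq_matI) auto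
  thus ?thesis using True by simp
next
  case False
  thus ?thesis using A by (auto simp: mat_eval_def cCons_def)
qed

lemma carrier_mult_A: "X \<in> carrier_mat n n \<Longrightarrow> X * A \<in> carrier_mat n n"
  using A by auto

text \<open>Splitting off the constant term and factoring out A on the right is one step of the
  Horner recursion.\<close>

lemma poly_mat_eq_mat_eval: "poly_mat P A = mat_eval A P"
proof -
  interpret R: ring "ring_mat TYPE('a) n ()" by (rule ring_mat)
  note rm = ring_mat_simps[of "TYPE('a)" n "()"]
  define f where "f = (\<lambda>P i. Polynomial.coeff P i \<cdot>\<^sub>m (A ^\<^sub>m i))"
  have fc: "f P \<in> I \<rightarrow> carrier (ring_mat TYPE('a) n ())" for P I
    using A by (auto simp: f_def rm)
  have "finsum (ring_mat TYPE('a) n ()) (f P) {..Polynomial.degree P} = mat_eval A P"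
  proof (induction P)
    case 0
    show ?case using A fc[of 0 "{..0}"] by (auto simp: rm f_def intro!: eq_matI)
  next
    case (pCons c P)
    show ?case
    proof (cases "P = 0")
      case True
      have "c \<cdot>\<^sub>m 1\<^sub>m n + 0\<^sub>m n n * A = c \<cdot>\<^sub>m 1\<^sub>m n" using A by (intro eq_matI) auto
      thus ?thesis using True A fc[of "[:c:]" "{..0}"]
        by (simp add: rm f_def mat_eval_pCons)
    next
      case False
      have "finsum (ring_mat TYPE('a) n ()) (f (pCons c P)) {..Polynomial.degree (pCons c P)}
          = finsum (ring_mat TYPE('a) n ()) (\<lambda>i. f (pCons c P) (Suc i)) {..Polynomial.degree P} + f (pCons c P) 0"
        using R.finsum_Suc2[OF fc[of "pCons c P"]] False by (simp add: rm)
      also have "finsum (ring_mat TYPE('a) n ()) (\<lambda>i. f (pCons c P) (Suc i)) {..Polynomial.degree P}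
          = finsum (ring_mat TYPE('a) n ()) (\<lambda>i. f P i * A) {..Polynomial.degree P}"
        using A by (intro R.finsum_cong') (auto simp: f_def rm mult_smult_assoc_mat[of _ n n])
      also have "\<dots> = finsum (ring_mat TYPE('a) n ()) (f P) {..Polynomial.degree P} * A"
        using R.finsum_ldistr[OF _ _ fc, of "{..Polynomial.degree P}" A P] A by (simp add: rm)
      also have "finsum (ring_mat TYPE('a) n ()) (f P) {..Polynomial.degree P} = mat_eval A P"
        by (rule pCons.IH)
      also have "mat_eval A P * A + f (pCons c P) 0 = mat_eval A (pCons c P)"
        using A carrier_mult_A[OF mat_eval_carrier, of P]
        by (simp add: mat_eval_pCons f_def comm_add_mat[of _ n n])
      finally show ?thesis .
    qed
  qed
  thus ?thesis using A by (simp add: poly_mat_def f_def)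
qed

lemma mat_eval_add: "mat_eval A (P + R) = mat_eval A P + mat_eval A R"
proof (induction P R rule: poly_induct2)
  case (pCons c P d R)
  have "(c + d) \<cdot>\<^sub>m 1\<^sub>m n + (X + Y) * A = (c \<cdot>\<^sub>m 1\<^sub>m n + X * A) + (d \<cdot>\<^sub>m 1\<^sub>m n + Y * A)"
    if "X \<in> carrier_mat n n" "Y \<in> carrier_mat n n" for X Y
    using A that carrier_mult_A
    by (subst add_mult_distrib_mat[of _ n n _ _ n]) (auto intro!: eq_matI simp: algebra_simps)
  thus ?case by (simp add: mat_eval_pCons pCons)
qed simp

lemma mat_eval_smult: "mat_eval A (Polynomial.smult c P) = c \<cdot>\<^sub>m mat_eval A P"
proof (induction P)
  case (pCons d P)
  have "(c * d) \<cdot>\<^sub>m 1\<^sub>m n + (c \<cdot>\<^sub>m X) * A = c \<cdot>\<^sub>m (d \<cdot>\<^sub>m 1\<^sub>m n + X * A)"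
    if "X \<in> carrier_mat n n" for X
    using A that carrier_mult_A
    by (subst mult_smult_assoc_mat[of _ n n _ n]) (auto intro!: eq_matI simp: algebra_simps)
  thus ?case by (simp add: mat_eval_pCons pCons)
qed (auto intro!: eq_matI)

lemma mat_eval_commute: "A * mat_eval A P = mat_eval A P * A"
proof (induction P)
  case 0
  show ?case using A by simp
next
  case (pCons c P)
  define X where "X = mat_eval A P"
  have X: "X \<in> carrier_mat n n" by (simp add: X_def)
  have "A * (c \<cdot>\<^sub>m 1\<^sub>m n + X * A) = A * (c \<cdot>\<^sub>m 1\<^sub>m n) + A * (X * A)"
    using A carrier_mult_A[OF X] by (intro mult_add_distrib_mat[of _ n n _ n]) auto
  also have "A * (X * A) = (A * X) * A" using A X by (intro assoc_mult_mat[symmetric])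
  also have "A * X = X * A" using pCons by (simp add: X_def)
  also have "A * (c \<cdot>\<^sub>m 1\<^sub>m n) = (c \<cdot>\<^sub>m 1\<^sub>m n) * A"
    using A by (simp add: mult_smult_distrib[of _ n n _ n] mult_smult_assoc_mat[of _ n n _ n])
  also have "(c \<cdot>\<^sub>m 1\<^sub>m n) * A + (X * A) * A = (c \<cdot>\<^sub>m 1\<^sub>m n + X * A) * A"
    using A carrier_mult_A[OF X] by (intro add_mult_distrib_mat[symmetric, of _ n n _ _ n]) auto
  finally show ?case by (simp add: mat_eval_pCons X_def)
qed

lemma mat_eval_mult: "mat_eval A (P * R) = mat_eval A P * mat_eval A R"
proof (induction P)
  case 0
  show ?case by (simp add: left_mult_zero_mat[of _ n n])
next
  case (pCons c P)
  define X Y where "X = mat_eval A P" and "Y = mat_eval A R"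
  have XY: "X \<in> carrier_mat n n" "Y \<in> carrier_mat n n" by (simp_all add: X_def Y_def)
  have XYc: "(X * Y) * A \<in> carrier_mat n n" using A XY by auto
  have "mat_eval A (pCons c P * R) = c \<cdot>\<^sub>m Y + (0 \<cdot>\<^sub>m 1\<^sub>m n + (X * Y) * A)"
    by (simp add: mat_eval_add mat_eval_smult mat_eval_pCons pCons X_def Y_def)
  also have "0 \<cdot>\<^sub>m 1\<^sub>m n + (X * Y) * A = (X * Y) * A"
  proof -
    have "(0 :: 'a) \<cdot>\<^sub>m 1\<^sub>m n = 0\<^sub>m n n" by (intro eq_matI) auto
    thus ?thesis using XYc by simp
  qed
  also have "(X * Y) * A = X * (Y * A)" using A XY by (intro assoc_mult_mat)
  also have "Y * A = A * Y" unfolding Y_def by (rule mat_eval_commute[symmetric])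
  also have "X * (A * Y) = (X * A) * Y" using A XY by (intro assoc_mult_mat[symmetric])
  also have "c \<cdot>\<^sub>m Y = (c \<cdot>\<^sub>m 1\<^sub>m n) * Y"
    using XY by (simp add: mult_smult_assoc_mat[of _ n n _ n])
  also have "(c \<cdot>\<^sub>m 1\<^sub>m n) * Y + (X * A) * Y = (c \<cdot>\<^sub>m 1\<^sub>m n + X * A) * Y"
    using XY carrier_mult_A[OF XY(1)] by (intro add_mult_distrib_mat[symmetric, of _ n n _ _ n]) auto
  finally show ?case by (simp add: mat_eval_pCons X_def Y_def)
qed

lemma mat_eval_1: "mat_eval A 1 = 1\<^sub>m n"
proof -
  have "mat_eval A (pCons 1 0) = 1\<^sub>m n" using A by (subst mat_eval_pCons) auto
  thus ?thesis by (simp add: one_pCons)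
qed

lemma mat_eval_power: "mat_eval A (P ^ k) = mat_eval A P ^\<^sub>m k"
proof (induction k)
  case 0
  show ?case using mat_eval_1 by (simp add: carrier_matD[OF mat_eval_carrier])
next
  case (Suc k)
  thus ?case by (simp only: power_Suc2 mat_eval_mult pow_mat.simps)
qed

lemma mat_eval_X: "mat_eval A [:0, 1:] = A"
  using A by (simp add: mat_eval_pCons) (auto intro!: eq_matI)

lemma mat_eval_sum:
  "finite I \<Longrightarrow> mat_eval A (\<Sum>i\<in>I. P i) = finsum (ring_mat TYPE('a) n ()) (\<lambda>i. mat_eval A (P i)) I"
proof (induction I rule: finite_induct)
  case empty
  interpret ring "ring_mat TYPE('a) n ()" by (rule ring_mat)
  show ?case by (simp add: ring_mat_simps)
next
  case (insert i I)
  interpret ring "ring_mat TYPE('a) n ()" by (rule ring_mat)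
  show ?case using insert by (simp add: ring_mat_simps mat_eval_add)
qed

end

lemma finite_carrier_mat: "finite (carrier_mat n n :: 'a :: finite mat set)"
proof (rule finite_subset)
  show "carrier_mat n n \<subseteq> (\<lambda>f. mat n n f) ` (({..<n} \<times> {..<n}) \<rightarrow>\<^sub>E (UNIV :: 'a set))"
  proof
    fix B :: "'a mat" assume B: "B \<in> carrier_mat n n"
    define f where "f = (\<lambda>ij. if ij \<in> {..<n} \<times> {..<n} then B $$ ij else undefined)"
    have "B = mat n n f" using B by (intro eq_matI) (auto simp: f_def)
    moreover have "f \<in> ({..<n} \<times> {..<n}) \<rightarrow>\<^sub>E UNIV" by (auto simp: f_def PiE_def extensional_def)
    ultimately show "B \<in> (\<lambda>f. mat n n f) ` (({..<n} \<times> {..<n}) \<rightarrow>\<^sub>E UNIV)"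
      by (rule image_eqI[where f = "\<lambda>f. mat n n f"])
  qed
  show "finite ((\<lambda>f. mat n n f) ` (({..<n} \<times> {..<n}) \<rightarrow>\<^sub>E (UNIV :: 'a set)))"
    by (intro finite_imageI finite_PiE) auto
qed

text \<open>The powers of A lie in a finite set, so two of them agree, and x^i - x^j annihilates
  A.\<close>

lemma annihilating_polynomial:
  fixes A :: "'a :: {field, finite} mat"
  assumes A: "A \<in> carrier_mat n n"
  obtains f where "f \<noteq> 0" "mat_eval A f = 0\<^sub>m n n"
proof -
  define M where "M = (\<lambda>i. mat_eval A ([:0, 1:] ^ i))"
  have "M ` UNIV \<subseteq> carrier_mat n n" using A by (auto simp: M_def)
  hence "finite (range M)" using finite_carrier_mat finite_subset by blast
  hence "\<not> inj M" using finite_imageD infinite_UNIV_nat by blast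
  then obtain i j where ij: "M i = M j" "i \<noteq> j" by (auto simp: inj_def)
  define f :: "'a poly" where "f = [:0, 1:] ^ i + Polynomial.smult (-1) ([:0, 1:] ^ j)"
  have "f \<noteq> 0"
  proof
    assume "f = 0"
    hence "[:0, 1 :: 'a:] ^ i = [:0, 1:] ^ j" by (simp add: f_def)
    hence "degree ([:0, 1 :: 'a:] ^ i) = degree ([:0, 1 :: 'a:] ^ j)" by simp
    with ij(2) show False by (simp add: degree_power_eq)
  qed
  moreover have "mat_eval A f = 0\<^sub>m n n"
  proof -
    have "M j \<in> carrier_mat n n" by (simp add: M_def A)
    hence "M j + (-1) \<cdot>\<^sub>m M j = 0\<^sub>m n n" by (intro eq_matI) auto
    moreover have "mat_eval A f = M i + (-1) \<cdot>\<^sub>m M j"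
      by (simp only: f_def mat_eval_add[OF A] mat_eval_smult[OF A] M_def)
    ultimately show ?thesis by (simp only: ij(1))
  qed
  ultimately show thesis by (rule that)
qed

text \<open>A representation of x modulo an annihilating polynomial becomes, on evaluation at A, a
  representation of A by elements of F_q[A].\<close>

theorem waring_matrix:
  fixes A :: "'a :: {field, finite} mat"
  assumes W: "\<And>(K :: 'a alg_closure set) e. finite_subfield K \<Longrightarrow> card K = CARD('a) ^ e \<Longrightarrow>
      finite_subfield.waring K k m"
    and k: "0 < k" "of_nat k \<noteq> (0 :: 'a)" and m: "0 < m" and A: "A \<in> carrier_mat n n"
  shows "\<exists>B :: nat \<Rightarrow> 'a mat. (\<forall>i\<in>{1..m}. B i \<in> poly_algebra_mat A \<and> B i \<in> carrier_mat n n) \<and>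
    A = finsum (ring_mat TYPE('a) n ()) (\<lambda>i. B i ^\<^sub>m k) {1..m}"
proof -
  obtain f where f: "f \<noteq> 0" "mat_eval A f = 0\<^sub>m n n" using annihilating_polynomial[OF A] by blast
  have "waring_mod k m [:0, 1:] f" by (rule waring_polynomial[OF _ k m f(1)]) (rule W)
  then obtain P :: "nat \<Rightarrow> 'a poly" where "f dvd [:0, 1:] - (\<Sum>i<m. P i ^ k)"
    by (auto simp: waring_mod_def)
  then obtain g where "[:0, 1:] - (\<Sum>i<m. P i ^ k) = f * g" by blast
  hence "[:0, 1:] = (\<Sum>i<m. P i ^ k) + f * g" by (simp add: algebra_simps)
  hence "A = mat_eval A ((\<Sum>i<m. P i ^ k) + f * g)" using mat_eval_X[OF A] by simp
  also have "\<dots> = mat_eval A (\<Sum>i<m. P i ^ k)"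
    unfolding mat_eval_add[OF A] mat_eval_mult[OF A] f(2)
    by (simp add: left_mult_zero_mat[OF mat_eval_carrier[OF A]] right_add_zero_mat[OF mat_eval_carrier[OF A]])
  also have "(\<Sum>i<m. P i ^ k) = (\<Sum>i\<in>{1..m}. P (i - 1) ^ k)"
    by (rule sum.reindex_bij_witness[of _ "\<lambda>i. i - 1" Suc]) auto
  also have "mat_eval A \<dots> = finsum (ring_mat TYPE('a) n ()) (\<lambda>i. mat_eval A (P (i - 1)) ^\<^sub>m k) {1..m}"
    by (simp add: mat_eval_sum[OF A] mat_eval_power[OF A])
  finally show ?thesis
    using mat_eval_carrier[OF A] poly_mat_eq_mat_eval[OF A]
    by (intro exI[of _ "\<lambda>i. mat_eval A (P (i - 1))"]) (auto simp: poly_algebra_mat_def)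
qed

section \<open>The list of triples\<close>

text \<open>Each perfect power is paired with each of its bases, so 64 occurs three times. The bases
  stop at 30 because 31^2 exceeds 911.\<close>

definition perfect_powers :: "(int \<times> int) list" where
  "perfect_powers = [
    (4,2), (8,2), (9,3), (16,2), (16,4), (25,5), (27,3), (32,2), (36,6), (49,7), (64,2), (64,4),
    (64,8), (81,3), (81,9), (100,10), (121,11), (125,5), (128,2), (144,12), (169,13), (196,14),
    (216,6), (225,15), (243,3), (256,2), (256,4), (256,16), (289,17), (324,18), (343,7), (361,19)
    , (400,20), (441,21), (484,22), (512,2), (512,8), (529,23), (576,24), (625,5), (625,25),
    (676,26), (729,3), (729,9), (729,27), (784,28), (841,29), (900,30)]"

text \<open>911 is the largest number listed explicitly in the sets \<open>Q\<close>.\<close>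

lemma perfect_powers_complete:
  assumes "2 \<le> b" "2 \<le> e" "b ^ e \<le> (911 :: nat)"
  shows "(int (b ^ e), int b) \<in> set perfect_powers"
proof -
  have "b \<le> 30"
  proof (rule ccontr)
    assume "\<not> b \<le> 30"
    hence "31 ^ 2 \<le> b ^ 2" by (intro power_mono) auto
    also have "\<dots> \<le> b ^ e" using assms by (intro power_increasing) auto
    finally show False using assms by simp
  qed
  hence b: "int b \<in> set [2..30]" unfolding set_upto atLeastAtMost_iff using assms(1) by simp
  have "e < 10"
  proof (rule ccontr)
    assume "\<not> e < 10"
    hence "(2 :: nat) ^ 10 \<le> 2 ^ e" by (intro power_increasing) auto
    also have "\<dots> \<le> b ^ e" using assms by (intro power_mono) auto
    finally show False using assms by simp
  qed
  hence e: "e \<in> set [2..<10]" unfolding set_upt atLeastLessThan_iff using assms(2) by simp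
  have "\<forall>b\<in>set [2..30]. \<forall>e\<in>set [2..<10]. b ^ e \<le> 911 \<longrightarrow> (b ^ e, b) \<in> set perfect_powers"
    by code_simp
  hence "int b ^ e \<le> 911 \<longrightarrow> (int b ^ e, int b) \<in> set perfect_powers" using b e by blast
  moreover have "int b ^ e \<le> 911" using assms(3) by (simp flip: of_nat_power)
  ultimately show ?thesis by simp
qed

text \<open>Closure of the excluded set under roots, as a finite test. Only S is inspected, since
  the roots of a power of a prime are powers of the same prime.\<close>

definition roots_closed :: "nat set \<Rightarrow> nat set \<Rightarrow> bool" where
  "roots_closed S P \<longleftrightarrow>
     (\<forall>n\<in>S. n \<le> 911) \<and> (\<forall>(n, b)\<in>set perfect_powers. n \<in> int ` S \<longrightarrow> b \<in> int ` (S \<union> P))"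

text \<open>This carries the hypothesis on F_q over to its finite extensions, which is where the
  residue fields lie.\<close>

lemma power_notin_with_powers:
  assumes S: "roots_closed S P" and P: "\<And>p. p \<in> P \<Longrightarrow> prime p"
    and c: "2 \<le> c" "c \<notin> with_powers S P" and e: "2 \<le> c ^ e"
  shows "c ^ e \<notin> with_powers S P"
proof
  assume "c ^ e \<in> with_powers S P"
  then consider "c ^ e \<in> S" | p s where "p \<in> P" "c ^ e = p ^ s" "1 \<le> s"
    by (auto simp: with_powers_def)
  thus False
  proof cases
    case 1
    show ?thesis
    proof (cases "e < 2")
      case True
      hence "e = 0 \<or> e = 1" by auto
      thus ?thesis using 1 c e by (auto simp: with_powers_def)
    next
      case False
      have "c ^ e \<le> 911" using S 1 by (auto simp: roots_closed_def)
      from perfect_powers_complete[OF c(1) _ this] False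
      have "(int (c ^ e), int c) \<in> set perfect_powers" by simp
      with S have "int (c ^ e) \<in> int ` S \<longrightarrow> int c \<in> int ` (S \<union> P)" unfolding roots_closed_def by blast
      with 1 have "c \<in> S \<union> P" by (auto simp del: of_nat_power)
      moreover have "c \<in> with_powers S P" if "c \<in> P"
        unfolding with_powers_def using that by (intro UnI2 CollectI exI[of _ c] exI[of _ 1]) auto
      ultimately show ?thesis using c by (auto simp: with_powers_def)
    qed
  next
    case (2 p s)
    have "0 < e" using e by (intro gr0I) auto
    hence "c dvd p ^ s" unfolding 2(2)[symmetric] by (intro dvd_power) auto
    then obtain t where "c = p ^ t" using divides_primepow_nat[OF P[OF 2(1)]] by blast
    moreover from this have "1 \<le> t" using c(1) by (cases t) auto
    ultimately show ?thesis using c(2) 2(1) by (auto simp: with_powers_def)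
  qed
qed

section \<open>The claim for residue fields, exponent by exponent\<close>

context finite_subfield
begin

lemma prime_not_dvd_q:
  assumes "q \<notin> with_powers S P" "p \<in> P" "prime p"
  shows "\<not> p dvd q"
proof
  assume "p dvd q"
  obtain r e where re: "prime r" "q = r ^ e" using q_prime_power by blast
  have "p dvd r" using \<open>p dvd q\<close> assms(3) unfolding re(2) by (rule prime_dvd_power[rotated])
  hence "p = r" using assms(3) re(1) primes_dvd_imp_eq by blast
  moreover have "1 \<le> e" using re q_ge_2 by (cases e) auto
  ultimately show False using assms(1,2) re(2) by (auto simp: with_powers_def)
qed

text \<open>The primes dividing k lie in P, and all their powers are excluded. So k is invertible in
  the field, as Hensel lifting requires.\<close>

lemma coprime_q:
  assumes "q \<notin> with_powers S P" "is_spec k spec" "fst ` set spec \<subseteq> P" "0 < k"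
  shows "coprime k q"
proof (rule ccontr)
  assume "\<not> ?thesis"
  hence "gcd k q \<noteq> 1" unfolding coprime_iff_gcd_eq_1 .
  from prime_factor_nat[OF this] obtain p where p: "prime p" "p dvd gcd k q" by (elim exE conjE)
  have "p dvd k" "p dvd q" using p(2) by simp_all
  hence "(p, int (k div p)) \<in> set spec" using assms(2) p(1) unfolding is_spec_def by blast
  hence "p \<in> fst ` set spec" by (rule image_eqI[rotated]) simp
  hence "p \<in> P" using assms(3) by blast
  from prime_not_dvd_q[OF assms(1) this p(1)] p(2) show False by simp
qed

text \<open>d stands for gcd k (q - 1). It is even if k is even and q odd, which leaves only even
  divisors to consider.\<close>

lemma gcd_cases:
  assumes "0 < k" "\<And>d. d dvd k \<Longrightarrow> d dvd q - 1 \<Longrightarrow> (2 dvd k \<and> odd q \<longrightarrow> 2 dvd d) \<Longrightarrow> waring d m"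
  shows "waring k m"
proof (rule waring_gcd)
  show "waring (gcd k (q - 1)) m" using q_ge_2 by (intro assms(2)) auto
qed fact

lemma odd_q: "q \<notin> with_powers S P \<Longrightarrow> 2 \<in> P \<Longrightarrow> odd q"
  by (rule prime_not_dvd_q) auto

lemma le_11_cases: "(d :: nat) \<le> 11 \<Longrightarrow> d \<in> {0, 1, 2, 3, 4, 5, 6, 7, 8, 9, 10, 11}"
  by (simp, arith)

lemma waring_case_3:
  assumes "2 \<le> m" and "q \<noteq> 4"
    and "required required_3 2 (int q) \<le> m"
  shows "waring 3 m"
proof (rule gcd_cases)
  fix d assume d: "d dvd 3" "d dvd q - 1" "2 dvd (3 :: nat) \<and> odd q \<longrightarrow> 2 dvd d"
  have "d \<le> 11" using dvd_imp_le[OF d(1)] by simp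
  from le_11_cases[OF this] have "d = 1 \<or> d = 3" using d(1,3) by auto
  thus "waring d m"
    using d(2) assms waring_1[OF \<open>2 \<le> m\<close>]
      waring_mono[OF waring_3 _] by auto
qed simp

lemma waring_case_4:
  assumes "odd q" and "3 \<le> m" and "q \<noteq> 9"
    and "required required_4 3 (int q) \<le> m"
  shows "waring 4 m"
proof (rule gcd_cases)
  fix d assume d: "d dvd 4" "d dvd q - 1" "2 dvd (4 :: nat) \<and> odd q \<longrightarrow> 2 dvd d"
  have "d \<le> 11" using dvd_imp_le[OF d(1)] by simp
  from le_11_cases[OF this] have "d = 2 \<or> d = 4" using d(1,3) assms(1) by auto
  thus "waring d m"
    using d(2) assms waring_2[OF _ \<open>3 \<le> m\<close>]
      waring_mono[OF waring_4 _] by auto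
qed simp

lemma waring_case_5:
  assumes "2 \<le> m" and "q \<noteq> 16"
    and "required required_5 2 (int q) \<le> m"
  shows "waring 5 m"
proof (rule gcd_cases)
  fix d assume d: "d dvd 5" "d dvd q - 1" "2 dvd (5 :: nat) \<and> odd q \<longrightarrow> 2 dvd d"
  have "d \<le> 11" using dvd_imp_le[OF d(1)] by simp
  from le_11_cases[OF this] have "d = 1 \<or> d = 5" using d(1,3) by auto
  thus "waring d m"
    using d(2) assms waring_1[OF \<open>2 \<le> m\<close>]
      waring_mono[OF waring_5 _] by auto
qed simp

lemma waring_case_6:
  assumes "odd q" and "3 \<le> m" and "q \<noteq> 25"
    and "required required_6 3 (int q) \<le> m"
  shows "waring 6 m"
proof (rule gcd_cases)
  fix d assume d: "d dvd 6" "d dvd q - 1" "2 dvd (6 :: nat) \<and> odd q \<longrightarrow> 2 dvd d"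
  have "d \<le> 11" using dvd_imp_le[OF d(1)] by simp
  from le_11_cases[OF this] have "d = 2 \<or> d = 6" using d(1,3) assms(1) by auto
  thus "waring d m"
    using d(2) assms waring_2[OF _ \<open>3 \<le> m\<close>]
      waring_mono[OF waring_6 _] by auto
qed simp

lemma waring_case_7:
  assumes "2 \<le> m" and "q \<noteq> 8"
    and "required required_7 2 (int q) \<le> m"
  shows "waring 7 m"
proof (rule gcd_cases)
  fix d assume d: "d dvd 7" "d dvd q - 1" "2 dvd (7 :: nat) \<and> odd q \<longrightarrow> 2 dvd d"
  have "d \<le> 11" using dvd_imp_le[OF d(1)] by simp
  from le_11_cases[OF this] have "d = 1 \<or> d = 7" using d(1,3) by auto
  thus "waring d m"
    using d(2) assms waring_1[OF \<open>2 \<le> m\<close>]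
      waring_mono[OF waring_7 _] by auto
qed simp

text \<open>The gcd may also be 4, so the exceptions for exponent 4 count here: this is how 5, 13
  and 29 enter the sets for k = 8.\<close>

lemma waring_case_8:
  assumes "odd q" and "3 \<le> m" and "q \<noteq> 9" "q \<noteq> 49"
    and "required required_4 3 (int q) \<le> m" "required required_8 3 (int q) \<le> m"
  shows "waring 8 m"
proof (rule gcd_cases)
  fix d assume d: "d dvd 8" "d dvd q - 1" "2 dvd (8 :: nat) \<and> odd q \<longrightarrow> 2 dvd d"
  have "d \<le> 11" using dvd_imp_le[OF d(1)] by simp
  from le_11_cases[OF this] have "d = 2 \<or> d = 4 \<or> d = 8" using d(1,3) assms(1) by auto
  thus "waring d m"
    using d(2) assms waring_2[OF _ \<open>3 \<le> m\<close>]
      waring_mono[OF waring_4 _]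
      waring_mono[OF waring_8 _] by auto
qed simp

text \<open>The gcd may also be 3, which brings 4 and 7 into the sets for k = 9.\<close>

lemma waring_case_9:
  assumes "2 \<le> m" and "q \<noteq> 4" "q \<noteq> 64"
    and "required required_3 2 (int q) \<le> m" "required required_9 2 (int q) \<le> m"
  shows "waring 9 m"
proof (rule gcd_cases)
  fix d assume d: "d dvd 9" "d dvd q - 1" "2 dvd (9 :: nat) \<and> odd q \<longrightarrow> 2 dvd d"
  have "d \<le> 11" using dvd_imp_le[OF d(1)] by simp
  from le_11_cases[OF this] have "d = 1 \<or> d = 3 \<or> d = 9" using d(1,3) by auto
  thus "waring d m"
    using d(2) assms waring_1[OF \<open>2 \<le> m\<close>]
      waring_mono[OF waring_3 _]
      waring_mono[OF waring_9 _] by auto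
qed simp

lemma waring_case_10:
  assumes "odd q" and "3 \<le> m" and "q \<noteq> 81"
    and "required required_10 3 (int q) \<le> m"
  shows "waring 10 m"
proof (rule gcd_cases)
  fix d assume d: "d dvd 10" "d dvd q - 1" "2 dvd (10 :: nat) \<and> odd q \<longrightarrow> 2 dvd d"
  have "d \<le> 11" using dvd_imp_le[OF d(1)] by simp
  from le_11_cases[OF this] have "d = 2 \<or> d = 10" using d(1,3) assms(1) by auto
  thus "waring d m"
    using d(2) assms waring_2[OF _ \<open>3 \<le> m\<close>]
      waring_mono[OF waring_10 _] by auto
qed simp

lemma waring_case_11:
  assumes "2 \<le> m" and "q \<noteq> 23"
    and "required required_11 2 (int q) \<le> m"
  shows "waring 11 m"
proof (rule gcd_cases)
  fix d assume d: "d dvd 11" "d dvd q - 1" "2 dvd (11 :: nat) \<and> odd q \<longrightarrow> 2 dvd d"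
  have "d \<le> 11" using dvd_imp_le[OF d(1)] by simp
  from le_11_cases[OF this] have "d = 1 \<or> d = 11" using d(1,3) by auto
  thus "waring d m"
    using d(2) assms waring_1[OF \<open>2 \<le> m\<close>]
      waring_mono[OF waring_11 _] by auto
qed simp

text \<open>In each triple, Q contains every exceptional size whose required number of summands
  exceeds m.\<close>

lemma waring_triples_imp_waring:
  assumes "(k, Q, m) \<in> waring_triples" "q \<notin> Q"
  shows "waring k m"
proof -
  have "\<forall>(k, Q, m)\<in>waring_triples. q \<notin> Q \<longrightarrow> waring k m"
    unfolding waring_triples_def ball_simps split_conv
    by (intro conjI impI TrueI;
        (rule waring_case_3 waring_case_5 waring_case_7 waring_case_9 waring_case_11
         | (rule waring_case_4 waring_case_6 waring_case_8 waring_case_10, rule odd_q, assumption, simp));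
        simp add: with_powers_def required_3_def required_4_def required_5_def required_6_def
          required_7_def required_8_def required_9_def required_10_def required_11_def)
  thus ?thesis using assms by blast
qed

end

lemma waring_triples_shape:
  assumes "(k, Q, m) \<in> waring_triples"
  shows "0 < k \<and> 0 < m \<and> (\<exists>S P spec. Q = with_powers S P \<and> roots_closed S P \<and> (\<forall>p\<in>P. prime p)
    \<and> is_spec k spec \<and> fst ` set spec \<subseteq> P)"
proof -
  have I: "0 < k \<and> 0 < m \<and> (\<exists>S P spec. with_powers S' P' = with_powers S P \<and> roots_closed S P \<and> (\<forall>p\<in>P. prime p)
    \<and> is_spec k spec \<and> fst ` set spec \<subseteq> P)"
    if "is_spec k spec" "0 < k" "0 < m" "fst ` set spec \<subseteq> P'" "\<forall>p\<in>P'. prime p" "roots_closed S' P'"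
    for k m :: nat and S' P' spec
    using that by blast
  have "\<forall>(k, Q, m)\<in>waring_triples. 0 < k \<and> 0 < m \<and> (\<exists>S P spec. Q = with_powers S P \<and> roots_closed S P
    \<and> (\<forall>p\<in>P. prime p) \<and> is_spec k spec \<and> fst ` set spec \<subseteq> P)"
    unfolding waring_triples_def ball_simps split_conv
    by (intro I[OF spec_3] I[OF spec_4] I[OF spec_5] I[OF spec_6] I[OF spec_7] I[OF spec_8]
          I[OF spec_9] I[OF spec_10] I[OF spec_11] conjI TrueI)
       (simp_all add: roots_closed_def, code_simp+)
  thus ?thesis using assms by blast
qed

theorem theorem4p2:
  fixes k m n :: nat and Q :: "nat set" and A :: "'a :: {field, finite} mat"
  assumes "(k, Q, m) \<in> waring_triples"
    and "CARD('a) \<notin> Q"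
    and "0 < n"
    and "A \<in> carrier_mat n n"
  shows
    "(\<exists>B :: nat \<Rightarrow> 'a mat.
        (\<forall>i \<in> {1..m}. B i \<in> carrier_mat n n) \<and>
        A = finsum (ring_mat TYPE('a) n ()) (\<lambda>i. B i ^\<^sub>m k) {1..m}) \<and>
     (\<exists>B :: nat \<Rightarrow> 'a mat.
        (\<forall>i \<in> {1..m}. B i \<in> poly_algebra_mat A) \<and>
        A = finsum (ring_mat TYPE('a) n ()) (\<lambda>i. B i ^\<^sub>m k) {1..m})"
proof -
  note shape = waring_triples_shape[OF assms(1)]
  have k: "0 < k" and m: "0 < m" using shape by simp_all
  from conjunct2[OF conjunct2[OF shape]] obtain S P spec
    where Q: "Q = with_powers S P" "roots_closed S P" and P: "\<forall>p\<in>P. prime p"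
      and spec: "is_spec k spec" "fst ` set spec \<subseteq> P"
    by (elim exE conjE)
  interpret U: finite_subfield "UNIV :: 'a set" by unfold_locales simp_all
  have Uq: "U.q = CARD('a)" by (simp add: U.q_def)
  have k0: "of_nat k \<noteq> (0 :: 'a)"
  proof
    assume z: "of_nat k = (0 :: 'a)"
    have "coprime k CARD('a)"
      using U.coprime_q[of S P k spec] assms(2) Q(1) spec k by (simp add: Uq)
    moreover have "of_nat CARD('a) = (0 :: 'a)" using U.of_nat_q by (simp add: Uq)
    \<comment> \<open>Bezout writes 1 through k and q, which would both vanish in F_q.\<close>
    moreover obtain x y where "k * x = CARD('a) * y + gcd k CARD('a)"
      using bezout_nat[of k "CARD('a)"] k by auto
    ultimately have "of_nat (k * x) = (1 :: 'a)" by simp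
    with z show False by simp
  qed
  have W: "finite_subfield.waring K k m"
    if K: "finite_subfield K" "card K = CARD('a) ^ e" for K :: "'a alg_closure set" and e
  proof -
    interpret finite_subfield K by fact
    have q: "q = CARD('a) ^ e" using K(2) by (simp add: q_def)
    have "CARD('a) ^ e \<notin> with_powers S P"
    proof (rule power_notin_with_powers[OF Q(2)])
      show "2 \<le> CARD('a)" "2 \<le> CARD('a) ^ e" using U.q_ge_2 q_ge_2 unfolding Uq q by simp_all
      show "CARD('a) \<notin> with_powers S P" using assms(2) Q(1) by simp
    qed (use P in blast)
    hence "q \<notin> Q" unfolding Q(1) q .
    with assms(1) show ?thesis by (rule waring_triples_imp_waring)
  qed
  have "\<exists>B :: nat \<Rightarrow> 'a mat. (\<forall>i\<in>{1..m}. B i \<in> poly_algebra_mat A \<and> B i \<in> carrier_mat n n) \<and>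
      A = finsum (ring_mat TYPE('a) n ()) (\<lambda>i. B i ^\<^sub>m k) {1..m}"
    by (rule waring_matrix[OF _ k k0 m assms(4)]) (erule W)
  then obtain B :: "nat \<Rightarrow> 'a mat"
    where B: "\<forall>i\<in>{1..m}. B i \<in> poly_algebra_mat A \<and> B i \<in> carrier_mat n n"
      and A: "A = finsum (ring_mat TYPE('a) n ()) (\<lambda>i. B i ^\<^sub>m k) {1..m}"
    by (elim exE conjE)
  from B have "\<forall>i\<in>{1..m}. B i \<in> poly_algebra_mat A" "\<forall>i\<in>{1..m}. B i \<in> carrier_mat n n" by blast+
  with A show ?thesis by (intro conjI exI[of _ B])
qed

end
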